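(* Let $c$ and $y$ be two non-negative integers. If the pair $(c,y)$ is $m$-effective, then $c>0$ and $y$ satisfies the inequality $0\le y\le \binom{c+1}{2}$. This inequality is sharp: for every integer $c>0$ both pairs $(c,0)$ and $\left(c,\binom{c+1}{2}\right)$ are $m$-effective.
   Context: The base field is $\mathbb{C}$. Let $A$ be a skew-symmetric $n\times n$ matrix of linear forms in $3$ variables, i.e. a $3$-dimensional linear subspace of the space of skew-symmetric $n\times n$ complex matrices. It has constant rank $r$ if every matrix obtained by specializing the $3$ variables to a nonzero point of $\mathbb{C}^3$ has rank $r$. Such a matrix defines a map of vector bundles $\mathcal{O}_{\mathbb{P}^2}(-1)^{n}\xrightarrow{A}\mathcal{O}_{\mathbb{P}^2}^{n}$ on $\mathbb{P}^2$, whose cokernel is a vector bundle of rank $n-r$; this is what is called the cokernel of $A$. Chern classes on $\mathbb{P}^2$ are regarded as integers. A pair of integers $(c,y)$ is $m$-effective if there exists a skew-symmetric matrix $A$ of linear forms in $3$ variables (spanning a $3$-dimensional space of matrices), having constant rank $2c$ and size $2c+2$, whose cokernel $E$ (a rank $2$ vector bundle on $\mathbb{P}^2$) has Chern classes $(c_1(E),c_2(E))=(c,y)$. *)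

theory Defs
  imports
    "Jordan_Normal_Form.DL_Rank"
    "Jordan_Normal_Form.Matrix_Kernel"
    "HOL-Library.Poly_Mapping"
    "HOL-Library.Numeral_Type"
    "HOL-Computational_Algebra.Polynomial"
begin

text \<open>
  The polynomial ring S = C[x0,x1,x2]: an element is a finitely supported function from
  exponent vectors to coefficients, with the convolution product of \<^theory>\<open>HOL-Library.Poly_Mapping\<close>.
\<close>

type_synonym mpoly3 = "(3 \<Rightarrow>\<^sub>0 nat) \<Rightarrow>\<^sub>0 complex"

definition eval3 :: "mpoly3 \<Rightarrow> (3 \<Rightarrow> complex) \<Rightarrow> complex" where
  "eval3 p v = (\<Sum>m\<in>Poly_Mapping.keys p.
     Poly_Mapping.lookup p m * (\<Prod>i\<in>UNIV. v i ^ Poly_Mapping.lookup m i))"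

text \<open>Forms of degree d. The zero polynomial is a form of every degree, and the only one if d < 0.\<close>

definition is_form :: "int \<Rightarrow> mpoly3 \<Rightarrow> bool" where
  "is_form d p \<longleftrightarrow> (\<forall>m\<in>Poly_Mapping.keys p. int (\<Sum>i\<in>UNIV. Poly_Mapping.lookup m i) = d)"

definition eval_mat :: "mpoly3 mat \<Rightarrow> (3 \<Rightarrow> complex) \<Rightarrow> complex mat" where
  "eval_mat A v = map_mat (\<lambda>p. eval3 p v) A"

definition skew_linear_matrix :: "nat \<Rightarrow> mpoly3 mat \<Rightarrow> bool" where
  "skew_linear_matrix n A \<longleftrightarrow>
     A \<in> carrier_mat n n \<and> transpose_mat A = - A \<and>
     (\<forall>i<n. \<forall>j<n. is_form 1 (A $$ (i, j)))"

text \<open>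
  The specializations of A form the image of the linear map sending v to A(v); they form a
  3-dimensional space exactly when this map has trivial kernel on C^3.
\<close>

definition spans_dim3 :: "nat \<Rightarrow> mpoly3 mat \<Rightarrow> bool" where
  "spans_dim3 n A \<longleftrightarrow> (\<forall>v. eval_mat A v = 0\<^sub>m n n \<longrightarrow> (\<forall>i. v i = 0))"

definition constant_rank :: "nat \<Rightarrow> nat \<Rightarrow> mpoly3 mat \<Rightarrow> bool" where
  "constant_rank n r A \<longleftrightarrow> (\<forall>v. (\<exists>i. v i \<noteq> 0) \<longrightarrow> vec_space.rank n (eval_mat A v) = r)"

text \<open>
  A list [d1,...,dm] of integers stands for the graded free S-module S(d1) + ... + S(dm)
  (direct sum), and for the associated bundle O(d1) + ... + O(dm) on the projective plane.
  A degree-preserving map S(d) \<rightarrow> S(d') is multiplication by a form of degree d' - d.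
\<close>

definition graded_map :: "int list \<Rightarrow> int list \<Rightarrow> mpoly3 mat \<Rightarrow> bool" where
  "graded_map L L' \<phi> \<longleftrightarrow>
     \<phi> \<in> carrier_mat (length L') (length L) \<and>
     (\<forall>i<length L'. \<forall>j<length L. is_form (L' ! i - L ! j) (\<phi> $$ (i, j)))"

definition mat_image :: "'a :: comm_ring_1 mat \<Rightarrow> 'a vec set" where
  "mat_image A = (\<lambda>w. A *\<^sub>v w) ` carrier_vec (dim_col A)"

text \<open>
  The sequence 0 \<rightarrow> L3 \<rightarrow> L2 \<rightarrow> L1 \<rightarrow> L0, with maps \<phi>3, \<phi>2, \<phi>1, is a graded free resolution of
  coker \<phi>1. The last modules may be 0 (empty lists). By Hilbert's syzygy theorem every graded map
  \<phi>1 between such modules extends to a resolution of this length.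
\<close>

definition graded_free_resolution ::
  "int list \<Rightarrow> int list \<Rightarrow> int list \<Rightarrow> int list \<Rightarrow> mpoly3 mat \<Rightarrow> mpoly3 mat \<Rightarrow> mpoly3 mat \<Rightarrow> bool" where
  "graded_free_resolution L0 L1 L2 L3 \<phi>1 \<phi>2 \<phi>3 \<longleftrightarrow>
     graded_map L1 L0 \<phi>1 \<and> graded_map L2 L1 \<phi>2 \<and> graded_map L3 L2 \<phi>3 \<and>
     mat_kernel \<phi>1 = mat_image \<phi>2 \<and>
     mat_kernel \<phi>2 = mat_image \<phi>3 \<and>
     mat_kernel \<phi>3 = {0\<^sub>v (length L3)}"

text \<open>
  Total Chern class of O(d1) + ... + O(dm). It is read in the Chow (or cohomology) ring
  Z[h]/(h^3) of the plane, where h is the class of a line and c(O(d)) = 1 + d h.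
\<close>

definition chern_sum_line_bundles :: "int list \<Rightarrow> int poly" where
  "chern_sum_line_bundles L = (\<Prod>d\<leftarrow>L. [:1, d:])"

text \<open>
  Chern classes of the sheaf E on the plane that is the cokernel of the map of bundles
  L1 \<rightarrow> L0 given by \<phi>1. Sheafification is exact, so a graded free resolution of coker \<phi>1 gives an
  exact sequence 0 \<rightarrow> L3 \<rightarrow> L2 \<rightarrow> L1 \<rightarrow> L0 \<rightarrow> E \<rightarrow> 0 of sheaves, and Whitney's formula reads
  c(E) c(L1) c(L3) = c(L0) c(L2) in Z[h]/(h^3). Since all these classes are units, it
  determines c1 and c2, and they do not depend on the chosen resolution.
\<close>

definition coker_has_chern_classes ::
  "int list \<Rightarrow> int list \<Rightarrow> mpoly3 mat \<Rightarrow> int \<Rightarrow> int \<Rightarrow> bool" where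
  "coker_has_chern_classes L0 L1 \<phi>1 c1 c2 \<longleftrightarrow>
     (\<exists>L2 L3 \<phi>2 \<phi>3. graded_free_resolution L0 L1 L2 L3 \<phi>1 \<phi>2 \<phi>3 \<and>
        [:0, 1:] ^ 3 dvd
          [:1, c1, c2:] * chern_sum_line_bundles L1 * chern_sum_line_bundles L3
          - chern_sum_line_bundles L0 * chern_sum_line_bundles L2)"

text \<open>The matrix A is regarded as a map from O(-1)^n to O^n.\<close>

definition m_effective :: "int \<Rightarrow> int \<Rightarrow> bool" where
  "m_effective c y \<longleftrightarrow>
     (\<exists>n r A. int n = 2 * c + 2 \<and> int r = 2 * c \<and>
        skew_linear_matrix n A \<and> spans_dim3 n A \<and> constant_rank n r A \<and>
        coker_has_chern_classes (replicate n 0) (replicate n (- 1)) A c y)"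

end

theory Submission
  imports Defs
begin

text \<open>
  Let \<open>E\<close> be the cokernel of a skew-symmetric matrix of linear forms as in the statement. The upper bound expresses
  that \<open>\<chi>(E(-1)) = h\<^sup>0(E(-1)) \<ge> 0\<close>: Riemann-Roch gives \<open>\<chi>(E(-1)) = c (c + 1) / 2 - y\<close>, and \<open>E(-1)\<close> has no higher
  cohomology since it is resolved on the left by \<open>O(-1)\<^sup>n\<close> and \<open>O(-2)\<^sup>n\<close>, which have no cohomology at all.

  In terms of a graded free resolution \<open>0 \<rightarrow> L3 \<rightarrow> L2 \<rightarrow> L1 \<rightarrow> L0\<close> the number \<open>\<chi>(E(-1))\<close> is
  \<open>\<chi>(L2(-1)) - \<chi>(L3(-1))\<close>, and each summand \<open>O(d)\<close> contributes \<open>d (d + 1) / 2\<close>. The comparison of \<open>L3\<close> with \<open>L2\<close>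
  splits into two injectivity statements for the last map \<open>\<phi>3\<close>. Positive \<open>d\<close> contribute the global sections of
  \<open>O(d - 1)\<close>, and there \<open>\<phi>3\<close> is injective as a map of modules in degree \<open>-1\<close>. Negative \<open>d\<close> contribute \<open>H\<^sup>2(O(d - 1))\<close>,
  which for large \<open>k\<close> is a graded piece of \<open>S/(x\<^sub>0\<^sup>k, x\<^sub>1\<^sup>k, x\<^sub>2\<^sup>k)\<close>; the injectivity there
  (\<open>resolution_injective_mod_powers\<close>) is local duality in disguise: the kernel would be made of torsion elements
  of degree \<open>-1\<close> in a module that starts in degree 0. Counting monomials gives
  \<open>resolution_twist_inequality\<close>, and Whitney's formula turns it into \<open>chern_class_bound\<close>.

  The extreme values are attained by explicit matrices. Both are built from the quadratic polynomial
  \<open>x\<^sub>0 + x\<^sub>1 t + x\<^sub>2 t\<^sup>2\<close> in an auxiliary variable \<open>t\<close>, so their kernels are spaces of solutions of a linear recurrence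
  of order two. For \<open>y = c (c + 1) / 2\<close> the matrix is \<open>(0, B\<^sup>T; -B, 0)\<close>, where \<open>B\<close> is the matrix of multiplication
  by this quadratic polynomial; the cokernel is the Steiner bundle \<open>coker B\<close>, resolved through the Buchsbaum-Rim
  complex of \<open>B\<^sup>T\<close>. For \<open>y = 0\<close> the cokernel is \<open>O + O(c)\<close>, and the matrix is a skew-symmetric matrix of odd size
  whose Pfaffians generate a Gorenstein ideal, enlarged by a zero row and column. The constant rank is read
  off from the recurrence (\<open>rank_eq_if_kernel_coordinates\<close>). Exactness of the resolutions is checked after inverting
  \<open>x\<^sub>0\<close> and after inverting \<open>x\<^sub>2\<close>, where solutions are determined by entries at one end, and
  \<open>exact_by_saturation\<close> descends it to the polynomial ring.
\<close>

section \<open>Polynomials in three variables and Koszul relations between powers\<close>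

abbreviation coef :: "mpoly3 \<Rightarrow> (3 \<Rightarrow>\<^sub>0 nat) \<Rightarrow> complex" where
  "coef \<equiv> Poly_Mapping.lookup"

abbreviation expo :: "(3 \<Rightarrow>\<^sub>0 nat) \<Rightarrow> 3 \<Rightarrow> nat" where
  "expo \<equiv> Poly_Mapping.lookup"

abbreviation expo_single :: "3 \<Rightarrow> nat \<Rightarrow> (3 \<Rightarrow>\<^sub>0 nat)" where
  "expo_single \<equiv> Poly_Mapping.single"

definition tdeg :: "(3 \<Rightarrow>\<^sub>0 nat) \<Rightarrow> nat" where
  "tdeg m = (\<Sum>i\<in>UNIV. expo m i)"

definition var :: "3 \<Rightarrow> mpoly3" where
  "var i = Poly_Mapping.single (expo_single i 1) 1"

lemma UNIV_three: "(UNIV :: 3 set) = {0, 1, 2}"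
proof -
  have "card {0, 1, 2 :: 3} = card (UNIV :: 3 set)" by simp
  then show ?thesis by (metis card_subset_eq finite top_greatest)
qed

lemma three_cases: "i = 0 \<or> i = 1 \<or> i = (2::3)"
  using UNIV_three by blast

lemma sum_three: "(\<Sum>i\<in>UNIV. f i) = f 0 + f 1 + f (2::3)" for f :: "3 \<Rightarrow> 'a :: comm_monoid_add"
  unfolding UNIV_three by (simp add: add.assoc)

lemma prod_three: "(\<Prod>i\<in>UNIV. f i) = f 0 * f 1 * f (2::3)" for f :: "3 \<Rightarrow> 'a :: comm_monoid_mult"
  unfolding UNIV_three by (simp add: mult.assoc)

text \<open>
  The support of the first factor is a single exponent vector, so the outer sum of the convolution
  collapses; multiplication by a term is a shift of coefficients.
\<close>
lemma coef_single_mult: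
  "coef (Poly_Mapping.single e c * p) m = c * Sum_any (\<lambda>q. coef p q when m = e + q)"
proof -
  have "coef (Poly_Mapping.single e c * p) m
      = Sum_any (\<lambda>l. coef (Poly_Mapping.single e c) l * Sum_any (\<lambda>q. coef p q when m = l + q))"
    by (rule lookup_mult)
  also have "\<dots> = Sum_any (\<lambda>l. c * Sum_any (\<lambda>q. coef p q when m = e + q) when l = e)"
    by (rule Sum_any.cong) (simp add: lookup_single when_def)
  finally show ?thesis by simp
qed

lemma coef_single_mult_add:
  "coef (Poly_Mapping.single e c * p) (e + m) = c * coef p m"
  by (simp add: coef_single_mult)

lemma coef_single_mult_none:
  assumes "\<And>m'. m \<noteq> e + m'"
  shows "coef (Poly_Mapping.single e c * p) m = 0"
  using assms by (simp add: coef_single_mult)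

lemma tdeg_add: "tdeg (a + b) = tdeg a + tdeg b"
  by (simp add: tdeg_def lookup_add sum.distrib)

lemma tdeg_single: "tdeg (expo_single i k) = k"
  by (simp add: tdeg_def lookup_single when_def)

lemma var_power: "var i ^ k = Poly_Mapping.single (expo_single i k) 1"
  by (induction k) (simp_all add: var_def mult_single single_add[symmetric])

lemma expo_split:
  assumes "k \<le> expo m i" shows "m = expo_single i k + (m - expo_single i k)"
  using assms by (intro poly_mapping_eqI) (auto simp: lookup_add lookup_minus lookup_single when_def)

lemma coef_var_power_mult:
  "coef (var i ^ k * p) m = (if k \<le> expo m i then coef p (m - expo_single i k) else 0)"
proof (cases "k \<le> expo m i")
  case True
  then show ?thesis using expo_split[OF True] coef_single_mult_add[of "expo_single i k" 1 p "m - expo_single i k"]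
    unfolding var_power by simp
next
  case False
  then have "m \<noteq> expo_single i k + m'" for m'
    by (auto simp: lookup_add)
  then show ?thesis using False coef_single_mult_none[of m "expo_single i k" 1 p] 
    unfolding var_power by auto
qed

text \<open>
  Quotient and remainder by the power \<open>x\<^sub>i\<^sup>k\<close>. Both operators only move or erase coefficients, so they
  are linear, keep forms homogeneous, and the remainder operators of different variables commute
  with multiplication by powers of the other variables.
\<close>
lift_definition div_var :: "3 \<Rightarrow> nat \<Rightarrow> mpoly3 \<Rightarrow> mpoly3" is
  "\<lambda>i k f m. f (m + expo_single i k)"
proof -
  fix i :: 3 and k :: nat and f :: "(3 \<Rightarrow>\<^sub>0 nat) \<Rightarrow> complex"
  assume "finite {m. f m \<noteq> 0}"
  then have "finite ((\<lambda>m. m + expo_single i k) -` {m. f m \<noteq> 0})"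
    by (rule finite_vimageI) (simp add: inj_on_def)
  then show "finite {m. f (m + expo_single i k) \<noteq> 0}" by (simp add: vimage_def)
qed

definition mod_var :: "3 \<Rightarrow> nat \<Rightarrow> mpoly3 \<Rightarrow> mpoly3" where
  "mod_var i k p = p - var i ^ k * div_var i k p"

lemma coef_mod_var: "coef (mod_var i k p) m = (if k \<le> expo m i then 0 else coef p m)"
proof (cases "k \<le> expo m i")
  case True
  then show ?thesis using expo_split[OF True]
    by (simp add: mod_var_def lookup_minus coef_var_power_mult div_var.rep_eq add.commute)
next
  case False
  then show ?thesis
    by (simp add: mod_var_def lookup_minus coef_var_power_mult)
qed

lemma div_mod_var: "p = var i ^ k * div_var i k p + mod_var i k p"
  by (simp add: mod_var_def)

lemma is_form_iff: "is_form d p \<longleftrightarrow> (\<forall>m. coef p m \<noteq> 0 \<longrightarrow> int (tdeg m) = d)"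
  by (simp add: is_form_def tdeg_def Ball_def in_keys_iff)

lemma is_form_0 [simp]: "is_form d 0"
  by (simp add: is_form_iff)

lemma is_form_1 [simp]: "is_form 0 1"
  by (simp add: is_form_iff lookup_one when_def tdeg_def)

lemma is_form_add: "is_form d p \<Longrightarrow> is_form d q \<Longrightarrow> is_form d (p + q)"
  by (auto simp: is_form_iff lookup_add) (metis add.left_neutral)

lemma is_form_uminus: "is_form d (- p) \<longleftrightarrow> is_form d p"
  by (simp add: is_form_iff)

lemma is_form_diff: "is_form d p \<Longrightarrow> is_form d q \<Longrightarrow> is_form d (p - q)"
  using is_form_add[of d p "- q"] by (simp add: is_form_uminus)

lemma is_form_sum: "(\<And>i. i \<in> I \<Longrightarrow> is_form d (f i)) \<Longrightarrow> is_form d (sum f I)"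
  by (induction I rule: infinite_finite_induct) (auto intro: is_form_add)

lemma is_form_mult:
  assumes "is_form d p" "is_form e q" shows "is_form (d + e) (p * q)"
  unfolding is_form_iff
proof (intro allI impI)
  fix m assume "coef (p * q) m \<noteq> 0"
  then have "m \<in> Poly_Mapping.keys (p * q)" by (simp add: in_keys_iff)
  then obtain a b where "a \<in> Poly_Mapping.keys p" "b \<in> Poly_Mapping.keys q" "m = a + b"
    using keys_mult[of p q] by auto
  moreover from this have "int (tdeg a) = d" "int (tdeg b) = e"
    using assms by (simp_all add: is_form_iff in_keys_iff)
  ultimately show "int (tdeg m) = d + e"
    by (simp add: tdeg_add)
qed

lemma is_form_var: "is_form 1 (var i)"
  by (simp add: is_form_iff var_def lookup_single when_def tdeg_single)

lemma is_form_power: "is_form d p \<Longrightarrow> is_form (int k * d) (p ^ k)"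
proof (induction k)
  case (Suc k)
  then show ?case using is_form_mult[of d p "int k * d" "p ^ k"] by (simp add: algebra_simps)
qed simp

lemma is_form_var_power: "is_form (int k) (var i ^ k)"
  using is_form_power[OF is_form_var, of k i] by simp

lemma is_form_negative: "is_form d p \<Longrightarrow> d < 0 \<Longrightarrow> p = 0"
  by (intro poly_mapping_eqI) (auto simp: is_form_iff)

lemma is_form_div_var: "is_form d p \<Longrightarrow> is_form (d - int k) (div_var i k p)"
  by (force simp: is_form_iff div_var.rep_eq tdeg_add tdeg_single)

lemma is_form_mod_var: "is_form d p \<Longrightarrow> is_form d (mod_var i k p)"
  by (auto simp: is_form_iff coef_mod_var)

lemma var_nonzero [simp]: "var i \<noteq> 0"
  by (metis var_def lookup_single_eq lookup_zero zero_neq_one)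

lemma mod_var_var_power_mult:
  assumes "i \<noteq> j" shows "mod_var i k (var j ^ l * p) = var j ^ l * mod_var i k p"
proof (rule poly_mapping_eqI)
  fix m
  show "coef (mod_var i k (var j ^ l * p)) m = coef (var j ^ l * mod_var i k p) m"
    using assms by (auto simp: coef_mod_var coef_var_power_mult lookup_minus lookup_single when_def)
qed

lemma mod_var_mult_self: "mod_var i k (var i ^ k * p) = 0"
  by (rule poly_mapping_eqI) (auto simp: coef_mod_var coef_var_power_mult)

lemma mod_var_add: "mod_var i k (p + q) = mod_var i k p + mod_var i k q"
  by (rule poly_mapping_eqI) (auto simp: coef_mod_var lookup_add)

lemma mod_var_0 [simp]: "mod_var i k 0 = 0"
  by (rule poly_mapping_eqI) (auto simp: coef_mod_var)

lemma mod_var_eq_0D: "mod_var i k p = 0 \<Longrightarrow> p = var i ^ k * div_var i k p"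
  using div_mod_var[of p i k] by simp

text \<open>
  Powers of two different variables form a regular sequence. The quotient \<open>e\<close> is obtained by
  \<^const>\<open>div_var\<close>, hence it is again a form when \<open>p\<close> is one; the degree bookkeeping below needs this.
\<close>
lemma koszul_exact2:
  assumes "i \<noteq> j" and "var i ^ k * p + var j ^ k * q = 0"
  shows "\<exists>e. p = var j ^ k * e \<and> q = - (var i ^ k * e) \<and> (\<forall>d. is_form d p \<longrightarrow> is_form (d - int k) e)"
proof -
  have "mod_var j k (var i ^ k * p + var j ^ k * q) = 0" using assms(2) by simp
  then have "var i ^ k * mod_var j k p = 0"
    using assms(1) by (simp add: mod_var_add mod_var_var_power_mult mod_var_mult_self)
  then have p: "p = var j ^ k * div_var j k p"
    using mod_var_eq_0D[of j k p] by simp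
  have "var j ^ k * (var i ^ k * div_var j k p + q) = 0"
    using assms(2) arg_cong[OF p, of "\<lambda>p. var i ^ k * p"] by (simp add: distrib_left mult.left_commute)
  then have "q = - (var i ^ k * div_var j k p)"
    by (simp add: eq_neg_iff_add_eq_0 add.commute)
  then show ?thesis using p is_form_div_var by blast
qed

text \<open>
  Exactness of the Koszul complex of \<open>x\<^sub>0\<^sup>k, x\<^sub>1\<^sup>k, x\<^sub>2\<^sup>k\<close> in its second term, in a graded form. Dividing
  \<open>p0\<close> by \<open>x\<^sub>1\<^sup>k\<close> and then by \<open>x\<^sub>2\<^sup>k\<close> leaves a remainder \<open>r\<close> that involves neither power; reducing the
  relation modulo both gives \<open>x\<^sub>0\<^sup>k r = 0\<close>, and the two-variable case finishes the argument.
\<close>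
lemma koszul_exact3:
  assumes eq: "var 0 ^ k * p0 + var 1 ^ k * p1 + var 2 ^ k * p2 = 0"
    and "is_form d p0" "is_form d p1" "is_form d p2"
  shows "\<exists>a b e. p0 = var 1 ^ k * a + var 2 ^ k * b \<and> p1 = var 2 ^ k * e - var 0 ^ k * a \<and>
           p2 = - (var 0 ^ k * b) - var 1 ^ k * e \<and>
           is_form (d - int k) a \<and> is_form (d - int k) b \<and> is_form (d - int k) e"
proof -
  have ne: "(0::3) \<noteq> 1" "(0::3) \<noteq> 2" "(1::3) \<noteq> 2" by simp_all
  define a where "a = div_var 1 k p0"
  define b where "b = div_var 2 k (mod_var 1 k p0)"
  define r where "r = mod_var 2 k (mod_var 1 k p0)"
  have p0: "p0 = var 1 ^ k * a + var 2 ^ k * b + r"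
    using div_mod_var[of p0 1 k] div_mod_var[of "mod_var 1 k p0" 2 k]
    unfolding a_def b_def r_def by (simp add: add.assoc)
  have "mod_var 2 k (mod_var 1 k (var 0 ^ k * p0 + var 1 ^ k * p1 + var 2 ^ k * p2)) = 0"
    using eq by simp
  then have "var 0 ^ k * r = 0"
    using ne by (simp add: mod_var_add mod_var_var_power_mult mod_var_mult_self r_def)
  then have "r = 0" by simp
  then have p0': "p0 = var 1 ^ k * a + var 2 ^ k * b" using p0 by simp
  have "var 1 ^ k * (p1 + var 0 ^ k * a) + var 2 ^ k * (p2 + var 0 ^ k * b) = 0"
    using eq p0' by (simp add: algebra_simps)
  then obtain e where e: "p1 + var 0 ^ k * a = var 2 ^ k * e" "p2 + var 0 ^ k * b = - (var 1 ^ k * e)"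
      "\<forall>d. is_form d (p1 + var 0 ^ k * a) \<longrightarrow> is_form (d - int k) e"
    using koszul_exact2[OF ne(3)] by blast
  have fa: "is_form (d - int k) a" unfolding a_def using assms(2) by (rule is_form_div_var)
  have fb: "is_form (d - int k) b" unfolding b_def
    using assms(2) by (intro is_form_div_var is_form_mod_var)
  have "is_form d (p1 + var 0 ^ k * a)"
    using is_form_add[OF assms(3)] is_form_mult[OF is_form_var_power[of k 0] fa] by simp
  then have "is_form (d - int k) e" using e(3) by blast
  moreover have "p1 = var 2 ^ k * e - var 0 ^ k * a"
    using e(1) by (simp add: eq_diff_eq)
  moreover have "p2 = - (var 0 ^ k * b) - var 1 ^ k * e"
    using e(2) by (subst minus_diff_commute) (simp only: eq_diff_eq)
  ultimately show ?thesis using p0' fa fb by blast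
qed

section \<open>Dimension counts with monomials\<close>

text \<open>
  Gaussian elimination, phrased with arbitrary finite index sets for equations and unknowns, since
  both will be sets of pairs (position in a list of degrees, monomial).
\<close>
lemma underdetermined_system_has_solution:
  fixes a :: "'y \<Rightarrow> 'x \<Rightarrow> 'k :: field"
  assumes "finite Y" "finite X" "card Y < card X"
  shows "\<exists>f. (\<exists>x\<in>X. f x \<noteq> 0) \<and> (\<forall>y\<in>Y. (\<Sum>x\<in>X. a y x * f x) = 0)"
  using assms
proof (induction Y arbitrary: X a rule: finite_induct)
  case empty
  then obtain x where "x \<in> X" by fastforce
  then show ?case by (intro exI[of _ "\<lambda>_. 1"]) auto
next
  case (insert y Y)
  show ?case
  proof (cases "\<exists>x0\<in>X. a y x0 \<noteq> 0")
    case False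
    then obtain f where "\<exists>x\<in>X. f x \<noteq> 0" "\<forall>y\<in>Y. (\<Sum>x\<in>X. a y x * f x) = 0"
      using insert by (metis card_insert_disjoint less_SucI Suc_lessD)
    then show ?thesis using False by (intro exI[of _ f]) simp
  next
    case True
    then obtain x0 where x0: "x0 \<in> X" "a y x0 \<noteq> 0" by blast
    \<comment> \<open>Eliminate the unknown x0 by means of the equation y.\<close>
    define b where "b = (\<lambda>z x. a z x - a z x0 * a y x / a y x0)"
    have "card Y < card (X - {x0})"
      using insert x0 by simp
    then obtain f where f: "\<exists>x\<in>X - {x0}. f x \<noteq> 0" "\<forall>z\<in>Y. (\<Sum>x\<in>X - {x0}. b z x * f x) = 0"
      using insert.IH[of "X - {x0}" b] insert.prems by blast
    define s where "s = (\<Sum>x\<in>X - {x0}. a y x * f x)"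
    define g where "g = f(x0 := - s / a y x0)"
    have g: "(\<Sum>x\<in>X. a z x * g x) = (\<Sum>x\<in>X - {x0}. a z x * f x) - a z x0 * s / a y x0" for z
    proof -
      have "(\<Sum>x\<in>X. a z x * g x) = a z x0 * g x0 + (\<Sum>x\<in>X - {x0}. a z x * g x)"
        using x0 insert.prems by (intro sum.remove) auto
      also have "(\<Sum>x\<in>X - {x0}. a z x * g x) = (\<Sum>x\<in>X - {x0}. a z x * f x)"
        by (intro sum.cong) (auto simp: g_def)
      finally show ?thesis by (simp add: g_def)
    qed
    have "(\<Sum>x\<in>X - {x0}. b z x * f x) = (\<Sum>x\<in>X - {x0}. a z x * f x) - a z x0 * s / a y x0" for z
      by (simp add: b_def s_def algebra_simps sum_subtractf sum_distrib_left sum_divide_distrib)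
    then have "\<forall>z\<in>Y. (\<Sum>x\<in>X. a z x * g x) = 0"
      using f(2) g by simp
    moreover have "(\<Sum>x\<in>X. a y x * g x) = 0"
      using g[of y] x0 by (simp add: s_def)
    moreover have "\<exists>x\<in>X. g x \<noteq> 0"
      using f(1) by (auto simp: g_def)
    ultimately show ?thesis by blast
  qed
qed

text \<open>
  The dimension count in the only form in which it is used: if a vector of polynomials supported on
  the monomials in \<open>X\<close> is zero as soon as its image has no coefficient in \<open>Y\<close>, then
  \<open>|X| \<le> |Y|\<close>. Choosing \<open>Y\<close> smaller than the full support of the image computes modulo an ideal
  generated by monomials.
\<close>
lemma injective_on_coefficients_card_le:
  assumes \<phi>: "\<phi> \<in> carrier_mat nr nc" and fin: "finite X" "finite Y"
    and X: "X \<subseteq> {..<nc} \<times> UNIV" and Y: "Y \<subseteq> {..<nr} \<times> UNIV"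
    and inj: "\<And>h. h \<in> carrier_vec nc \<Longrightarrow> (\<And>i m. i < nc \<Longrightarrow> coef (h $ i) m \<noteq> 0 \<Longrightarrow> (i, m) \<in> X) \<Longrightarrow>
        (\<And>i m. (i, m) \<in> Y \<Longrightarrow> coef ((\<phi> *\<^sub>v h) $ i) m = 0) \<Longrightarrow> h = 0\<^sub>v nc"
  shows "card X \<le> card Y"
proof (rule ccontr)
  assume "\<not> card X \<le> card Y"
  then have "card Y < card X" by simp
  define a where "a = (\<lambda>(y :: nat \<times> (3 \<Rightarrow>\<^sub>0 nat)) (x :: nat \<times> (3 \<Rightarrow>\<^sub>0 nat)).
      coef (\<phi> $$ (fst y, fst x) * Poly_Mapping.single (snd x) 1) (snd y))"
  obtain f where f: "\<exists>x\<in>X. f x \<noteq> 0" "\<And>y. y \<in> Y \<Longrightarrow> (\<Sum>x\<in>X. a y x * f x) = 0"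
    using underdetermined_system_has_solution[OF fin(2,1) \<open>card Y < card X\<close>, of a] by blast
  define h where "h = vec nc (\<lambda>i. \<Sum>x\<in>X. if fst x = i then Poly_Mapping.single (snd x) (f x) else 0)"
  have coef_h: "coef (h $ i) m = (if (i, m) \<in> X then f (i, m) else 0)" if "i < nc" for i m
  proof -
    have "coef (h $ i) m = (\<Sum>x\<in>X. if x = (i, m) then f x else 0)"
      using that by (auto simp: h_def lookup_sum lookup_single when_def intro!: sum.cong split: prod.splits)
    then show ?thesis using fin by simp
  qed
  have "coef ((\<phi> *\<^sub>v h) $ i) m = 0" if im: "(i, m) \<in> Y" for i m
  proof -
    have i: "i < nr" using im Y by auto
    have "(\<phi> *\<^sub>v h) $ i = (\<Sum>j<nc. \<phi> $$ (i, j) * (\<Sum>x\<in>X. if fst x = j then Poly_Mapping.single (snd x) (f x) else 0))"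
      using \<phi> i by (simp add: h_def scalar_prod_def lessThan_atLeast0)
    also have "\<dots> = (\<Sum>x\<in>X. \<Sum>j<nc. if fst x = j then \<phi> $$ (i, j) * Poly_Mapping.single (snd x) (f x) else 0)"
      unfolding sum_distrib_left by (subst sum.swap) (auto intro!: sum.cong)
    also have "\<dots> = (\<Sum>x\<in>X. Poly_Mapping.single 0 (f x) * (\<phi> $$ (i, fst x) * Poly_Mapping.single (snd x) 1))"
      using X by (intro sum.cong) (auto simp: mult_single mult.left_commute)
    finally have "coef ((\<phi> *\<^sub>v h) $ i) m
        = (\<Sum>x\<in>X. coef (Poly_Mapping.single 0 (f x) * (\<phi> $$ (i, fst x) * Poly_Mapping.single (snd x) 1)) (0 + m))"
      by (simp add: lookup_sum)
    also have "\<dots> = (\<Sum>x\<in>X. a (i, m) x * f x)"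
      by (intro sum.cong refl) (subst coef_single_mult_add, simp add: a_def mult.commute)
    finally show ?thesis using f(2)[OF im] by simp
  qed
  then have "h = 0\<^sub>v nc"
    using coef_h by (intro inj) (auto simp: h_def split: if_splits)
  then have "f (i, m) = 0" if "(i, m) \<in> X" for i m
    using coef_h[of i m] that X by auto
  then show False using f(1) by auto
qed

definition monomials :: "int \<Rightarrow> (3 \<Rightarrow>\<^sub>0 nat) set" where
  "monomials d = {m. int (tdeg m) = d}"

definition monomial :: "nat \<Rightarrow> nat \<Rightarrow> nat \<Rightarrow> (3 \<Rightarrow>\<^sub>0 nat)" where
  "monomial a b c = expo_single 0 a + expo_single 1 b + expo_single 2 c"

lemma expo_monomial [simp]:
  "expo (monomial a b c) 0 = a" "expo (monomial a b c) 1 = b" "expo (monomial a b c) 2 = c"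
  by (simp_all add: monomial_def lookup_add lookup_single when_def)

lemma monomial_eqI:
  assumes "expo m 0 = expo m' 0" "expo m 1 = expo m' 1" "expo m 2 = expo m' 2"
  shows "m = m'"
proof (rule poly_mapping_eqI)
  fix i show "expo m i = expo m' i"
    using three_cases[of i] assms by (elim disjE) (simp_all only:)
qed

lemma tdeg_eq: "tdeg m = expo m 0 + expo m 1 + expo m 2"
  by (simp add: tdeg_def sum_three)

lemma bij_triples_monomials:
  "bij_betw (\<lambda>(a, b). monomial a b (D - a - b)) (SIGMA a:{..D}. {..D - a}) (monomials (int D))"
  by (rule bij_betw_byWitness[where f' = "\<lambda>m. (expo m 0, expo m 1)"])
    (auto simp: monomials_def tdeg_eq intro!: monomial_eqI)

lemma finite_monomials: "finite (monomials d)"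
proof (cases "d \<ge> 0")
  case True
  then show ?thesis using bij_betw_finite[OF bij_triples_monomials[of "nat d"]] by simp
next
  case False
  then show ?thesis by (simp add: monomials_def)
qed

lemma card_monomials:
  assumes "d \<ge> -2" shows "2 * int (card (monomials d)) = (d + 1) * (d + 2)"
proof (cases "d \<ge> 0")
  case True
  then obtain D where d: "d = int D" using nonneg_int_cases by blast
  have "card (monomials d) = (\<Sum>a\<le>D. Suc (D - a))"
    using bij_betw_same_card[OF bij_triples_monomials[of D]] by (simp add: d)
  also have "\<dots> = (\<Sum>a\<le>D. Suc a)"
    by (rule sum.nat_diff_reindex[of "\<lambda>a. Suc a" "Suc D", simplified lessThan_Suc_atMost, simplified])
  finally have "card (monomials d) = (\<Sum>a\<le>D. Suc a)" .
  moreover have "2 * int (\<Sum>a\<le>D. Suc a) = (int D + 1) * (int D + 2)"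
    by (induction D) (simp_all add: algebra_simps)
  ultimately show ?thesis by (simp add: d)
next
  case False
  then have "d = -1 \<or> d = -2" using assms by linarith
  then show ?thesis by (auto simp: monomials_def)
qed

text \<open>
  A basis of the degree \<open>d\<close> part of \<open>S/(x\<^sub>0\<^sup>k, x\<^sub>1\<^sup>k, x\<^sub>2\<^sup>k)\<close>.
\<close>
definition reduced_monomials :: "nat \<Rightarrow> int \<Rightarrow> (3 \<Rightarrow>\<^sub>0 nat) set" where
  "reduced_monomials k d = {m \<in> monomials d. \<forall>i. expo m i < k}"

lemma all_three: "(\<forall>i::3. P i) \<longleftrightarrow> P 0 \<and> P 1 \<and> P 2"
proof (intro iffI allI)
  fix i assume "P 0 \<and> P 1 \<and> P 2"
  then show "P i" using three_cases[of i] by (elim disjE) (simp_all only:)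
qed simp

text \<open>
  The ring \<open>S/(x\<^sub>0\<^sup>k, x\<^sub>1\<^sup>k, x\<^sub>2\<^sup>k)\<close> is Gorenstein with socle in degree \<open>3k - 3\<close>; on monomials its duality is
  the exponentwise complement to \<open>k - 1\<close>.
\<close>
definition complement :: "nat \<Rightarrow> (3 \<Rightarrow>\<^sub>0 nat) \<Rightarrow> (3 \<Rightarrow>\<^sub>0 nat)" where
  "complement k m = monomial (k - 1 - expo m 0) (k - 1 - expo m 1) (k - 1 - expo m 2)"

lemma complement_complement:
  assumes "\<forall>i. expo m i < k" shows "complement k (complement k m) = m"
proof (rule monomial_eqI)
  show "expo (complement k (complement k m)) 0 = expo m 0"
    using spec[OF assms, of 0] by (simp add: complement_def)
  show "expo (complement k (complement k m)) 1 = expo m 1"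
    using spec[OF assms, of 1] by (simp add: complement_def del: One_nat_def)
  show "expo (complement k (complement k m)) 2 = expo m 2"
    using spec[OF assms, of 2] by (simp add: complement_def)
qed

lemma complement_less:
  assumes "\<forall>i. expo m i < k" shows "\<forall>i. expo (complement k m) i < k"
  using assms[rule_format, of 0] unfolding all_three by (simp add: complement_def del: One_nat_def)

lemma tdeg_complement:
  assumes "\<forall>i. expo m i < k" shows "int (tdeg (complement k m)) = 3 * int k - 3 - int (tdeg m)"
  using assms[rule_format, of 0] assms[rule_format, of 1] assms[rule_format, of 2]
  by (simp add: complement_def tdeg_eq of_nat_diff)

text \<open>
  For \<open>k\<close> large compared with \<open>e\<close> the bound on the exponents is automatic on the side of the
  monomials of degree \<open>e\<close>, so the duality is a bijection onto all of them.
\<close>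
lemma card_reduced_monomials:
  assumes "e < int k"
  shows "card (reduced_monomials k (3 * int k - 3 - e)) = card (monomials e)"
proof -
  have less: "\<forall>i. expo m i < k" if "m \<in> monomials e" for m
    using that assms unfolding all_three by (simp add: monomials_def tdeg_eq)
  have "bij_betw (complement k) (reduced_monomials k (3 * int k - 3 - e)) (monomials e)"
  proof (rule bij_betw_byWitness[where f' = "complement k"])
    show "\<forall>m\<in>reduced_monomials k (3 * int k - 3 - e). complement k (complement k m) = m"
      unfolding reduced_monomials_def by (blast intro: complement_complement)
    show "\<forall>m\<in>monomials e. complement k (complement k m) = m"
      using less by (intro ballI complement_complement) blast
    show "complement k ` reduced_monomials k (3 * int k - 3 - e) \<subseteq> monomials e"
    proof (rule image_subsetI)
      fix m assume "m \<in> reduced_monomials k (3 * int k - 3 - e)"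
      then have "\<forall>i. expo m i < k" "int (tdeg m) = 3 * int k - 3 - e"
        by (simp_all add: reduced_monomials_def monomials_def)
      then show "complement k m \<in> monomials e"
        unfolding monomials_def mem_Collect_eq by (subst tdeg_complement) auto
    qed
    show "complement k ` monomials e \<subseteq> reduced_monomials k (3 * int k - 3 - e)"
    proof (rule image_subsetI)
      fix m assume m: "m \<in> monomials e"
      then have "int (tdeg m) = e" by (simp add: monomials_def)
      then have "int (tdeg (complement k m)) = 3 * int k - 3 - e"
        by (subst tdeg_complement) (use less[OF m] in auto)
      then show "complement k m \<in> reduced_monomials k (3 * int k - 3 - e)"
        unfolding reduced_monomials_def monomials_def using complement_less[OF less[OF m]] by blast
    qed
  qed
  then show ?thesis by (rule bij_betw_same_card)
qed

lemma finite_reduced_monomials: "finite (reduced_monomials k d)"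
  unfolding reduced_monomials_def using finite_monomials by simp

section \<open>An inequality for free resolutions of length three\<close>

text \<open>
  Elements of degree \<open>t\<close> in the graded free module \<open>S(d\<^sub>1) + ... + S(d\<^sub>m)\<close>.
\<close>
definition graded_vec :: "int list \<Rightarrow> int \<Rightarrow> mpoly3 vec \<Rightarrow> bool" where
  "graded_vec L t w \<longleftrightarrow> w \<in> carrier_vec (length L) \<and> (\<forall>i<length L. is_form (L ! i + t) (w $ i))"

lemma mult_mat_vec_smult:
  fixes k :: "'a :: comm_ring_1"
  assumes A: "A \<in> carrier_mat nr nc" and v: "v \<in> carrier_vec nc"
  shows "A *\<^sub>v (k \<cdot>\<^sub>v v) = k \<cdot>\<^sub>v (A *\<^sub>v v)"
proof (rule eq_vecI)
  fix i assume "i < dim_vec (k \<cdot>\<^sub>v (A *\<^sub>v v))"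
  then have "i < nr" using A by auto
  then show "(A *\<^sub>v (k \<cdot>\<^sub>v v)) $ i = (k \<cdot>\<^sub>v (A *\<^sub>v v)) $ i"
    using A v by (auto simp: scalar_prod_def sum_distrib_left mult.left_commute intro!: sum.cong)
qed auto

lemma mult_mat_vec_index:
  assumes "A \<in> carrier_mat nr nc" "v \<in> carrier_vec nc" "i < nr"
  shows "(A *\<^sub>v v) $ i = (\<Sum>j<nc. A $$ (i, j) * v $ j)"
  using assms by (auto simp: scalar_prod_def lessThan_atLeast0)

lemma graded_map_carrier: "graded_map L L' \<phi> \<Longrightarrow> \<phi> \<in> carrier_mat (length L') (length L)"
  by (simp add: graded_map_def)

lemma graded_map_graded_vec:
  assumes "graded_map L L' \<phi>" "graded_vec L t w"
  shows "graded_vec L' t (\<phi> *\<^sub>v w)"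
proof -
  have "is_form (L' ! i + t) ((\<phi> *\<^sub>v w) $ i)" if i: "i < length L'" for i
  proof -
    have "is_form (L' ! i + t) (\<phi> $$ (i, j) * w $ j)" if "j < length L" for j
      using is_form_mult[of "L' ! i - L ! j" "\<phi> $$ (i, j)" "L ! j + t" "w $ j"] assms i that
      by (simp add: graded_map_def graded_vec_def)
    moreover have "(\<phi> *\<^sub>v w) $ i = (\<Sum>j<length L. \<phi> $$ (i, j) * w $ j)"
      using assms i by (intro mult_mat_vec_index) (auto simp: graded_map_def graded_vec_def)
    ultimately show ?thesis by (auto intro: is_form_sum)
  qed
  then show ?thesis using assms by (auto simp: graded_map_def graded_vec_def)
qed

text \<open>
  A form without reduced monomials lies in \<open>(x\<^sub>0\<^sup>k, x\<^sub>1\<^sup>k, x\<^sub>2\<^sup>k)\<close>, and the cofactors can be taken to be forms.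
\<close>
lemma decompose_nonreduced:
  assumes p: "is_form d p" and red: "\<And>m. m \<in> reduced_monomials k d \<Longrightarrow> coef p m = 0"
  shows "\<exists>a b e. p = var 0 ^ k * a + var 1 ^ k * b + var 2 ^ k * e \<and>
    is_form (d - int k) a \<and> is_form (d - int k) b \<and> is_form (d - int k) e"
proof -
  define q where "q = mod_var 0 k p"
  define r where "r = mod_var 1 k q"
  have "mod_var 2 k r = 0"
  proof (rule poly_mapping_eqI)
    fix m
    have "coef p m = 0" if "\<forall>i. expo m i < k"
      using red[of m] that p by (auto simp: reduced_monomials_def monomials_def is_form_iff)
    then show "coef (mod_var 2 k r) m = coef 0 m"
      unfolding all_three by (simp add: q_def r_def coef_mod_var not_le)
  qed
  then have "p = var 0 ^ k * div_var 0 k p + var 1 ^ k * div_var 1 k q + var 2 ^ k * div_var 2 k r"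
    using div_mod_var[of p 0 k] div_mod_var[of q 1 k] div_mod_var[of r 2 k]
    unfolding q_def[symmetric] r_def[symmetric] by (simp add: add.assoc)
  moreover have "is_form d q" "is_form d r"
    using p by (simp_all add: q_def r_def is_form_mod_var)
  ultimately show ?thesis using p is_form_div_var by blast
qed

lemma graded_vec_decompose_nonreduced:
  assumes w: "graded_vec L t w"
    and red: "\<And>i m. i < length L \<Longrightarrow> m \<in> reduced_monomials k (L ! i + t) \<Longrightarrow> coef (w $ i) m = 0"
  shows "\<exists>a b e. w = var 0 ^ k \<cdot>\<^sub>v a + var 1 ^ k \<cdot>\<^sub>v b + var 2 ^ k \<cdot>\<^sub>v e \<and>
    graded_vec L (t - int k) a \<and> graded_vec L (t - int k) b \<and> graded_vec L (t - int k) e"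
proof -
  have "\<exists>a b e. w $ i = var 0 ^ k * a + var 1 ^ k * b + var 2 ^ k * e \<and>
    is_form (L ! i + t - int k) a \<and> is_form (L ! i + t - int k) b \<and> is_form (L ! i + t - int k) e"
    if "i < length L" for i
    using decompose_nonreduced[of "L ! i + t" "w $ i" k] w red[OF that] that by (simp add: graded_vec_def)
  then obtain a b e where abe: "\<And>i. i < length L \<Longrightarrow> w $ i = var 0 ^ k * a i + var 1 ^ k * b i + var 2 ^ k * e i \<and>
    is_form (L ! i + t - int k) (a i) \<and> is_form (L ! i + t - int k) (b i) \<and> is_form (L ! i + t - int k) (e i)"
    by metis
  show ?thesis
    using w abe by (intro exI[of _ "vec (length L) a"] exI[of _ "vec (length L) b"] exI[of _ "vec (length L) e"])
      (auto simp: graded_vec_def add_diff_eq)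
qed

lemma koszul_exact3_vec:
  assumes "graded_vec L t p0" "graded_vec L t p1" "graded_vec L t p2"
    and eq: "var 0 ^ k \<cdot>\<^sub>v p0 + var 1 ^ k \<cdot>\<^sub>v p1 + var 2 ^ k \<cdot>\<^sub>v p2 = 0\<^sub>v (length L)"
  shows "\<exists>a b e. p0 = var 1 ^ k \<cdot>\<^sub>v a + var 2 ^ k \<cdot>\<^sub>v b \<and> p1 = var 2 ^ k \<cdot>\<^sub>v e - var 0 ^ k \<cdot>\<^sub>v a \<and>
           p2 = - (var 0 ^ k \<cdot>\<^sub>v b) - var 1 ^ k \<cdot>\<^sub>v e \<and>
           graded_vec L (t - int k) a \<and> graded_vec L (t - int k) b \<and> graded_vec L (t - int k) e"
proof -
  have "\<exists>a b e. p0 $ i = var 1 ^ k * a + var 2 ^ k * b \<and> p1 $ i = var 2 ^ k * e - var 0 ^ k * a \<and>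
           p2 $ i = - (var 0 ^ k * b) - var 1 ^ k * e \<and>
    is_form (L ! i + t - int k) a \<and> is_form (L ! i + t - int k) b \<and> is_form (L ! i + t - int k) e"
    if i: "i < length L" for i
  proof (rule koszul_exact3)
    have "(var 0 ^ k \<cdot>\<^sub>v p0 + var 1 ^ k \<cdot>\<^sub>v p1 + var 2 ^ k \<cdot>\<^sub>v p2) $ i = 0"
      using eq i by simp
    then show "var 0 ^ k * p0 $ i + var 1 ^ k * p1 $ i + var 2 ^ k * p2 $ i = 0"
      using assms(1-3) i by (auto simp: graded_vec_def add.assoc)
  qed (use assms(1-3) i in \<open>auto simp: graded_vec_def\<close>)
  then obtain a b e where abe: "\<And>i. i < length L \<Longrightarrow>
      p0 $ i = var 1 ^ k * a i + var 2 ^ k * b i \<and> p1 $ i = var 2 ^ k * e i - var 0 ^ k * a i \<and>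
      p2 $ i = - (var 0 ^ k * b i) - var 1 ^ k * e i \<and>
      is_form (L ! i + t - int k) (a i) \<and> is_form (L ! i + t - int k) (b i) \<and> is_form (L ! i + t - int k) (e i)"
    by metis
  show ?thesis
    using assms(1-3) abe by (intro exI[of _ "vec (length L) a"] exI[of _ "vec (length L) b"] exI[of _ "vec (length L) e"])
      (auto simp: graded_vec_def add_diff_eq)
qed

text \<open>
  A syzygy of \<open>x\<^sub>i\<^sup>k, x\<^sub>j\<^sup>k\<close> is a multiple of the trivial one by an element of degree \<open>t - k\<close>; in negative
  degree there is no such element.
\<close>
lemma common_multiple_vec_zero:
  assumes ij: "i \<noteq> j" and p: "graded_vec L t p" and q: "q \<in> carrier_vec (length L)"
    and eq: "var i ^ k \<cdot>\<^sub>v p + var j ^ k \<cdot>\<^sub>v q = 0\<^sub>v (length L)"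
    and neg: "\<And>d. d \<in> set L \<Longrightarrow> d + t < int k"
  shows "p = 0\<^sub>v (length L)" "q = 0\<^sub>v (length L)"
proof -
  have "p $ l = 0 \<and> q $ l = 0" if l: "l < length L" for l
  proof -
    have "(var i ^ k \<cdot>\<^sub>v p + var j ^ k \<cdot>\<^sub>v q) $ l = 0"
      using eq l by simp
    then have "var i ^ k * p $ l + var j ^ k * q $ l = 0"
      using p q l by (auto simp: graded_vec_def)
    from koszul_exact2[OF ij this] obtain e where e: "p $ l = var j ^ k * e" "q $ l = - (var i ^ k * e)"
       "is_form (L ! l + t - int k) e" using p l by (auto simp: graded_vec_def)
    have "e = 0" using e(3) neg[of "L ! l"] l by (intro is_form_negative[of "L ! l + t - int k"]) auto
    then show ?thesis using e by simp
  qed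
  then show "p = 0\<^sub>v (length L)" "q = 0\<^sub>v (length L)"
    using p q by (auto simp: graded_vec_def)
qed

lemma mat_image_iff: "A \<in> carrier_mat nr nc \<Longrightarrow> w \<in> mat_image A \<longleftrightarrow> (\<exists>v\<in>carrier_vec nc. w = A *\<^sub>v v)"
  by (auto simp: mat_image_def)

text \<open>
  The heart of the bound: \<open>\<phi>3\<close> stays injective modulo \<open>(x\<^sub>0\<^sup>k, x\<^sub>1\<^sup>k, x\<^sub>2\<^sup>k)\<close> in degree \<open>3k - 1\<close>. The kernel of the
  reduced map is \<open>Tor\<^sub>3(M, S/(x\<^sub>0\<^sup>k, x\<^sub>1\<^sup>k, x\<^sub>2\<^sup>k))\<close> for \<open>M = coker \<phi>1\<close>, which the Koszul complex identifies with the
  elements of \<open>M\<close> annihilated by the three powers, shifted by \<open>3k\<close>. In degree \<open>3k - 1\<close> these are elements of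
  \<open>M\<close> of degree \<open>-1\<close>, and there are none since \<open>L0\<close> starts in nonnegative degrees.
  
  The proof is the zigzag through the double complex, written out: \<open>\<phi>3 h\<close> is a combination of the powers with
  cofactors \<open>u\<^sub>i\<close>; the relation between the \<open>\<phi>2 u\<^sub>i\<close> is a Koszul relation with cofactors \<open>a, b, e\<close>; the images
  of these under \<open>\<phi>1\<close> vanish for degree reasons; then one lifts back along the resolution.
\<close>
lemma resolution_injective_mod_powers:
  assumes res: "graded_free_resolution L0 L1 L2 L3 \<phi>1 \<phi>2 \<phi>3"
    and L0: "\<And>d. d \<in> set L0 \<Longrightarrow> d \<le> 0"
    and h: "graded_vec L3 (3 * int k - 1) h"
    and red: "\<And>i m. i < length L2 \<Longrightarrow> m \<in> reduced_monomials k (L2 ! i + (3 * int k - 1)) \<Longrightarrow>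
        coef ((\<phi>3 *\<^sub>v h) $ i) m = 0"
    and i: "i < length L3" and m: "\<forall>j. expo m j < k"
  shows "coef (h $ i) m = 0"
proof -
  let ?X = "\<lambda>i. var i ^ k"
  let ?n1 = "length L1" and ?n2 = "length L2" and ?n3 = "length L3"
  have maps: "graded_map L1 L0 \<phi>1" "graded_map L2 L1 \<phi>2" "graded_map L3 L2 \<phi>3"
    and ker1: "mat_kernel \<phi>1 = mat_image \<phi>2" and ker2: "mat_kernel \<phi>2 = mat_image \<phi>3"
    and ker3: "mat_kernel \<phi>3 = {0\<^sub>v (length L3)}"
    using res by (simp_all add: graded_free_resolution_def)
  note c1 = graded_map_carrier[OF maps(1)] and c2 = graded_map_carrier[OF maps(2)]
    and c3 = graded_map_carrier[OF maps(3)]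
  have k1: "\<exists>v\<in>carrier_vec ?n2. w = \<phi>2 *\<^sub>v v" if "w \<in> carrier_vec ?n1" "\<phi>1 *\<^sub>v w = 0\<^sub>v (length L0)" for w
    using mat_kernelI[OF c1 that] ker1 mat_image_iff[OF c2] by simp
  have k2: "\<exists>v\<in>carrier_vec ?n3. w = \<phi>3 *\<^sub>v v" if "w \<in> carrier_vec ?n2" "\<phi>2 *\<^sub>v w = 0\<^sub>v ?n1" for w
    using mat_kernelI[OF c2 that] ker2 mat_image_iff[OF c3] by simp
  have k3: "w = 0\<^sub>v ?n3" if "w \<in> carrier_vec ?n3" "\<phi>3 *\<^sub>v w = 0\<^sub>v ?n2" for w
    using mat_kernelI[OF c3 that] ker3 by simp
  have z1: "\<phi>1 *\<^sub>v (\<phi>2 *\<^sub>v v) = 0\<^sub>v (length L0)" if "v \<in> carrier_vec ?n2" for v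
    using that ker1 mat_image_iff[OF c2, of "\<phi>2 *\<^sub>v v"] mat_kernelD(2)[OF c1] by blast
  have z2: "\<phi>2 *\<^sub>v (\<phi>3 *\<^sub>v v) = 0\<^sub>v ?n1" if "v \<in> carrier_vec ?n3" for v
    using that ker2 mat_image_iff[OF c3, of "\<phi>3 *\<^sub>v v"] mat_kernelD(2)[OF c2] by blast
  have hc: "h \<in> carrier_vec ?n3" using h by (simp add: graded_vec_def)
  \<comment> \<open>First step of the zigzag, in L2.\<close>
  obtain u0 u1 u2 where u: "\<phi>3 *\<^sub>v h = ?X 0 \<cdot>\<^sub>v u0 + ?X 1 \<cdot>\<^sub>v u1 + ?X 2 \<cdot>\<^sub>v u2"
      "graded_vec L2 (3 * int k - 1 - int k) u0" "graded_vec L2 (3 * int k - 1 - int k) u1"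
      "graded_vec L2 (3 * int k - 1 - int k) u2"
    using graded_vec_decompose_nonreduced[OF graded_map_graded_vec[OF maps(3) h] red] by blast
  have uc: "u0 \<in> carrier_vec ?n2" "u1 \<in> carrier_vec ?n2" "u2 \<in> carrier_vec ?n2"
    using u by (simp_all add: graded_vec_def)
  have "?X 0 \<cdot>\<^sub>v (\<phi>2 *\<^sub>v u0) + ?X 1 \<cdot>\<^sub>v (\<phi>2 *\<^sub>v u1) + ?X 2 \<cdot>\<^sub>v (\<phi>2 *\<^sub>v u2) = \<phi>2 *\<^sub>v (\<phi>3 *\<^sub>v h)"
    unfolding u(1) using uc c2
    by (simp del: assoc_add_vec add: mult_add_distrib_mat_vec[where nc = ?n2 and nr = ?n1, OF c2]  mult_mat_vec_smult[where nc = ?n2 and nr = ?n1, OF c2])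
  then have "?X 0 \<cdot>\<^sub>v (\<phi>2 *\<^sub>v u0) + ?X 1 \<cdot>\<^sub>v (\<phi>2 *\<^sub>v u1) + ?X 2 \<cdot>\<^sub>v (\<phi>2 *\<^sub>v u2) = 0\<^sub>v ?n1"
    using z2[OF hc] by simp
  \<comment> \<open>Second step, in L1: the cofactors have degree k - 1.\<close>
  from koszul_exact3_vec[OF u(2-4)[THEN graded_map_graded_vec[OF maps(2)]] this]
  obtain a b e where abe: "\<phi>2 *\<^sub>v u0 = ?X 1 \<cdot>\<^sub>v a + ?X 2 \<cdot>\<^sub>v b" "\<phi>2 *\<^sub>v u1 = ?X 2 \<cdot>\<^sub>v e - ?X 0 \<cdot>\<^sub>v a"
       "\<phi>2 *\<^sub>v u2 = - (?X 0 \<cdot>\<^sub>v b) - ?X 1 \<cdot>\<^sub>v e"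
      "graded_vec L1 (3 * int k - 1 - int k - int k) a" "graded_vec L1 (3 * int k - 1 - int k - int k) b"
      "graded_vec L1 (3 * int k - 1 - int k - int k) e"
    by blast
  have abec: "a \<in> carrier_vec ?n1" "b \<in> carrier_vec ?n1" "e \<in> carrier_vec ?n1"
    using abe by (simp_all add: graded_vec_def)
  have neg: "d + (3 * int k - 1 - int k - int k) < int k" if "d \<in> set L0" for d
    using L0[OF that] by simp
  have pc: "\<phi>1 *\<^sub>v a \<in> carrier_vec (length L0)" "\<phi>1 *\<^sub>v b \<in> carrier_vec (length L0)" "\<phi>1 *\<^sub>v e \<in> carrier_vec (length L0)"
    using c1 abec by (auto intro: mult_mat_vec_carrier)
  have "?X 1 \<cdot>\<^sub>v (\<phi>1 *\<^sub>v a) + ?X 2 \<cdot>\<^sub>v (\<phi>1 *\<^sub>v b) = \<phi>1 *\<^sub>v (\<phi>2 *\<^sub>v u0)"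
    unfolding abe(1) using abec c1
    by (simp add: mult_add_distrib_mat_vec[where nc = ?n1 and nr = "length L0", OF c1]  mult_mat_vec_smult[where nc = ?n1 and nr = "length L0", OF c1])
  then have "?X 1 \<cdot>\<^sub>v (\<phi>1 *\<^sub>v a) + ?X 2 \<cdot>\<^sub>v (\<phi>1 *\<^sub>v b) = 0\<^sub>v (length L0)"
    using z1[OF uc(1)] by simp
  from common_multiple_vec_zero[OF _ graded_map_graded_vec[OF maps(1) abe(4)] pc(2) this neg]
  have za: "\<phi>1 *\<^sub>v a = 0\<^sub>v (length L0)" and zb: "\<phi>1 *\<^sub>v b = 0\<^sub>v (length L0)" by simp_all
  have "?X 2 \<cdot>\<^sub>v (\<phi>1 *\<^sub>v e) - ?X 0 \<cdot>\<^sub>v (\<phi>1 *\<^sub>v a) = \<phi>1 *\<^sub>v (\<phi>2 *\<^sub>v u1)"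
    unfolding abe(2) using abec c1
    by (simp add: mult_minus_distrib_mat_vec[where nc = ?n1 and nr = "length L0", OF c1]  mult_mat_vec_smult[where nc = ?n1 and nr = "length L0", OF c1])
  moreover have "?X 2 \<cdot>\<^sub>v (\<phi>1 *\<^sub>v e) + ?X 0 \<cdot>\<^sub>v (\<phi>1 *\<^sub>v a) =
      ?X 2 \<cdot>\<^sub>v (\<phi>1 *\<^sub>v e) - ?X 0 \<cdot>\<^sub>v (\<phi>1 *\<^sub>v a)"
    unfolding za using c1 by (intro eq_vecI) auto
  ultimately have "?X 2 \<cdot>\<^sub>v (\<phi>1 *\<^sub>v e) + ?X 0 \<cdot>\<^sub>v (\<phi>1 *\<^sub>v a) = 0\<^sub>v (length L0)"
    using z1[OF uc(2)] by simp
  from common_multiple_vec_zero(1)[OF _ graded_map_graded_vec[OF maps(1) abe(6)] pc(1) this neg]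
  have ze: "\<phi>1 *\<^sub>v e = 0\<^sub>v (length L0)" by simp
  \<comment> \<open>Lifting back: a, b, e come from L2, hence the u_i differ from a Koszul combination by images of
    \<phi>3.\<close>
  obtain a' b' e' where l: "a = \<phi>2 *\<^sub>v a'" "b = \<phi>2 *\<^sub>v b'" "e = \<phi>2 *\<^sub>v e'"
     "a' \<in> carrier_vec ?n2" "b' \<in> carrier_vec ?n2" "e' \<in> carrier_vec ?n2"
    using k1[OF abec(1) za] k1[OF abec(2) zb] k1[OF abec(3) ze] by blast
  note dist = mult_add_distrib_mat_vec[where nc = ?n2 and nr = ?n1, OF c2]
    mult_minus_distrib_mat_vec[where nc = ?n2 and nr = ?n1, OF c2]  mult_mat_vec_smult[where nc = ?n2 and nr = ?n1, OF c2]
  have "\<phi>2 *\<^sub>v (u0 - (?X 1 \<cdot>\<^sub>v a' + ?X 2 \<cdot>\<^sub>v b')) = 0\<^sub>v ?n1"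
    using abe(1) l uc c2 by (simp add: dist)
  then obtain h0 where h0: "h0 \<in> carrier_vec ?n3" "u0 - (?X 1 \<cdot>\<^sub>v a' + ?X 2 \<cdot>\<^sub>v b') = \<phi>3 *\<^sub>v h0"
    using k2[of "u0 - (?X 1 \<cdot>\<^sub>v a' + ?X 2 \<cdot>\<^sub>v b')"] l uc by auto
  have "\<phi>2 *\<^sub>v (u1 - (?X 2 \<cdot>\<^sub>v e' - ?X 0 \<cdot>\<^sub>v a')) = 0\<^sub>v ?n1"
    using abe(2) l uc c2 by (simp add: dist)
  then obtain h1 where h1: "h1 \<in> carrier_vec ?n3" "u1 - (?X 2 \<cdot>\<^sub>v e' - ?X 0 \<cdot>\<^sub>v a') = \<phi>3 *\<^sub>v h1"
    using k2[of "u1 - (?X 2 \<cdot>\<^sub>v e' - ?X 0 \<cdot>\<^sub>v a')"] l uc by auto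
  have "\<phi>2 *\<^sub>v (u2 + ?X 0 \<cdot>\<^sub>v b' + ?X 1 \<cdot>\<^sub>v e') = - (?X 0 \<cdot>\<^sub>v b) - ?X 1 \<cdot>\<^sub>v e + ?X 0 \<cdot>\<^sub>v b + ?X 1 \<cdot>\<^sub>v e"
    using l uc c2 by (simp del: assoc_add_vec add: dist abe(3)[unfolded l])
  also have "\<dots> = 0\<^sub>v ?n1"
    using abec by (intro eq_vecI) auto
  finally obtain h2 where h2: "h2 \<in> carrier_vec ?n3" "u2 + ?X 0 \<cdot>\<^sub>v b' + ?X 1 \<cdot>\<^sub>v e' = \<phi>3 *\<^sub>v h2"
    using k2[of "u2 + ?X 0 \<cdot>\<^sub>v b' + ?X 1 \<cdot>\<^sub>v e'"] l uc by auto
  \<comment> \<open>The Koszul combinations cancel in the sum, so h and g have the same image.\<close>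
  define g where "g = ?X 0 \<cdot>\<^sub>v h0 + ?X 1 \<cdot>\<^sub>v h1 + ?X 2 \<cdot>\<^sub>v h2"
  have gc: "g \<in> carrier_vec ?n3" using h0 h1 h2 by (simp add: g_def)
  have "\<phi>3 *\<^sub>v g = ?X 0 \<cdot>\<^sub>v (\<phi>3 *\<^sub>v h0) + ?X 1 \<cdot>\<^sub>v (\<phi>3 *\<^sub>v h1) + ?X 2 \<cdot>\<^sub>v (\<phi>3 *\<^sub>v h2)"
    using h0(1) h1(1) h2(1) c3 unfolding g_def
    by (simp del: assoc_add_vec add: mult_add_distrib_mat_vec[where nc = ?n3 and nr = ?n2, OF c3]  mult_mat_vec_smult[where nc = ?n3 and nr = ?n2, OF c3])
  also have "\<dots> = \<phi>3 *\<^sub>v h"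
    unfolding h0(2)[symmetric] h1(2)[symmetric] h2(2)[symmetric] u(1) using uc l
    by (intro eq_vecI) (auto simp: algebra_simps)
  finally have "\<phi>3 *\<^sub>v (h - g) = 0\<^sub>v ?n2"
    using hc gc c3 by (simp add: mult_minus_distrib_mat_vec[where nc = ?n3 and nr = ?n2, OF c3])
  then have "h - g = 0\<^sub>v ?n3" using k3[of "h - g"] hc gc by simp
  then have "(h - g) $ i = 0" using i by simp
  then have "h $ i = ?X 0 * h0 $ i + ?X 1 * h1 $ i + ?X 2 * h2 $ i"
    using i hc gc h0 h1 h2 by (simp add: g_def)
  then show ?thesis
    using m by (simp add: lookup_add coef_var_power_mult all_three)
qed


text \<open>
  The numbers of monomials of degrees \<open>d - 1\<close> and \<open>-d - 2\<close> are the dimensions of \<open>H\<^sup>0(O(d-1))\<close> and \<open>H\<^sup>2(O(d-1))\<close>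
  on the plane. At most one of them is nonzero, and their sum is the Euler characteristic
  \<open>d (d + 1) / 2\<close>, whatever the sign of \<open>d\<close>.
\<close>
lemma sum_card_monomials:
  "2 * int (card (monomials (d - 1)) + card (monomials (- d - 2))) = d * (d + 1)"
proof -
  consider "d \<ge> 1" | "d = 0" | "d = -1" | "d \<le> -2" by linarith
  then show ?thesis
  proof cases
    case 1
    then have "monomials (- d - 2) = {}" by (auto simp: monomials_def)
    then show ?thesis using 1 card_monomials[of "d - 1"] by simp
  next
    case 4
    then have "monomials (d - 1) = {}" by (auto simp: monomials_def)
    then show ?thesis using 4 card_monomials[of "- d - 2"] by (simp add: algebra_simps)
  qed (simp_all add: monomials_def)
qed

definition graded_monomials :: "int list \<Rightarrow> int \<Rightarrow> (nat \<times> (3 \<Rightarrow>\<^sub>0 nat)) set" where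
  "graded_monomials L t = (SIGMA i:{..<length L}. monomials (L ! i + t))"

definition reduced_graded_monomials :: "nat \<Rightarrow> int list \<Rightarrow> int \<Rightarrow> (nat \<times> (3 \<Rightarrow>\<^sub>0 nat)) set" where
  "reduced_graded_monomials k L t = (SIGMA i:{..<length L}. reduced_monomials k (L ! i + t))"

lemma card_graded_monomials_le:
  assumes res: "graded_free_resolution L0 L1 L2 L3 \<phi>1 \<phi>2 \<phi>3"
  shows "card (graded_monomials L3 t) \<le> card (graded_monomials L2 t)"
proof (rule injective_on_coefficients_card_le)
  have maps: "graded_map L3 L2 \<phi>3" and ker3: "mat_kernel \<phi>3 = {0\<^sub>v (length L3)}"
    using res by (simp_all add: graded_free_resolution_def)
  show c3: "\<phi>3 \<in> carrier_mat (length L2) (length L3)" using maps by (rule graded_map_carrier)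
  fix h assume h: "h \<in> carrier_vec (length L3)"
    and supp: "\<And>i m. i < length L3 \<Longrightarrow> coef (h $ i) m \<noteq> 0 \<Longrightarrow> (i, m) \<in> graded_monomials L3 t"
    and zero: "\<And>i m. (i, m) \<in> graded_monomials L2 t \<Longrightarrow> coef ((\<phi>3 *\<^sub>v h) $ i) m = 0"
  have "graded_vec L3 t h"
    using h supp by (auto simp: graded_vec_def is_form_iff graded_monomials_def monomials_def)
  then have img: "graded_vec L2 t (\<phi>3 *\<^sub>v h)" using graded_map_graded_vec maps by blast
  have "(\<phi>3 *\<^sub>v h) $ i = 0" if i: "i < length L2" for i
  proof (rule poly_mapping_eqI)
    fix m
    have "is_form (L2 ! i + t) ((\<phi>3 *\<^sub>v h) $ i)"
      using img i unfolding graded_vec_def by blast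
    then have "coef ((\<phi>3 *\<^sub>v h) $ i) m \<noteq> 0 \<Longrightarrow> (i, m) \<in> graded_monomials L2 t"
      using i unfolding is_form_iff graded_monomials_def monomials_def by blast
    then show "coef ((\<phi>3 *\<^sub>v h) $ i) m = coef 0 m"
      using zero by (metis lookup_zero)
  qed
  then have "\<phi>3 *\<^sub>v h = 0\<^sub>v (length L2)"
    using c3 by (intro eq_vecI) (auto simp del: index_mult_mat_vec)
  then show "h = 0\<^sub>v (length L3)" using mat_kernelI[OF c3 h] ker3 by simp
qed (auto simp: graded_monomials_def finite_monomials)

lemma card_reduced_graded_monomials_le:
  assumes res: "graded_free_resolution L0 L1 L2 L3 \<phi>1 \<phi>2 \<phi>3"
    and L0: "\<And>d. d \<in> set L0 \<Longrightarrow> d \<le> 0"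
  shows "card (reduced_graded_monomials k L3 (3 * int k - 1)) \<le> card (reduced_graded_monomials k L2 (3 * int k - 1))"
proof (rule injective_on_coefficients_card_le)
  show "\<phi>3 \<in> carrier_mat (length L2) (length L3)"
    using res by (simp add: graded_free_resolution_def graded_map_carrier)
  fix h assume h: "h \<in> carrier_vec (length L3)"
    and supp: "\<And>i m. i < length L3 \<Longrightarrow> coef (h $ i) m \<noteq> 0 \<Longrightarrow>
        (i, m) \<in> reduced_graded_monomials k L3 (3 * int k - 1)"
    and zero: "\<And>i m. (i, m) \<in> reduced_graded_monomials k L2 (3 * int k - 1) \<Longrightarrow> coef ((\<phi>3 *\<^sub>v h) $ i) m = 0"
  have "graded_vec L3 (3 * int k - 1) h"
    using h supp by (auto simp: graded_vec_def is_form_iff reduced_graded_monomials_def reduced_monomials_def monomials_def)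
  note inj = resolution_injective_mod_powers[OF res L0 this]
  have red: "coef (h $ i) m = 0" if "i < length L3" "\<forall>j. expo m j < k" for i m
    by (rule inj) (use zero that in \<open>auto simp del: index_mult_mat_vec simp: reduced_graded_monomials_def\<close>)
  have "h $ i = 0" if i: "i < length L3" for i
  proof (rule poly_mapping_eqI)
    fix m show "coef (h $ i) m = coef 0 m"
    proof (cases "\<forall>j. expo m j < k")
      case True
      then show ?thesis using red[OF i] by simp
    next
      case False
      then have "(i, m) \<notin> reduced_graded_monomials k L3 (3 * int k - 1)"
        unfolding reduced_graded_monomials_def reduced_monomials_def by blast
      then show ?thesis using supp[OF i, of m] by auto
    qed
  qed
  then show "h = 0\<^sub>v (length L3)" using h by (intro eq_vecI) auto
qed (auto simp: reduced_graded_monomials_def finite_reduced_monomials)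

lemma sum_graded_monomials:
  assumes k: "\<And>d. d \<in> set L \<Longrightarrow> - d - 2 < int k"
  shows "2 * int (card (graded_monomials L (- 1)) + card (reduced_graded_monomials k L (3 * int k - 1)))
    = (\<Sum>d\<leftarrow>L. d * (d + 1))"
proof -
  have "card (graded_monomials L (- 1)) = (\<Sum>i<length L. card (monomials (L ! i - 1)))"
    unfolding graded_monomials_def by (subst card_SigmaI) (auto simp: finite_monomials)
  moreover have "card (reduced_graded_monomials k L (3 * int k - 1))
      = (\<Sum>i<length L. card (reduced_monomials k (L ! i + (3 * int k - 1))))"
    unfolding reduced_graded_monomials_def by (subst card_SigmaI) (auto simp: finite_reduced_monomials)
  moreover have "card (reduced_monomials k (L ! i + (3 * int k - 1))) = card (monomials (- (L ! i) - 2))"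
    if "i < length L" for i
    using card_reduced_monomials[of "- (L ! i) - 2" k] k[of "L ! i"] that by (simp add: algebra_simps)
  ultimately have "2 * int (card (graded_monomials L (- 1)) + card (reduced_graded_monomials k L (3 * int k - 1)))
      = (\<Sum>i<length L. 2 * int (card (monomials (L ! i - 1)) + card (monomials (- (L ! i) - 2))))"
    by (simp add: sum.distrib sum_distrib_left)
  also have "\<dots> = (\<Sum>i<length L. L ! i * (L ! i + 1))"
    unfolding sum_card_monomials ..
  also have "\<dots> = (\<Sum>d\<leftarrow>L. d * (d + 1))"
    by (simp add: sum_list_sum_nth lessThan_atLeast0)
  finally show ?thesis .
qed

text \<open>
  Both sides count, up to the factor 2, the sum of \<open>h\<^sup>0\<close> and \<open>h\<^sup>2\<close> of \<open>L3(-1)\<close> and of \<open>L2(-1)\<close>. The first part is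
  compared by the injectivity of \<open>\<phi>3\<close> in degree \<open>-1\<close>, the second one, by duality, by its
  injectivity modulo large powers of the variables.
\<close>
theorem resolution_twist_inequality:
  assumes res: "graded_free_resolution L0 L1 L2 L3 \<phi>1 \<phi>2 \<phi>3"
    and L0: "\<And>d. d \<in> set L0 \<Longrightarrow> d \<le> 0"
  shows "(\<Sum>d\<leftarrow>L3. d * (d + 1)) \<le> (\<Sum>d\<leftarrow>L2. d * (d + 1))"
proof -
  define k where "k = nat (\<Sum>d\<leftarrow>L2 @ L3. \<bar>d\<bar>)"
  have k: "- d - 2 < int k" if "d \<in> set (L2 @ L3)" for d
  proof -
    have "\<bar>d\<bar> \<le> (\<Sum>d\<leftarrow>L2 @ L3. \<bar>d\<bar>)"
      using that by (intro member_le_sum_list) auto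
    then show ?thesis unfolding k_def by linarith
  qed
  have "(\<Sum>d\<leftarrow>L. d * (d + 1)) =
      2 * int (card (graded_monomials L (- 1)) + card (reduced_graded_monomials k L (3 * int k - 1)))"
    if "set L \<subseteq> set (L2 @ L3)" for L
    by (rule sum_graded_monomials[symmetric]) (use k that in blast)
  then show ?thesis
    using card_graded_monomials_le[OF res, of "-1"] card_reduced_graded_monomials_le[OF res L0, of k] by simp
qed

section \<open>Chern classes and the upper bound\<close>

text \<open>
  Twice the Euler characteristic of \<open>E(-1)\<close> for a sheaf \<open>E\<close> on the plane with total Chern class \<open>P\<close>: by
  Riemann-Roch this number is independent of the rank. It is additive in exact sequences, so it turns
  products of Chern classes into sums.
\<close>
definition twist_number :: "int poly \<Rightarrow> int" where
  "twist_number P = (coeff P 1)\<^sup>2 - 2 * coeff P 2 + coeff P 1"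

lemma coeff_mult_1: "coeff (P * Q) 1 = coeff P 0 * coeff Q 1 + coeff P 1 * coeff Q 0"
  for P Q :: "int poly"
  by (simp add: coeff_mult)

lemma coeff_mult_2: "coeff (P * Q) 2 = coeff P 0 * coeff Q 2 + coeff P 1 * coeff Q 1 + coeff P 2 * coeff Q 0"
  for P Q :: "int poly"
  by (simp add: coeff_mult numeral_2_eq_2)

lemma twist_number_mult:
  assumes "coeff P 0 = 1" "coeff Q 0 = 1"
  shows "twist_number (P * Q) = twist_number P + twist_number Q"
  unfolding twist_number_def coeff_mult_1 coeff_mult_2 using assms
  by (simp add: power2_eq_square algebra_simps)

lemma coeff_chern_sum_0: "coeff (chern_sum_line_bundles L) 0 = 1"
  by (induction L) (simp_all add: chern_sum_line_bundles_def)

lemma coeff_chern_sum_1: "coeff (chern_sum_line_bundles L) 1 = sum_list L"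
proof (induction L)
  case (Cons d L)
  have "chern_sum_line_bundles (d # L) = [:1, d:] * chern_sum_line_bundles L"
    by (simp add: chern_sum_line_bundles_def)
  then show ?case
    using Cons coeff_chern_sum_0[of L] unfolding coeff_mult_1 by simp
qed (simp add: chern_sum_line_bundles_def)

lemma twist_number_chern_sum:
  "twist_number (chern_sum_line_bundles L) = (\<Sum>d\<leftarrow>L. d * (d + 1))"
proof (induction L)
  case Nil
  show ?case by (simp add: chern_sum_line_bundles_def twist_number_def)
next
  case (Cons d L)
  have "twist_number [:1, d:] = d * (d + 1)"
    by (simp add: twist_number_def numeral_2_eq_2 power2_eq_square algebra_simps)
  moreover have "chern_sum_line_bundles (d # L) = [:1, d:] * chern_sum_line_bundles L"
    by (simp add: chern_sum_line_bundles_def)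
  ultimately show ?case
    using Cons twist_number_mult[of "[:1, d:]" "chern_sum_line_bundles L"] coeff_chern_sum_0[of L]
    by simp
qed

text \<open>
  For classes with constant term 1 the coefficient of \<open>h\<^sup>2\<close> can be traded for the additive invariant.
\<close>
lemma congruent_mod_h3_iff:
  assumes "coeff P 0 = 1" "coeff Q 0 = 1"
  shows "[:0, 1:] ^ 3 dvd P - Q \<longleftrightarrow> coeff P 1 = coeff Q 1 \<and> twist_number P = twist_number Q"
proof -
  have "[:0, 1:] ^ 3 = (monom 1 3 :: int poly)"
    by (simp add: monom_altdef)
  then have "[:0, 1:] ^ 3 dvd P - Q \<longleftrightarrow> (\<forall>k<3. coeff (P - Q) k = 0)"
    by (simp add: monom_1_dvd_iff')
  also have "\<dots> \<longleftrightarrow> coeff P 0 = coeff Q 0 \<and> coeff P 1 = coeff Q 1 \<and> coeff P 2 = coeff Q 2"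
    by (auto simp: numeral_3_eq_3 numeral_2_eq_2 less_Suc_eq)
  also have "\<dots> \<longleftrightarrow> coeff P 1 = coeff Q 1 \<and> twist_number P = twist_number Q"
    using assms by (auto simp: twist_number_def)
  finally show ?thesis .
qed

lemma whitney_iff:
  "[:0, 1:] ^ 3 dvd [:1, c1, c2:] * chern_sum_line_bundles L1 * chern_sum_line_bundles L3
     - chern_sum_line_bundles L0 * chern_sum_line_bundles L2 \<longleftrightarrow>
   c1 + sum_list L1 + sum_list L3 = sum_list L0 + sum_list L2 \<and>
   c1\<^sup>2 - 2 * c2 + c1 + (\<Sum>d\<leftarrow>L1. d * (d + 1)) + (\<Sum>d\<leftarrow>L3. d * (d + 1)) =
     (\<Sum>d\<leftarrow>L0. d * (d + 1)) + (\<Sum>d\<leftarrow>L2. d * (d + 1))"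
proof -
  have c: "coeff [:1, c1, c2:] 1 = c1" "twist_number [:1, c1, c2:] = c1\<^sup>2 - 2 * c2 + c1" "coeff [:1, c1, c2:] 0 = 1"
    by (simp_all add: twist_number_def numeral_2_eq_2)
  let ?P = "[:1, c1, c2:] * chern_sum_line_bundles L1 * chern_sum_line_bundles L3"
  let ?Q = "chern_sum_line_bundles L0 * chern_sum_line_bundles L2"
  have 0: "coeff ([:1, c1, c2:] * chern_sum_line_bundles L1) 0 = 1" "coeff ?P 0 = 1" "coeff ?Q 0 = 1"
    unfolding coeff_mult_0 c coeff_chern_sum_0 by simp_all
  have "coeff ?P 1 = c1 + sum_list L1 + sum_list L3" "coeff ?Q 1 = sum_list L0 + sum_list L2"
    unfolding coeff_mult_1 coeff_mult_0 c coeff_chern_sum_0 coeff_chern_sum_1 by simp_all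
  moreover have "twist_number ?P = c1\<^sup>2 - 2 * c2 + c1 + (\<Sum>d\<leftarrow>L1. d * (d + 1)) + (\<Sum>d\<leftarrow>L3. d * (d + 1))"
    using twist_number_mult[OF 0(1) coeff_chern_sum_0[of L3]] twist_number_mult[OF c(3) coeff_chern_sum_0[of L1]]
    by (simp only: twist_number_chern_sum c(2))
  moreover have "twist_number ?Q = (\<Sum>d\<leftarrow>L0. d * (d + 1)) + (\<Sum>d\<leftarrow>L2. d * (d + 1))"
    using twist_number_mult[OF coeff_chern_sum_0[of L0] coeff_chern_sum_0[of L2]]
    by (simp only: twist_number_chern_sum)
  ultimately show ?thesis
    using congruent_mod_h3_iff[OF 0(2,3)] by (simp only:)
qed

text \<open>
  Trivial summands \<open>O\<close> and \<open>O(-1)\<close> do not contribute to \<^const>\<open>twist_number\<close>: both \<open>O(-1)\<close> and \<open>O(-2)\<close>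
  have Euler characteristic 0. Hence the Euler characteristic of \<open>E(-1)\<close> is the difference between those of
  \<open>L2(-1)\<close> and \<open>L3(-1)\<close>, which is nonnegative.
\<close>
lemma chern_class_bound:
  assumes "coker_has_chern_classes (replicate n 0) (replicate n (- 1)) A c1 c2"
  shows "2 * c2 \<le> c1 * (c1 + 1)"
proof -
  obtain L2 L3 \<phi>2 \<phi>3 where
    res: "graded_free_resolution (replicate n 0) (replicate n (- 1)) L2 L3 A \<phi>2 \<phi>3" and
    W: "[:0, 1:] ^ 3 dvd [:1, c1, c2:] * chern_sum_line_bundles (replicate n (- 1)) * chern_sum_line_bundles L3
          - chern_sum_line_bundles (replicate n 0) * chern_sum_line_bundles L2"
    using assms unfolding coker_has_chern_classes_def by blast
  have "(\<Sum>d\<leftarrow>L3. d * (d + 1)) \<le> (\<Sum>d\<leftarrow>L2. d * (d + 1))"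
    by (rule resolution_twist_inequality[OF res]) simp
  then show ?thesis
    using W unfolding whitney_iff by (simp add: power2_eq_square algebra_simps sum_list_replicate)
qed

lemma rank_0_imp_zero:
  assumes M: "M \<in> carrier_mat n nc" and rank: "vec_space.rank n M = (0 :: nat)"
  shows "M = (0\<^sub>m n nc :: complex mat)"
proof (rule eq_matI)
  interpret vec_space "TYPE(complex)" n .
  fix i j assume ij: "i < dim_row (0\<^sub>m n nc :: complex mat)" "j < dim_col (0\<^sub>m n nc :: complex mat)"
  have "col M j = 0\<^sub>v n"
  proof (rule ccontr)
    assume nz: "col M j \<noteq> 0\<^sub>v n"
    have colc: "col M j \<in> carrier_vec n" using M ij by auto
    have "lin_indpt {col M j}"
    proof
      assume "lin_dep {col M j}"
      then obtain a v where "lincomb a {col M j} = 0\<^sub>v n" "v \<in> {col M j}" "a v \<noteq> 0"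
        using finite_lin_dep[of "{col M j}"] colc by auto
      then have "a (col M j) \<cdot>\<^sub>v col M j = 0\<^sub>v n" "a (col M j) \<noteq> 0"
        using colc by (auto simp: lincomb_def)
      then show False using nz colc by (auto simp: vec_eq_iff)
    qed
    moreover have "{col M j} \<subseteq> set (cols M)" using M ij by (auto simp: cols_def)
    ultimately have "card {col M j} \<le> rank M" using rank_ge_card_indpt[OF M] by blast
    then show False using rank by simp
  qed
  then show "M $$ (i, j) = 0\<^sub>m n nc $$ (i, j)"
    using M ij by (metis carrier_matD index_col index_zero_mat index_zero_vec(1))
qed (use M in auto)

text \<open>
  For \<open>c = 0\<close> the constant rank is 0, so all specializations of the matrix vanish and span nothing.
\<close>
lemma m_effective_c1_positive:
  assumes "m_effective (int c) y" shows "c > 0"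
proof (rule ccontr)
  assume "\<not> c > 0"
  then obtain A where A: "skew_linear_matrix 2 A" "spans_dim3 2 A" "constant_rank 2 0 A"
    using assms by (auto simp: m_effective_def)
  define v :: "3 \<Rightarrow> complex" where "v = (\<lambda>_. 1)"
  have "vec_space.rank 2 (eval_mat A v) = 0"
    using A(3) by (auto simp: constant_rank_def v_def)
  moreover have "eval_mat A v \<in> carrier_mat 2 2"
    using A(1) by (auto simp: skew_linear_matrix_def eval_mat_def)
  ultimately have "eval_mat A v = 0\<^sub>m 2 2" using rank_0_imp_zero by blast
  then have "v 0 = 0" using A(2) by (auto simp: spans_dim3_def)
  then show False by (simp add: v_def)
qed

lemma m_effective_c2_bound:
  assumes "m_effective (int c) (int y)" shows "y \<le> (c + 1) choose 2"
proof -
  have "2 * int y \<le> int c * (int c + 1)"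
    using assms chern_class_bound by (auto simp: m_effective_def)
  then have "2 * y \<le> c * (c + 1)" by (metis of_nat_1 of_nat_add of_nat_le_iff of_nat_mult of_nat_numeral)
  then show ?thesis by (simp add: choose_two mult.commute)
qed

section \<open>Ranks of specializations and exactness over the polynomial ring\<close>

lemma eval3_0: "eval3 0 v = 0"
  by (simp add: eval3_def)

lemma eval3_uminus: "eval3 (- p) v = - eval3 p v"
  by (simp add: eval3_def keys_minus sum_negf)

lemma eval3_var: "eval3 (var i) v = v i"
  using three_cases[of i] by (auto simp: eval3_def var_def prod_three lookup_single)

text \<open>
  A kernel on which two coordinates of the ambient space are a linear coordinate system has dimension 2. The
  corresponding rank is computed directly: deleting the two columns \<open>a\<close> and \<open>b\<close> leaves a matrix \<open>N\<close> with
  independent columns, and the two given kernel vectors express the deleted columns by the others.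
\<close>
lemma rank_eq_if_kernel_coordinates:
  fixes M :: "complex mat"
  assumes M: "M \<in> carrier_mat n n" and ab: "a < n" "b < n" "a \<noteq> b"
    and inj: "\<And>w. w \<in> carrier_vec n \<Longrightarrow> M *\<^sub>v w = 0\<^sub>v n \<Longrightarrow> w $ a = 0 \<Longrightarrow> w $ b = 0 \<Longrightarrow> w = 0\<^sub>v n"
    and u: "u \<in> carrier_vec n" "M *\<^sub>v u = 0\<^sub>v n" "u $ a \<noteq> 0" "u $ b = 0"
    and v: "v \<in> carrier_vec n" "M *\<^sub>v v = 0\<^sub>v n" "v $ b \<noteq> 0" "v $ a = 0"
  shows "vec_space.rank n M = n - 2"
proof -
  interpret vec_space "TYPE(complex)" n .
  have "card ({..<n} - {a, b}) = card {..<n - 2}"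
    using ab by (subst card_Diff_subset) auto
  then obtain h where h: "bij_betw h {..<n - 2} ({..<n} - {a, b})"
    using finite_same_card_bij[of "{..<n - 2}" "{..<n} - {a, b}"] by auto
  have hn: "h j < n" "h j \<noteq> a" "h j \<noteq> b" if "j < n - 2" for j
    using bij_betw_apply[OF h, of j] that by auto
  define N where "N = mat n (n - 2) (\<lambda>(i, j). M $$ (i, h j))"
  have N: "N \<in> carrier_mat n (n - 2)" by (simp add: N_def)
  have restrict: "M *\<^sub>v x = N *\<^sub>v vec (n - 2) (\<lambda>j. x $ h j)"
    if x: "x \<in> carrier_vec n" "x $ a = 0" "x $ b = 0" for x
  proof (rule eq_vecI)
    fix i assume "i < dim_vec (N *\<^sub>v vec (n - 2) (\<lambda>j. x $ h j))"
    then have i: "i < n" using N by simp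
    have "(M *\<^sub>v x) $ i = (\<Sum>j<n. M $$ (i, j) * x $ j)"
      using mult_mat_vec_index[OF M x(1) i] .
    also have "\<dots> = (\<Sum>j\<in>{..<n} - {a, b}. M $$ (i, j) * x $ j)"
      using x by (intro sum.mono_neutral_right) auto
    also have "\<dots> = (\<Sum>j<n - 2. M $$ (i, h j) * x $ h j)"
      by (rule sum.reindex_bij_betw[OF h, symmetric])
    also have "\<dots> = (N *\<^sub>v vec (n - 2) (\<lambda>j. x $ h j)) $ i"
      using i by (subst mult_mat_vec_index[OF N]) (simp_all add: N_def)
    finally show "(M *\<^sub>v x) $ i = (N *\<^sub>v vec (n - 2) (\<lambda>j. x $ h j)) $ i" .
  qed (use M N in simp)
  have extend: "\<exists>x\<in>carrier_vec n. x $ a = 0 \<and> x $ b = 0 \<and> z = vec (n - 2) (\<lambda>j. x $ h j)"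
    if z: "z \<in> carrier_vec (n - 2)" for z
  proof -
    let ?x = "vec n (\<lambda>i. if i = a \<or> i = b then 0 else z $ the_inv_into {..<n - 2} h i)"
    have "the_inv_into {..<n - 2} h (h j) = j" if "j < n - 2" for j
      using h that by (simp add: bij_betw_def the_inv_into_f_f)
    then show ?thesis using z ab hn by (intro bexI[of _ ?x]) auto
  qed
  have N_inj: "z = 0\<^sub>v (n - 2)" if z: "z \<in> carrier_vec (n - 2)" "N *\<^sub>v z = 0\<^sub>v n" for z
  proof -
    obtain x where x: "x \<in> carrier_vec n" "x $ a = 0" "x $ b = 0" "z = vec (n - 2) (\<lambda>j. x $ h j)"
      using extend[OF z(1)] by blast
    then have "x = 0\<^sub>v n" using inj[OF x(1)] restrict[OF x(1-3)] z(2) by simp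
    then show ?thesis using x(4) hn by auto
  qed
  have dist: "distinct (cols N)"
  proof (rule ccontr)
    assume "\<not> distinct (cols N)"
    then obtain j l where jl: "j < n - 2" "l < n - 2" "j \<noteq> l" "col N j = col N l"
      using N by (auto simp: distinct_conv_nth)
    let ?z = "unit_vec (n - 2) j - unit_vec (n - 2) l :: complex vec"
    have "N *\<^sub>v ?z = N *\<^sub>v unit_vec (n - 2) j - N *\<^sub>v unit_vec (n - 2) l"
      by (rule mult_minus_distrib_mat_vec[OF N]) auto
    also have "\<dots> = col N j - col N l"
    proof -
      have "N *\<^sub>v unit_vec (n - 2) i = col N i" if "i < n - 2" for i
        using N that by (intro eq_vecI) auto
      then show ?thesis using jl by simp
    qed
    also have "\<dots> = 0\<^sub>v n"
      using N jl by simp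
    finally have "?z = 0\<^sub>v (n - 2)" by (intro N_inj) auto
    then have "?z $ j = 0" using jl by simp
    then show False using jl by simp
  qed
  have "lin_indpt (set (cols N))"
    using lin_depE[OF N _ dist] N_inj by metis
  then have "rank N = n - 2" using lin_indpt_full_rank[OF N dist] by blast
  moreover have "col_space M = col_space N"
  proof -
    have "\<exists>z\<in>carrier_vec (n - 2). N *\<^sub>v z = M *\<^sub>v x" if x: "x \<in> carrier_vec n" for x
    proof -
      define s t where "s = x $ a / u $ a" and "t = x $ b / v $ b"
      define y where "y = x - (s \<cdot>\<^sub>v u + t \<cdot>\<^sub>v v)"
      have "M *\<^sub>v y = M *\<^sub>v x - (s \<cdot>\<^sub>v (M *\<^sub>v u) + t \<cdot>\<^sub>v (M *\<^sub>v v))"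
        using x u(1) v(1) unfolding y_def
        by (simp add: mult_minus_distrib_mat_vec[OF M] mult_add_distrib_mat_vec[OF M] mult_mat_vec_smult[OF M])
      also have "\<dots> = M *\<^sub>v x"
        using M x by (simp add: u(2) v(2))
      finally have My: "M *\<^sub>v y = M *\<^sub>v x" .
      have "y \<in> carrier_vec n" "y $ a = 0" "y $ b = 0"
        using x u v ab by (auto simp: y_def s_def t_def)
      from restrict[OF this] My show ?thesis by (metis vec_carrier)
    qed
    moreover have "\<exists>x\<in>carrier_vec n. M *\<^sub>v x = N *\<^sub>v z" if "z \<in> carrier_vec (n - 2)" for z
      using extend[OF that] restrict by metis
    ultimately show ?thesis
      unfolding col_space_eq[OF M] col_space_eq[OF N] using M N by (auto 4 4)
  qed
  ultimately show ?thesis unfolding rank_def col_space_def by simp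
qed

text \<open>
  A criterion for exactness at \<open>\<phi>1, \<phi>2\<close> from exactness after inverting \<open>x\<^sub>i\<close> and after inverting \<open>x\<^sub>j\<close>. If
  \<open>x\<^sub>i\<^sup>k w = \<phi>2 u\<close> and \<open>x\<^sub>j\<^sup>k w = \<phi>2 u'\<close>, then \<open>x\<^sub>j\<^sup>k u - x\<^sub>i\<^sup>k u'\<close> is a syzygy \<open>\<phi>3 a\<close>. When the last map is
  injective modulo \<open>(x\<^sub>i\<^sup>k, x\<^sub>j\<^sup>k)\<close>, the vector \<open>a\<close> lies in this ideal, and \<open>u\<close> can be corrected by an image of \<open>\<phi>3\<close>
  to be divisible by \<open>x\<^sub>i\<^sup>k\<close>; dividing gives a preimage of \<open>w\<close>. This takes the place of the
  Buchsbaum-Eisenbud criterion.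
\<close>
lemma exact_by_saturation:
  fixes \<phi>1 \<phi>2 \<phi>3 :: "mpoly3 mat"
  assumes c1: "\<phi>1 \<in> carrier_mat n0 n1" and c2: "\<phi>2 \<in> carrier_mat n1 n2" and c3: "\<phi>3 \<in> carrier_mat n2 n3"
    and ij: "i \<noteq> j"
    and comp: "\<And>v. v \<in> carrier_vec n2 \<Longrightarrow> \<phi>1 *\<^sub>v (\<phi>2 *\<^sub>v v) = 0\<^sub>v n0"
    and sat_i: "\<And>w. w \<in> carrier_vec n1 \<Longrightarrow> \<phi>1 *\<^sub>v w = 0\<^sub>v n0 \<Longrightarrow> \<exists>u\<in>carrier_vec n2. var i ^ k \<cdot>\<^sub>v w = \<phi>2 *\<^sub>v u"
    and sat_j: "\<And>w. w \<in> carrier_vec n1 \<Longrightarrow> \<phi>1 *\<^sub>v w = 0\<^sub>v n0 \<Longrightarrow> \<exists>u\<in>carrier_vec n2. var j ^ k \<cdot>\<^sub>v w = \<phi>2 *\<^sub>v u"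
    and ker2: "mat_kernel \<phi>2 = mat_image \<phi>3"
    and reg: "\<And>a. a \<in> carrier_vec n3 \<Longrightarrow> (\<And>r. r < n2 \<Longrightarrow> \<exists>p q. (\<phi>3 *\<^sub>v a) $ r = var i ^ k * p + var j ^ k * q) \<Longrightarrow>
        \<forall>s<n3. \<exists>p q. a $ s = var i ^ k * p + var j ^ k * q"
  shows "mat_kernel \<phi>1 = mat_image \<phi>2"
proof (intro subset_antisym subsetI)
  fix w assume "w \<in> mat_image \<phi>2"
  then show "w \<in> mat_kernel \<phi>1"
    using mat_image_iff[OF c2] comp mat_kernelI[OF c1] c2 by auto
next
  let ?x = "var i ^ k" and ?y = "var j ^ k"
  fix w assume "w \<in> mat_kernel \<phi>1"
  then have w: "w \<in> carrier_vec n1" "\<phi>1 *\<^sub>v w = 0\<^sub>v n0"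
    using mat_kernelD[OF c1] by auto
  obtain u u' where u: "u \<in> carrier_vec n2" "?x \<cdot>\<^sub>v w = \<phi>2 *\<^sub>v u"
    and u': "u' \<in> carrier_vec n2" "?y \<cdot>\<^sub>v w = \<phi>2 *\<^sub>v u'"
    using sat_i[OF w] sat_j[OF w] by blast
  have "\<phi>2 *\<^sub>v (?y \<cdot>\<^sub>v u - ?x \<cdot>\<^sub>v u') = ?y \<cdot>\<^sub>v (?x \<cdot>\<^sub>v w) - ?x \<cdot>\<^sub>v (?y \<cdot>\<^sub>v w)"
    using u u' by (simp add: mult_minus_distrib_mat_vec[OF c2] mult_mat_vec_smult[OF c2])
  also have "\<dots> = 0\<^sub>v n1" using w by (intro eq_vecI) auto
  finally have "?y \<cdot>\<^sub>v u - ?x \<cdot>\<^sub>v u' \<in> mat_kernel \<phi>2"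
    using u u' by (intro mat_kernelI[OF c2]) auto
  then obtain a where a: "a \<in> carrier_vec n3" "?y \<cdot>\<^sub>v u - ?x \<cdot>\<^sub>v u' = \<phi>3 *\<^sub>v a"
    using ker2 mat_image_iff[OF c3] by blast
  have "\<forall>s<n3. \<exists>p q. a $ s = ?x * p + ?y * q"
  proof (rule reg[OF a(1)])
    fix r assume r: "r < n2"
    have "(\<phi>3 *\<^sub>v a) $ r = ?x * - (u' $ r) + ?y * (u $ r)"
      unfolding a(2)[symmetric] using r u u' by simp
    then show "\<exists>p q. (\<phi>3 *\<^sub>v a) $ r = ?x * p + ?y * q" by blast
  qed
  then obtain p q where pq: "\<And>s. s < n3 \<Longrightarrow> a $ s = ?x * p s + ?y * q s" by metis
  define P Q where "P = vec n3 p" and "Q = vec n3 q"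
  have PQ: "P \<in> carrier_vec n3" "Q \<in> carrier_vec n3" by (simp_all add: P_def Q_def)
  have "a = ?x \<cdot>\<^sub>v P + ?y \<cdot>\<^sub>v Q"
    using a pq by (intro eq_vecI) (auto simp: P_def Q_def)
  then have \<phi>a: "\<phi>3 *\<^sub>v a = ?x \<cdot>\<^sub>v (\<phi>3 *\<^sub>v P) + ?y \<cdot>\<^sub>v (\<phi>3 *\<^sub>v Q)"
    using PQ by (simp add: mult_add_distrib_mat_vec[OF c3] mult_mat_vec_smult[OF c3])
  have c3PQ: "\<phi>3 *\<^sub>v P \<in> carrier_vec n2" "\<phi>3 *\<^sub>v Q \<in> carrier_vec n2"
    using c3 PQ by auto
  have "\<exists>e. (u - \<phi>3 *\<^sub>v Q) $ r = ?x * e" if r: "r < n2" for r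
  proof -
    have "(?y \<cdot>\<^sub>v u - ?x \<cdot>\<^sub>v u') $ r = (?x \<cdot>\<^sub>v (\<phi>3 *\<^sub>v P) + ?y \<cdot>\<^sub>v (\<phi>3 *\<^sub>v Q)) $ r"
      using a(2) \<phi>a by simp
    then have "?y * u $ r - ?x * u' $ r = ?x * (\<phi>3 *\<^sub>v P) $ r + ?y * (\<phi>3 *\<^sub>v Q) $ r"
      using r u u' c3PQ c3 by (simp del: index_mult_mat_vec)
    then have "?y * (u $ r - (\<phi>3 *\<^sub>v Q) $ r) + ?x * - (u' $ r + (\<phi>3 *\<^sub>v P) $ r) = 0"
      by (simp add: algebra_simps)
    from koszul_exact2[OF ij[symmetric] this]
    obtain e where "u $ r - (\<phi>3 *\<^sub>v Q) $ r = ?x * e" by blast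
    then have "(u - \<phi>3 *\<^sub>v Q) $ r = ?x * e" using r c3 by (simp del: index_mult_mat_vec)
    then show ?thesis by blast
  qed
  then obtain e where e: "\<And>r. r < n2 \<Longrightarrow> (u - \<phi>3 *\<^sub>v Q) $ r = ?x * e r" by metis
  define E where "E = vec n2 e"
  have E: "E \<in> carrier_vec n2" by (simp add: E_def)
  have uE: "u - \<phi>3 *\<^sub>v Q = ?x \<cdot>\<^sub>v E"
    using e c3 by (intro eq_vecI) (auto simp: E_def simp del: index_mult_mat_vec)
  have "\<phi>3 *\<^sub>v Q \<in> mat_kernel \<phi>2" using ker2 mat_image_iff[OF c3] PQ by blast
  then have "\<phi>2 *\<^sub>v (\<phi>3 *\<^sub>v Q) = 0\<^sub>v n1" using mat_kernelD[OF c2] by blast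
  then have "\<phi>2 *\<^sub>v (u - \<phi>3 *\<^sub>v Q) = ?x \<cdot>\<^sub>v w"
    using u c3PQ c2 w by (simp add: mult_minus_distrib_mat_vec[OF c2])
  then have xw: "?x \<cdot>\<^sub>v w = ?x \<cdot>\<^sub>v (\<phi>2 *\<^sub>v E)"
    unfolding uE using mult_mat_vec_smult[OF c2 E] by simp
  have "w = \<phi>2 *\<^sub>v E"
  proof (rule eq_vecI)
    show "dim_vec w = dim_vec (\<phi>2 *\<^sub>v E)" using w c2 by simp
    fix r assume "r < dim_vec (\<phi>2 *\<^sub>v E)"
    then have r: "r < n1" using c2 by simp
    have "(?x \<cdot>\<^sub>v w) $ r = (?x \<cdot>\<^sub>v (\<phi>2 *\<^sub>v E)) $ r" using xw by simp
    then show "w $ r = (\<phi>2 *\<^sub>v E) $ r"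
      using r w c2 by (simp del: index_mult_mat_vec)
  qed
  then show "w \<in> mat_image \<phi>2" using E mat_image_iff[OF c2] by blast
qed

lemma mat_image_no_columns: "mat_image (0\<^sub>m n 0 :: mpoly3 mat) = {0\<^sub>v n}"
proof -
  have "0\<^sub>m n 0 *\<^sub>v w = 0\<^sub>v n" if "w \<in> carrier_vec 0" for w :: "mpoly3 vec"
    using that by (intro eq_vecI) (auto simp: scalar_prod_def)
  then show ?thesis using mat_image_iff[of "0\<^sub>m n 0 :: mpoly3 mat" n 0]
    by (auto intro: zero_carrier_vec)
qed

lemma mat_kernel_no_columns: "mat_kernel (0\<^sub>m n 0 :: mpoly3 mat) = {0\<^sub>v 0}"
proof -
  have "0\<^sub>m n 0 *\<^sub>v (0\<^sub>v 0) = (0\<^sub>v n :: mpoly3 vec)"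
    by (intro eq_vecI) (auto simp: scalar_prod_def)
  then show ?thesis
    by (auto simp: mat_kernel[of _ n 0])
qed

section \<open>Band matrices and their maximal minors\<close>

text \<open>
  The Lucas sequence of \<open>z t\<^sup>2 + y t + x\<close>. Up to sign, \<open>lucas (k + 1)\<close> is the determinant of the tridiagonal
  \<open>k \<times> k\<close> matrix with diagonal \<open>y\<close> and off-diagonals \<open>x\<close> and \<open>z\<close>. All syzygies below are built from it.
\<close>
fun lucas :: "'a::comm_ring_1 \<Rightarrow> 'a \<Rightarrow> 'a \<Rightarrow> nat \<Rightarrow> 'a" where
  "lucas x y z 0 = 0"
| "lucas x y z (Suc 0) = 1"
| "lucas x y z (Suc (Suc k)) = - y * lucas x y z (Suc k) - x * z * lucas x y z k"

lemma is_form_lucas: "is_form (int k - 1) (lucas (var a) (var b) (var c) k)"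
proof (induction "var a" "var b" "var c" k rule: lucas.induct)
  case (3 k)
  have "is_form (1 + (int (Suc k) - 1)) (- var b * lucas (var a) (var b) (var c) (Suc k))"
    using 3(1) is_form_var by (intro is_form_mult) (simp_all add: is_form_uminus)
  moreover have "is_form (1 + 1 + (int k - 1)) (var a * var c * lucas (var a) (var b) (var c) k)"
    using 3(2) is_form_var by (intro is_form_mult)
  ultimately show ?case by (auto intro!: is_form_diff simp: algebra_simps)
qed simp_all

lemma sum_three_entries:
  fixes w :: "nat \<Rightarrow> 'a :: comm_ring_1"
  shows "(\<Sum>j<n. ((if j = a then x else 0) + (if j = b then y else 0) + (if j = c then z else 0)) * w j)
    = (if a < n then x * w a else 0) + (if b < n then y * w b else 0) + (if c < n then z * w c else 0)"
proof -
  have "((if j = a then x else 0) + (if j = b then y else 0) + (if j = c then z else 0)) * w j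
     = (if j = a then x * w a else 0) + (if j = b then y * w b else 0) + (if j = c then z * w c else 0)" for j
    by (auto simp: algebra_simps)
  then show ?thesis by (simp add: sum.distrib)
qed

definition band :: "'a::comm_ring_1 \<Rightarrow> 'a \<Rightarrow> 'a \<Rightarrow> nat \<Rightarrow> nat \<Rightarrow> 'a" where
  "band x y z i j = (if j = i then x else 0) + (if j = i + 1 then y else 0) + (if j = i + 2 then z else 0)"

text \<open>
  Multiplication by \<open>x + y t + z t\<^sup>2\<close> on polynomials in \<open>t\<close> of degree less than \<open>d\<close>.
\<close>
definition band_mat :: "nat \<Rightarrow> 'a::comm_ring_1 \<Rightarrow> 'a \<Rightarrow> 'a \<Rightarrow> 'a mat" where
  "band_mat d x y z = mat (d + 2) d (\<lambda>(r, s). band x y z s r)"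

text \<open>
  Up to sign, the maximal minor of \<^const>\<open>band_mat\<close> that omits the rows \<open>i\<close> and \<open>j\<close>: the remaining matrix
  has triangular blocks at both ends, which give the two powers, and a tridiagonal block between them.
\<close>
definition minors :: "nat \<Rightarrow> 'a::comm_ring_1 \<Rightarrow> 'a \<Rightarrow> 'a \<Rightarrow> nat \<Rightarrow> nat \<Rightarrow> 'a" where
  "minors d x y z i j = (if i \<le> j then x ^ i * z ^ (d + 1 - j) * lucas x y z (j - i)
     else - (x ^ j * z ^ (d + 1 - i) * lucas x y z (i - j)))"

lemma minors_skew: "minors d x y z j i = - minors d x y z i j"
  by (auto simp: minors_def)

text \<open>
  The Laplace relations between the maximal minors: for fixed \<open>i\<close> they solve the linear recurrence
  given by the rows of the transposed band matrix.
\<close>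
lemma minors_recurrence:
  assumes "r < d" "i \<le> d + 1"
  shows "x * minors d x y z i r + y * minors d x y z i (r + 1) + z * minors d x y z i (r + 2) = 0"
proof -
  consider (above) "i \<le> r" | (eq) "i = r + 1" | (below) "i \<ge> r + 2" by linarith
  then show ?thesis
  proof cases
    case above
    then obtain k where k: "r = i + k" using le_Suc_ex by blast
    obtain l where l: "d = r + 1 + l" using assms(1) less_iff_Suc_add by auto
    have e: "Suc (i + k) - i = Suc k" "Suc (Suc (i + k)) - i = Suc (Suc k)" by linarith+
    show ?thesis by (simp add: minors_def k l e algebra_simps)
  next
    case eq
    obtain l where l: "d = r + 1 + l" using assms(1) less_iff_Suc_add by auto
    show ?thesis by (simp add: minors_def eq l algebra_simps)
  next
    case below
    then obtain k where k: "i = r + 2 + k" using le_Suc_ex by blast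
    obtain l where l: "d + 1 = i + l" using assms(2) le_Suc_ex by blast
    show ?thesis
    proof (cases k)
      case 0
      then show ?thesis using k by (simp add: minors_def algebra_simps numeral_2_eq_2)
    next
      case (Suc k')
      have e: "Suc (Suc (r + k)) - r = Suc (Suc k)" "Suc (r + k) - r = Suc k" "Suc (Suc (r + k)) - Suc r = Suc k"
        by linarith+
      show ?thesis using Suc l by (simp add: minors_def k e algebra_simps numeral_3_eq_3)
    qed
  qed
qed

text \<open>
  The kernel of the transposed band matrix.
\<close>
definition recurrent :: "nat \<Rightarrow> 'a::comm_ring_1 \<Rightarrow> 'a \<Rightarrow> 'a \<Rightarrow> (nat \<Rightarrow> 'a) \<Rightarrow> bool" where
  "recurrent d x y z w \<longleftrightarrow> (\<forall>r<d. x * w r + y * w (r + 1) + z * w (r + 2) = 0)"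

lemma recurrent_zero_forward:
  fixes x :: "'a :: idom"
  assumes "recurrent d x y z w" "z \<noteq> 0" "w 0 = 0" "w 1 = 0" "j \<le> d + 1"
  shows "w j = 0"
  using assms(5)
proof (induction j rule: less_induct)
  case (less j)
  show ?case
  proof (cases "j < 2")
    case True
    then have "j = 0 \<or> j = 1" by linarith
    then show ?thesis using assms(3,4) by blast
  next
    case False
    then obtain l where l: "j = l + 2" by (metis le_add_diff_inverse2 not_less)
    then have "x * w l + y * w (l + 1) + z * w (l + 2) = 0"
      using assms(1) less.prems by (simp add: recurrent_def)
    moreover have "w l = 0" "w (l + 1) = 0"
      using l less by simp_all
    ultimately show ?thesis using assms(2) l by simp
  qed
qed

lemma recurrent_reverse:
  assumes "recurrent d x y z w"
  shows "recurrent d z y x (\<lambda>j. w (d + 1 - j))"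
  unfolding recurrent_def
proof (intro allI impI)
  fix r assume r: "r < d"
  then have "d - 1 - r < d" by simp
  then have "x * w (d - 1 - r) + y * w (d - 1 - r + 1) + z * w (d - 1 - r + 2) = 0"
    using assms by (simp add: recurrent_def)
  moreover have "d - 1 - r + 1 = d + 1 - (r + 1)" "d - 1 - r + 2 = d + 1 - r" "d - 1 - r = d + 1 - (r + 2)"
    using r by simp_all
  ultimately show "z * w (d + 1 - r) + y * w (d + 1 - (r + 1)) + x * w (d + 1 - (r + 2)) = 0"
    by (simp add: add.commute add.left_commute)
qed

lemma recurrent_zero_backward:
  fixes x :: "'a :: idom"
  assumes "recurrent d x y z w" "x \<noteq> 0" "w (d + 1) = 0" "w d = 0" "j \<le> d + 1"
  shows "w j = 0"
  using recurrent_zero_forward[OF recurrent_reverse[OF assms(1)] assms(2), of "d + 1 - j"] assms(3-5)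
  by simp

lemma recurrent_minors: "i \<le> d + 1 \<Longrightarrow> recurrent d x y z (minors d x y z i)"
  using minors_recurrence unfolding recurrent_def by blast

lemma recurrent_diff:
  assumes "recurrent d x y z u" "recurrent d x y z w"
  shows "recurrent d x y z (\<lambda>j. u j - w j)"
proof -
  have "x * (u r - w r) + y * (u (r + 1) - w (r + 1)) + z * (u (r + 2) - w (r + 2))
    = (x * u r + y * u (r + 1) + z * u (r + 2)) - (x * w r + y * w (r + 1) + z * w (r + 2))" for r
    by (simp add: algebra_simps)
  then show ?thesis using assms by (simp add: recurrent_def)
qed

lemma recurrent_scale:
  assumes "recurrent d x y z w"
  shows "recurrent d x y z (\<lambda>j. c * w j)"
proof -
  have "x * (c * w r) + y * (c * w (r + 1)) + z * (c * w (r + 2)) = c * (x * w r + y * w (r + 1) + z * w (r + 2))" for r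
    by (simp add: algebra_simps)
  then show ?thesis using assms by (simp add: recurrent_def)
qed

text \<open>
  After inverting \<open>z\<close> a solution is determined by its first two entries, and the minors with \<open>i = 0, 1\<close> are a
  basis of the solutions. Clearing denominators costs only the power \<open>z\<^sup>d\<close>.
\<close>
lemma recurrent_forward_expansion:
  fixes x :: "'a :: idom"
  assumes w: "recurrent d x y z w" and z: "z \<noteq> 0" and d: "d > 0" and j: "j \<le> d + 1"
  shows "z ^ d * w j = w 1 * minors d x y z 0 j - w 0 * minors d x y z 1 j"
proof -
  let ?e = "\<lambda>j. z ^ d * w j - (w 1 * minors d x y z 0 j - w 0 * minors d x y z 1 j)"
  have "recurrent d x y z ?e"
    by (intro recurrent_diff recurrent_scale recurrent_minors w) (use d in auto)
  then have "?e j = 0"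
    by (rule recurrent_zero_forward[OF _ z _ _ j]) (simp_all add: minors_def)
  then show ?thesis by simp
qed

lemma recurrent_backward_expansion:
  fixes x :: "'a :: idom"
  assumes w: "recurrent d x y z w" and x: "x \<noteq> 0" and d: "d > 0" and j: "j \<le> d + 1"
  shows "x ^ d * w j = w (d + 1) * minors d x y z d j - w d * minors d x y z (d + 1) j"
proof -
  let ?e = "\<lambda>j. x ^ d * w j - (w (d + 1) * minors d x y z d j - w d * minors d x y z (d + 1) j)"
  have "recurrent d x y z ?e"
    by (intro recurrent_diff recurrent_scale recurrent_minors w) (use d in auto)
  then have "?e j = 0"
    by (rule recurrent_zero_backward[OF _ x _ _ j]) (simp_all add: minors_def)
  then show ?thesis by simp
qed

lemma band_mat_carrier: "band_mat d x y z \<in> carrier_mat (d + 2) d"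
  by (simp add: band_mat_def)

lemma band_mat_mult:
  assumes a: "a \<in> carrier_vec d" and r: "r < d + 2"
  shows "(band_mat d x y z *\<^sub>v a) $ r = (if r < d then x * a $ r else 0) +
     (if 1 \<le> r \<and> r \<le> d then y * a $ (r - 1) else 0) + (if 2 \<le> r then z * a $ (r - 2) else 0)"
proof -
  have "(band_mat d x y z *\<^sub>v a) $ r = (\<Sum>s<d. band x y z s r * a $ s)"
    using r by (subst mult_mat_vec_index[OF band_mat_carrier a]) (simp_all add: band_mat_def)
  also have "\<dots> = (\<Sum>s<d. ((if s = r then x else 0) + (if s = r - 1 then (if 1 \<le> r then y else 0) else 0) +
      (if s = r - 2 then (if 2 \<le> r then z else 0) else 0)) * a $ s)"
    by (intro sum.cong) (auto simp: band_def)
  finally show ?thesis using r unfolding sum_three_entries by auto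
qed

text \<open>
  Division of the polynomial \<open>u\<close> by \<open>x + y t + z t\<^sup>2\<close>, starting from the leading coefficients. Each of the \<open>m\<close>
  steps multiplies by the leading coefficient \<open>z\<close> once.
\<close>
lemma band_mat_forward_division:
  fixes u :: "'a :: comm_ring_1 vec"
  assumes u: "u \<in> carrier_vec (d + 2)" and m: "m \<le> d"
  shows "\<exists>a\<in>carrier_vec d. (\<forall>s<d - m. a $ s = 0) \<and>
    (\<forall>r<d + 2. d + 2 - m \<le> r \<longrightarrow> z ^ m * u $ r = (band_mat d x y z *\<^sub>v a) $ r)"
  using m
proof (induction m)
  case 0
  show ?case by (intro bexI[of _ "0\<^sub>v d"]) auto
next
  case (Suc m)
  then obtain a where a: "a \<in> carrier_vec d" "\<And>s. s < d - m \<Longrightarrow> a $ s = 0"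
    "\<And>r. r < d + 2 \<Longrightarrow> d + 2 - m \<le> r \<Longrightarrow> z ^ m * u $ r = (band_mat d x y z *\<^sub>v a) $ r" by auto
  define s where "s = d - Suc m"
  have s: "s < d" "s + 2 = d + 1 - m" using Suc.prems by (auto simp: s_def)
  define e where "e = z ^ m * u $ (s + 2) - (band_mat d x y z *\<^sub>v a) $ (s + 2)"
  define a' where "a' = vec d (\<lambda>i. if i = s then z * a $ i + e else z * a $ i)"
  have a': "a' \<in> carrier_vec d" by (simp add: a'_def)
  have rest: "z ^ Suc m * u $ r = (band_mat d x y z *\<^sub>v a') $ r" if r: "r < d + 2" "d + 2 - Suc m \<le> r" for r
  proof -
    have rs: "s + 2 \<le> r" using r(2) s(2) Suc.prems by simp
    have t1: "(if r < d then x * a' $ r else 0) = z * (if r < d then x * a $ r else 0)"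
      using rs by (simp add: a'_def)
    have t2: "(if 1 \<le> r \<and> r \<le> d then y * a' $ (r - 1) else 0) = z * (if 1 \<le> r \<and> r \<le> d then y * a $ (r - 1) else 0)"
      using rs by (auto simp: a'_def)
    have t3: "(if 2 \<le> r then z * a' $ (r - 2) else 0) =
        z * (if 2 \<le> r then z * a $ (r - 2) else 0) + (if r = s + 2 then z * e else 0)"
      using rs r(1) s(1) by (auto simp: a'_def distrib_left)
    have "(band_mat d x y z *\<^sub>v a') $ r = z * (band_mat d x y z *\<^sub>v a) $ r + (if r = s + 2 then z * e else 0)"
      unfolding band_mat_mult[OF a' r(1)] band_mat_mult[OF a(1) r(1)]
      unfolding t1 t2 t3 by (simp only: distrib_left add.assoc)
    moreover have "z ^ m * u $ r = (band_mat d x y z *\<^sub>v a) $ r" if "r \<noteq> s + 2"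
      using a(3) r s that by simp
    ultimately show ?thesis
      by (cases "r = s + 2") (auto simp: e_def algebra_simps)
  qed
  have zero: "a' $ i = 0" if "i < d - Suc m" for i
    using a(2)[of i] that by (auto simp: a'_def s_def)
  show ?case using a' rest zero by blast
qed


text \<open>
  Reversing all coefficient sequences exchanges \<open>x\<close> and \<open>z\<close>; every statement about leading
  coefficients has a mirror image about constant ones.
\<close>
lemma band_mat_reverse:
  assumes a: "a \<in> carrier_vec d" and r: "r < d + 2"
  shows "(band_mat d z y x *\<^sub>v vec d (\<lambda>s. a $ (d - 1 - s))) $ (d + 1 - r) = (band_mat d x y z *\<^sub>v a) $ r"
proof -
  have r': "d + 1 - r < d + 2" by simp
  have t1: "(if d + 1 - r < d then z * vec d (\<lambda>s. a $ (d - 1 - s)) $ (d + 1 - r) else 0) =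
      (if 2 \<le> r then z * a $ (r - 2) else 0)"
  proof (cases "2 \<le> r")
    case True
    then have "d + 1 - r < d" "d - 1 - (d + 1 - r) = r - 2" using r by linarith+
    then show ?thesis using True by simp
  qed (use r in auto)
  have t2: "(if 1 \<le> d + 1 - r \<and> d + 1 - r \<le> d then y * vec d (\<lambda>s. a $ (d - 1 - s)) $ (d + 1 - r - 1) else 0) =
      (if 1 \<le> r \<and> r \<le> d then y * a $ (r - 1) else 0)"
  proof (cases "1 \<le> r \<and> r \<le> d")
    case True
    then have "d + 1 - r - 1 < d" "d - 1 - (d + 1 - r - 1) = r - 1" "1 \<le> d + 1 - r" "d + 1 - r \<le> d" by linarith+
    then show ?thesis using True by simp
  qed (use r in auto)
  have t3: "(if 2 \<le> d + 1 - r then x * vec d (\<lambda>s. a $ (d - 1 - s)) $ (d + 1 - r - 2) else 0) =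
      (if r < d then x * a $ r else 0)"
  proof (cases "r < d")
    case True
    then have "d + 1 - r - 2 < d" "d - 1 - (d + 1 - r - 2) = r" "2 \<le> d + 1 - r" by linarith+
    then show ?thesis using True by simp
  qed (use r in auto)
  have ac: "vec d (\<lambda>s. a $ (d - 1 - s)) \<in> carrier_vec d" by simp
  show ?thesis unfolding band_mat_mult[OF ac r'] band_mat_mult[OF a r] t1 t2 t3
    by (simp only: add.assoc add.commute add.left_commute)
qed

lemma band_mat_backward_division:
  fixes u :: "'a :: comm_ring_1 vec"
  assumes u: "u \<in> carrier_vec (d + 2)"
  shows "\<exists>a\<in>carrier_vec d. \<forall>r<d. x ^ d * u $ r = (band_mat d x y z *\<^sub>v a) $ r"
proof -
  let ?u = "vec (d + 2) (\<lambda>r. u $ (d + 1 - r))"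
  obtain b where b: "b \<in> carrier_vec d"
    "\<And>r. r < d + 2 \<Longrightarrow> 2 \<le> r \<Longrightarrow> x ^ d * ?u $ r = (band_mat d z y x *\<^sub>v b) $ r"
    using band_mat_forward_division[of ?u d d x z y] by auto
  have "x ^ d * u $ r = (band_mat d x y z *\<^sub>v vec d (\<lambda>s. b $ (d - 1 - s))) $ r" if r: "r < d" for r
  proof -
    have e: "d + 1 - (d + 1 - r) = r" using r by linarith
    have "x ^ d * u $ r = x ^ d * ?u $ (d + 1 - r)"
      using r e by (subst index_vec) auto
    also have "x ^ d * ?u $ (d + 1 - r) = (band_mat d z y x *\<^sub>v b) $ (d + 1 - r)"
      using r by (intro b(2)) auto
    also have "(band_mat d z y x *\<^sub>v b) $ (d + 1 - r) = (band_mat d x y z *\<^sub>v vec d (\<lambda>s. b $ (d - 1 - s))) $ (d + 1 - (d + 1 - r))"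
      by (rule band_mat_reverse[OF b(1), symmetric]) auto
    finally show ?thesis unfolding e .
  qed
  then show ?thesis by (intro bexI[of _ "vec d (\<lambda>s. b $ (d - 1 - s))"]) auto
qed

lemma band_mat_injective_x:
  fixes x :: "'a :: idom"
  assumes a: "a \<in> carrier_vec d" and B: "band_mat d x y z *\<^sub>v a = 0\<^sub>v (d + 2)" and x: "x \<noteq> 0"
  shows "a = 0\<^sub>v d"
proof -
  have "a $ s = 0" if "s < d" for s
    using that
  proof (induction s rule: less_induct)
    case (less s)
    have "(band_mat d x y z *\<^sub>v a) $ s = 0" using B less.prems by simp
    moreover have "1 \<le> s \<Longrightarrow> a $ (s - 1) = 0" "2 \<le> s \<Longrightarrow> a $ (s - 2) = 0"
      using less by simp_all
    ultimately have "x * a $ s = 0"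
      using less.prems by (subst (asm) band_mat_mult[OF a]) (auto split: if_splits)
    then show ?case using x by simp
  qed
  then show ?thesis using a by (intro eq_vecI) auto
qed

lemma band_mat_injective_z:
  fixes x :: "'a :: idom"
  assumes a: "a \<in> carrier_vec d" and B: "band_mat d x y z *\<^sub>v a = 0\<^sub>v (d + 2)" and z: "z \<noteq> 0"
  shows "a = 0\<^sub>v d"
proof -
  let ?b = "vec d (\<lambda>s. a $ (d - 1 - s))"
  have "band_mat d z y x *\<^sub>v ?b = 0\<^sub>v (d + 2)"
  proof (rule eq_vecI)
    fix r assume "r < dim_vec (0\<^sub>v (d + 2) :: 'a vec)"
    then have r: "r < d + 2" by simp
    then have "d + 1 - (d + 1 - r) = r" by simp
    then have "(band_mat d z y x *\<^sub>v ?b) $ r = (band_mat d x y z *\<^sub>v a) $ (d + 1 - r)"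
      using band_mat_reverse[OF a, of "d + 1 - r" z y x] by simp
    then show "(band_mat d z y x *\<^sub>v ?b) $ r = 0\<^sub>v (d + 2) $ r"
      using B r by simp
  qed (simp add: band_mat_def)
  from band_mat_injective_x[OF vec_carrier this z] have "?b = 0\<^sub>v d" .
  then have b0: "?b $ s = 0" if "s < d" for s using that by simp
  have "a $ s = 0" if "s < d" for s
  proof -
    have e: "d - 1 - s < d" "d - 1 - (d - 1 - s) = s" using that by linarith+
    show ?thesis using b0[OF e(1)] unfolding index_vec[OF e(1)] e(2) .
  qed
  then show ?thesis using a by (intro eq_vecI) auto
qed

lemma band_mat_injective_y:
  fixes y :: "'a :: idom"
  assumes a: "a \<in> carrier_vec d" and B: "band_mat d 0 y 0 *\<^sub>v a = 0\<^sub>v (d + 2)" and y: "y \<noteq> 0"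
  shows "a = 0\<^sub>v d"
proof -
  have "a $ s = 0" if "s < d" for s
  proof -
    have "(band_mat d 0 y 0 *\<^sub>v a) $ (s + 1) = 0" using B that by simp
    then show ?thesis using that y by (subst (asm) band_mat_mult[OF a]) (auto split: if_splits)
  qed
  then show ?thesis using a by (intro eq_vecI) auto
qed

lemma mem_ideal_iff_coef:
  assumes "i \<noteq> j"
  shows "(\<exists>p q. f = var i ^ k * p + var j ^ k * q) \<longleftrightarrow> (\<forall>m. expo m i < k \<longrightarrow> expo m j < k \<longrightarrow> coef f m = 0)"
    (is "?L \<longleftrightarrow> ?R")
proof
  assume ?L
  then obtain p q where "f = var i ^ k * p + var j ^ k * q" by blast
  then show ?R by (simp add: lookup_add coef_var_power_mult)
next
  assume R: ?R
  have "mod_var j k (mod_var i k f) = 0"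
    by (rule poly_mapping_eqI) (use R in \<open>simp add: coef_mod_var not_le\<close>)
  then have "f = var i ^ k * div_var i k f + var j ^ k * div_var j k (mod_var i k f)"
    using div_mod_var[of f i k] mod_var_eq_0D[of j k "mod_var i k f"] by simp
  then show ?L by blast
qed

lemma coef_var_mult:
  "coef (var i * p) m = (if 1 \<le> expo m i then coef p (m - expo_single i 1) else 0)"
  using coef_var_power_mult[of i 1 p m] by simp

text \<open>
  Modulo \<open>(x\<^sub>0\<^sup>k, x\<^sub>2\<^sup>k)\<close> the variables \<open>x\<^sub>0\<close> and \<open>x\<^sub>2\<close> are nilpotent and \<open>x\<^sub>1\<close> is a nonzerodivisor, so
  \<open>x\<^sub>0 + x\<^sub>1 t + x\<^sub>2 t\<^sup>2\<close> is a nonzerodivisor too. Concretely, take a coefficient of \<open>a\<close> outside the ideal of least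
  degree in \<open>x\<^sub>0, x\<^sub>2\<close>: multiplied by \<open>x\<^sub>1\<close> it cannot be cancelled, because the other two terms would come
  from coefficients of smaller degree.
\<close>
lemma band_mat_regular_mod_powers:
  assumes a: "a \<in> carrier_vec d"
    and B: "\<And>r. r < d + 2 \<Longrightarrow> \<exists>p q. (band_mat d (var 0) (var 1) (var 2) *\<^sub>v a) $ r = var 2 ^ k * p + var 0 ^ k * q"
  shows "\<forall>s<d. \<exists>p q. a $ s = var 2 ^ k * p + var 0 ^ k * q"
proof -
  have "coef (a $ s) m = 0" if "s < d" "expo m 2 < k" "expo m 0 < k" for s m
    using that
  proof (induction "expo m 2 + expo m 0" arbitrary: s m rule: less_induct)
    case less
    define m' where "m' = m + expo_single 1 1"
    have m': "expo m' 1 = expo m 1 + 1" "expo m' 2 = expo m 2" "expo m' 0 = expo m 0" "m' - expo_single 1 1 = m"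
      by (simp_all add: m'_def lookup_add lookup_single)
    have "coef ((band_mat d (var 0) (var 1) (var 2) *\<^sub>v a) $ (s + 1)) m' = 0"
      using iffD1[OF mem_ideal_iff_coef B[of "s + 1"]] less.prems m' by simp
    moreover have "coef (if s + 1 < d then var 0 * a $ (s + 1) else 0) m' = 0"
    proof (cases "s + 1 < d \<and> 1 \<le> expo m' 0")
      case True
      then have "coef (a $ (s + 1)) (m' - expo_single 0 1) = 0"
        using less.prems m' by (intro less.hyps) (simp_all add: lookup_minus lookup_single)
      then show ?thesis by (simp add: coef_var_mult)
    next
      case False
      then show ?thesis by (cases "s + 1 < d") (simp_all add: coef_var_mult)
    qed
    moreover have "coef (if 2 \<le> s + 1 then var 2 * a $ (s + 1 - 2) else 0) m' = 0"
    proof (cases "2 \<le> s + 1 \<and> 1 \<le> expo m' 2")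
      case True
      then have "coef (a $ (s + 1 - 2)) (m' - expo_single 2 1) = 0"
        using less.prems m' by (intro less.hyps) (simp_all add: lookup_minus lookup_single)
      then show ?thesis by (simp add: coef_var_mult)
    next
      case False
      then show ?thesis by (cases "2 \<le> s + 1") (simp_all add: coef_var_mult)
    qed
    moreover have "coef (if 1 \<le> s + 1 \<and> s + 1 \<le> d then var 1 * a $ (s + 1 - 1) else 0) m' = coef (a $ s) m"
      using m' less.prems(1) by (simp add: coef_var_mult)
    moreover have "s + 1 < d + 2" using less.prems(1) by simp
    ultimately show ?case
      by (simp only: band_mat_mult[OF a] lookup_add add_0_left add_0_right)
  qed
  then show ?thesis using mem_ideal_iff_coef[of 2 0] by simp
qed

section \<open>Steiner bundles\<close>

lemma dim_band_mat [simp]: "dim_row (band_mat d x y z) = d + 2" "dim_col (band_mat d x y z) = d"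
  by (simp_all add: band_mat_def)

lemma smult_zero_vec_right: "c \<cdot>\<^sub>v 0\<^sub>v n = (0\<^sub>v n :: 'a :: comm_ring_1 vec)"
  by (intro eq_vecI) auto

text \<open>
  The matrix \<open>(0, B\<^sup>T; -B, 0)\<close> for the band matrix \<open>B\<close>. Its cokernel is the direct sum of \<open>coker B\<close>, a bundle with
  resolution \<open>0 \<rightarrow> O(-1)\<^sup>d \<rightarrow> O\<^sup>d\<^sup>+\<^sup>2\<close>, and of \<open>coker B\<^sup>T\<close>, which is zero as a sheaf because \<open>B\<close>
  has constant rank \<open>d\<close>.
\<close>
definition steiner_mat :: "nat \<Rightarrow> 'a::comm_ring_1 \<Rightarrow> 'a \<Rightarrow> 'a \<Rightarrow> 'a mat" where
  "steiner_mat d x y z = mat (2 * d + 2) (2 * d + 2) (\<lambda>(i, j).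
     if i < d \<and> d \<le> j then band x y z i (j - d)
     else if d \<le> i \<and> j < d then - band x y z j (i - d) else 0)"

lemma steiner_mat_carrier: "steiner_mat d x y z \<in> carrier_mat (2 * d + 2) (2 * d + 2)"
  by (simp add: steiner_mat_def)

lemma steiner_mat_mult_upper:
  assumes w: "w \<in> carrier_vec (2 * d + 2)" and i: "i < d"
  shows "(steiner_mat d x y z *\<^sub>v w) $ i = x * w $ (d + i) + y * w $ (d + (i + 1)) + z * w $ (d + (i + 2))"
proof -
  have "(steiner_mat d x y z *\<^sub>v w) $ i = (\<Sum>j<2 * d + 2. steiner_mat d x y z $$ (i, j) * w $ j)"
    using i by (intro mult_mat_vec_index[OF steiner_mat_carrier w]) simp
  also have "\<dots> = (\<Sum>j<2 * d + 2. ((if j = d + i then x else 0) + (if j = d + (i + 1) then y else 0) +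
      (if j = d + (i + 2) then z else 0)) * w $ j)"
    using i by (intro sum.cong) (auto simp: steiner_mat_def band_def)
  finally show ?thesis using i unfolding sum_three_entries by simp
qed

lemma steiner_mat_mult_lower:
  assumes w: "w \<in> carrier_vec (2 * d + 2)" and r: "r < d + 2"
  shows "(steiner_mat d x y z *\<^sub>v w) $ (d + r) = - (band_mat d x y z *\<^sub>v vec d (\<lambda>s. w $ s)) $ r"
proof -
  have "(steiner_mat d x y z *\<^sub>v w) $ (d + r) = (\<Sum>j<2 * d + 2. steiner_mat d x y z $$ (d + r, j) * w $ j)"
    using r by (intro mult_mat_vec_index[OF steiner_mat_carrier w]) simp
  also have "\<dots> = (\<Sum>j<d. - band x y z j r * w $ j)"
    using r by (intro sum.mono_neutral_cong_right) (auto simp: steiner_mat_def)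
  also have "\<dots> = - (\<Sum>j<d. band x y z j r * w $ j)"
    by (simp add: sum_negf)
  also have "(\<Sum>j<d. band x y z j r * w $ j) = (band_mat d x y z *\<^sub>v vec d (\<lambda>s. w $ s)) $ r"
    using r by (subst mult_mat_vec_index[OF band_mat_carrier vec_carrier]) (simp_all add: band_mat_def)
  finally show ?thesis .
qed

lemma steiner_mat_kernel_iff:
  assumes w: "w \<in> carrier_vec (2 * d + 2)"
  shows "steiner_mat d x y z *\<^sub>v w = 0\<^sub>v (2 * d + 2) \<longleftrightarrow>
    band_mat d x y z *\<^sub>v vec d (\<lambda>s. w $ s) = 0\<^sub>v (d + 2) \<and> recurrent d x y z (\<lambda>j. w $ (d + j))"
    (is "?A *\<^sub>v w = _ \<longleftrightarrow> ?B = _ \<and> _")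
proof
  assume A: "?A *\<^sub>v w = 0\<^sub>v (2 * d + 2)"
  have "?B $ r = 0" if "r < d + 2" for r
    using steiner_mat_mult_lower[OF w that, of x y z] A that by simp
  then have "?B = 0\<^sub>v (d + 2)"
    using band_mat_carrier[of d x y z] by (intro eq_vecI) (auto simp del: index_mult_mat_vec)
  moreover have "recurrent d x y z (\<lambda>j. w $ (d + j))"
    unfolding recurrent_def using steiner_mat_mult_upper[OF w, of _ x y z] A by simp
  ultimately show "?B = 0\<^sub>v (d + 2) \<and> recurrent d x y z (\<lambda>j. w $ (d + j))" ..
next
  assume B: "?B = 0\<^sub>v (d + 2) \<and> recurrent d x y z (\<lambda>j. w $ (d + j))"
  show "?A *\<^sub>v w = 0\<^sub>v (2 * d + 2)"
  proof (rule eq_vecI)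
    fix i assume "i < dim_vec (0\<^sub>v (2 * d + 2) :: 'a vec)"
    then have i: "i < 2 * d + 2" by simp
    show "(?A *\<^sub>v w) $ i = 0\<^sub>v (2 * d + 2) $ i"
    proof (cases "i < d")
      case True
      then show ?thesis using steiner_mat_mult_upper[OF w True, of x y z] B i by (simp add: recurrent_def)
    next
      case False
      then obtain r where r: "i = d + r" using le_Suc_ex not_less by blast
      then have "r < d + 2" using i by simp
      then show ?thesis using steiner_mat_mult_lower[OF w \<open>r < d + 2\<close>, of x y z] B r i by simp
    qed
  qed (simp add: steiner_mat_def)
qed

lemma steiner_mat_skew: "transpose_mat (steiner_mat d x y z) = - steiner_mat d x y z"
  by (rule eq_matI) (auto simp: steiner_mat_def)

lemma dim_steiner_mat [simp]: "dim_row (steiner_mat d x y z) = 2 * d + 2" "dim_col (steiner_mat d x y z) = 2 * d + 2"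
  by (simp_all add: steiner_mat_def)

text \<open>
  The syzygies of \<^const>\<open>steiner_mat\<close>: zero on the block where \<open>B\<close> is injective, and the maximal minors of \<open>B\<close>
  on the other one. Together with \<open>B\<close> itself they form the Buchsbaum-Rim complex of \<open>B\<^sup>T\<close>.
\<close>
definition syz_mat :: "nat \<Rightarrow> 'a::comm_ring_1 \<Rightarrow> 'a \<Rightarrow> 'a \<Rightarrow> 'a mat" where
  "syz_mat d x y z = mat (2 * d + 2) (d + 2) (\<lambda>(i, j). if i < d then 0 else minors d x y z j (i - d))"

lemma syz_mat_carrier: "syz_mat d x y z \<in> carrier_mat (2 * d + 2) (d + 2)"
  by (simp add: syz_mat_def)

lemma dim_syz_mat [simp]: "dim_row (syz_mat d x y z) = 2 * d + 2" "dim_col (syz_mat d x y z) = d + 2"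
  by (simp_all add: syz_mat_def)

lemma syz_mat_mult_upper:
  assumes "u \<in> carrier_vec (d + 2)" "i < d"
  shows "(syz_mat d x y z *\<^sub>v u) $ i = 0"
  using assms by (subst mult_mat_vec_index[OF syz_mat_carrier assms(1)]) (auto simp: syz_mat_def intro!: sum.neutral)

lemma syz_mat_mult_lower:
  assumes "u \<in> carrier_vec (d + 2)" "j < d + 2"
  shows "(syz_mat d x y z *\<^sub>v u) $ (d + j) = (\<Sum>i<d + 2. minors d x y z i j * u $ i)"
  using assms by (subst mult_mat_vec_index[OF syz_mat_carrier assms(1)]) (auto simp: syz_mat_def intro!: sum.cong)

lemma syz_mat_mult_two:
  assumes ab: "a \<noteq> b" "a < d + 2" "b < d + 2" and j: "j < d + 2"
    and u: "u \<in> carrier_vec (d + 2)" "\<And>i. i < d + 2 \<Longrightarrow> i \<noteq> a \<Longrightarrow> i \<noteq> b \<Longrightarrow> u $ i = 0"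
  shows "(syz_mat d x y z *\<^sub>v u) $ (d + j) = minors d x y z a j * u $ a + minors d x y z b j * u $ b"
proof -
  have "(\<Sum>i<d + 2. minors d x y z i j * u $ i) = (\<Sum>i\<in>{a, b}. minors d x y z i j * u $ i)"
    using ab u(2) by (intro sum.mono_neutral_right) auto
  then show ?thesis using ab(1) syz_mat_mult_lower[OF u(1) j] by simp
qed

lemma steiner_syz_zero:
  assumes v: "v \<in> carrier_vec (d + 2)"
  shows "steiner_mat d x y z *\<^sub>v (syz_mat d x y z *\<^sub>v v) = 0\<^sub>v (2 * d + 2)"
proof -
  let ?w = "syz_mat d x y z *\<^sub>v v"
  have w: "?w \<in> carrier_vec (2 * d + 2)" using mult_mat_vec_carrier[OF syz_mat_carrier v] .
  have "vec d (\<lambda>s. ?w $ s) = 0\<^sub>v d"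
    by (rule eq_vecI) (simp_all add: syz_mat_mult_upper[OF v] del: index_mult_mat_vec)
  then have "band_mat d x y z *\<^sub>v vec d (\<lambda>s. ?w $ s) = 0\<^sub>v (d + 2)"
    using band_mat_carrier[of d x y z] by (intro eq_vecI) auto
  moreover have "recurrent d x y z (\<lambda>j. ?w $ (d + j))"
    unfolding recurrent_def
  proof (intro allI impI)
    fix r assume r: "r < d"
    let ?m = "minors d x y z"
    have "x * ?w $ (d + r) + y * ?w $ (d + (r + 1)) + z * ?w $ (d + (r + 2))
       = (\<Sum>i<d + 2. (x * ?m i r + y * ?m i (r + 1) + z * ?m i (r + 2)) * v $ i)"
      using r by (simp only: syz_mat_mult_lower[OF v])
        (simp add: syz_mat_mult_lower[OF v] sum_distrib_left sum.distrib algebra_simps del: index_mult_mat_vec sum.lessThan_Suc)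
    also have "\<dots> = 0"
    proof (intro sum.neutral ballI)
      fix i assume "i \<in> {..<d + 2}"
      then have "i \<le> d + 1" by simp
      then show "(x * ?m i r + y * ?m i (r + 1) + z * ?m i (r + 2)) * v $ i = 0"
        by (simp only: minors_recurrence[OF r] mult_zero_left)
    qed
    finally show "x * ?w $ (d + r) + y * ?w $ (d + (r + 1)) + z * ?w $ (d + (r + 2)) = 0" .
  qed
  ultimately show ?thesis using steiner_mat_kernel_iff[OF w] by blast
qed

lemma recurrent_orthogonal_band_image:
  assumes w: "recurrent d x y z w" and a: "a \<in> carrier_vec d"
  shows "(\<Sum>i<d + 2. w i * (band_mat d x y z *\<^sub>v a) $ i) = 0"
proof -
  have "(\<Sum>i<d + 2. w i * (band_mat d x y z *\<^sub>v a) $ i) = (\<Sum>i<d + 2. w i * (\<Sum>s<d. band x y z s i * a $ s))"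
    by (intro sum.cong refl, subst mult_mat_vec_index[OF band_mat_carrier a]) (simp_all add: band_mat_def)
  also have "\<dots> = (\<Sum>s<d. a $ s * (\<Sum>i<d + 2. band x y z s i * w i))"
    unfolding sum_distrib_left by (subst sum.swap) (simp only: mult_ac)
  also have "\<dots> = 0"
  proof (intro sum.neutral ballI)
    fix s assume "s \<in> {..<d}"
    then have s: "s < d" by simp
    then have "x * w s + y * w (s + 1) + z * w (s + 2) = 0" using w by (simp add: recurrent_def)
    then show "a $ s * (\<Sum>i<d + 2. band x y z s i * w i) = 0"
      using s unfolding band_def sum_three_entries by simp
  qed
  finally show ?thesis .
qed

lemma syz_band_zero:
  assumes a: "a \<in> carrier_vec d"
  shows "syz_mat d x y z *\<^sub>v (band_mat d x y z *\<^sub>v a) = 0\<^sub>v (2 * d + 2)"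
proof (rule eq_vecI)
  let ?u = "band_mat d x y z *\<^sub>v a"
  have u: "?u \<in> carrier_vec (d + 2)" using mult_mat_vec_carrier[OF band_mat_carrier a] .
  fix i assume "i < dim_vec (0\<^sub>v (2 * d + 2) :: 'a vec)"
  then have i: "i < 2 * d + 2" by simp
  show "(syz_mat d x y z *\<^sub>v ?u) $ i = 0\<^sub>v (2 * d + 2) $ i"
  proof (cases "i < d")
    case True
    then show ?thesis using syz_mat_mult_upper[OF u True, of x y z] i by simp
  next
    case False
    then obtain j where j: "i = d + j" using le_Suc_ex not_less by blast
    then have jd: "j < d + 2" using i by simp
    have "(syz_mat d x y z *\<^sub>v ?u) $ i = (\<Sum>l<d + 2. - (minors d x y z j l * ?u $ l))"
      unfolding j syz_mat_mult_lower[OF u jd] by (intro sum.cong refl) (simp add: minors_skew[of d x y z _ j])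
    also have "\<dots> = 0"
      using recurrent_orthogonal_band_image[OF recurrent_minors a, of j x y z] jd by (simp only: sum_negf minus_zero)
    finally show ?thesis using i by simp
  qed
qed (simp add: syz_mat_def)


abbreviation steiner :: "nat \<Rightarrow> mpoly3 mat" where
  "steiner d \<equiv> steiner_mat d (var 0) (var 1) (var 2)"

abbreviation syz :: "nat \<Rightarrow> mpoly3 mat" where
  "syz d \<equiv> syz_mat d (var 0) (var 1) (var 2)"

abbreviation bandm :: "nat \<Rightarrow> mpoly3 mat" where
  "bandm d \<equiv> band_mat d (var 0) (var 1) (var 2)"

lemma band_mat_kernel: "mat_kernel (bandm d) = {0\<^sub>v d}"
proof -
  have "bandm d *\<^sub>v 0\<^sub>v d = 0\<^sub>v (d + 2)"
    by (intro eq_vecI) (auto simp: scalar_prod_def)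
  then show ?thesis
    using band_mat_injective_x[of _ d "var 0"] by (auto simp: mat_kernel[OF band_mat_carrier])
qed

text \<open>
  If \<open>u\<close> is a syzygy of the minors, division by \<open>x\<^sub>0 + x\<^sub>1 t + x\<^sub>2 t\<^sup>2\<close> leaves a remainder with two entries that is
  again such a syzygy; two independent rows of minors force it to vanish. So \<open>u\<close> is in the image of \<open>B\<close>
  after multiplication by a power of \<open>x\<^sub>2\<close>, and in the same way by a power of \<open>x\<^sub>0\<close>.
\<close>
lemma syz_kernel:
  assumes d: "d > 0" shows "mat_kernel (syz d) = mat_image (bandm d)"
proof (rule exact_by_saturation[where i = 2 and j = 0 and k = d and ?\<phi>3.0 = "0\<^sub>m d 0" and ?n3.0 = 0,
      OF syz_mat_carrier band_mat_carrier])
  fix u :: "mpoly3 vec" assume u: "u \<in> carrier_vec (d + 2)" and zero: "syz d *\<^sub>v u = 0\<^sub>v (2 * d + 2)"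
  obtain a where a: "a \<in> carrier_vec d"
    and a_eq: "\<And>r. r < d + 2 \<Longrightarrow> 2 \<le> r \<Longrightarrow> var 2 ^ d * u $ r = (bandm d *\<^sub>v a) $ r"
    using band_mat_forward_division[OF u, of d "var 2" "var 0" "var 1"] by auto
  obtain b where b: "b \<in> carrier_vec d"
    and b_eq: "\<And>r. r < d \<Longrightarrow> var 0 ^ d * u $ r = (bandm d *\<^sub>v b) $ r"
    using band_mat_backward_division[OF u, of "var 0" "var 1" "var 2"] by auto
  have Bc: "bandm d *\<^sub>v a \<in> carrier_vec (d + 2)" "bandm d *\<^sub>v b \<in> carrier_vec (d + 2)"
    using mult_mat_vec_carrier[OF band_mat_carrier] a b by auto
  have syz_zero: "syz d *\<^sub>v (c \<cdot>\<^sub>v u - bandm d *\<^sub>v e) = 0\<^sub>v (2 * d + 2)" if e: "e \<in> carrier_vec d" for c e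
  proof -
    have "bandm d *\<^sub>v e \<in> carrier_vec (d + 2)" using mult_mat_vec_carrier[OF band_mat_carrier e] .
    then show ?thesis using u zero syz_band_zero[OF e, of "var 0" "var 1" "var 2"]
      by (simp add: mult_minus_distrib_mat_vec[OF syz_mat_carrier] mult_mat_vec_smult[OF syz_mat_carrier] smult_zero_vec_right)
  qed
  let ?e = "var 2 ^ d \<cdot>\<^sub>v u - bandm d *\<^sub>v a"
  have e: "?e \<in> carrier_vec (d + 2)" using u Bc by simp
  have e0: "?e $ r = 0" if "r < d + 2" "2 \<le> r" for r
    using a_eq[OF that] u Bc that by (simp del: index_mult_mat_vec)
  have "minors d (var 0) (var 1) (var 2) 0 j * ?e $ 0 + minors d (var 0) (var 1) (var 2) 1 j * ?e $ 1 = 0"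
    if j: "j < d + 2" for j
    using syz_mat_mult_two[of 0 1 d j ?e "var 0" "var 1" "var 2"] e e0 j syz_zero[OF a, of "var 2 ^ d"] by simp
  from this[of 0] this[of 1] have "?e $ 0 = 0" "?e $ 1 = 0"
    by (simp_all add: minors_def)
  then have e_zero: "?e $ r = 0" if "r < d + 2" for r
    using e0[OF that] less_2_cases[of r] by (cases "2 \<le> r") auto
  have "var 2 ^ d \<cdot>\<^sub>v u = bandm d *\<^sub>v a"
  proof (rule eq_vecI)
    fix r assume "r < dim_vec (bandm d *\<^sub>v a)"
    then have r: "r < d + 2" using Bc by simp
    show "(var 2 ^ d \<cdot>\<^sub>v u) $ r = (bandm d *\<^sub>v a) $ r"
      using e_zero[OF r] u Bc r by (simp del: index_mult_mat_vec)
  qed (use u Bc in simp)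
  then show "\<exists>v\<in>carrier_vec d. var 2 ^ d \<cdot>\<^sub>v u = bandm d *\<^sub>v v" using a by blast
  let ?f = "var 0 ^ d \<cdot>\<^sub>v u - bandm d *\<^sub>v b"
  have f: "?f \<in> carrier_vec (d + 2)" using u Bc by simp
  have f0: "?f $ r = 0" if "r < d" for r
    using b_eq[OF that] u Bc that by (simp del: index_mult_mat_vec)
  have "minors d (var 0) (var 1) (var 2) d j * ?f $ d + minors d (var 0) (var 1) (var 2) (d + 1) j * ?f $ (d + 1) = 0"
    if j: "j < d + 2" for j
    using syz_mat_mult_two[of d "d + 1" d j ?f "var 0" "var 1" "var 2"] f f0 j syz_zero[OF b, of "var 0 ^ d"] by simp
  from this[of d] this[of "d + 1"] have "?f $ d = 0" "?f $ (d + 1) = 0"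
    by (simp_all add: minors_def)
  then have f_zero: "?f $ r = 0" if "r < d + 2" for r
    using f0[of r] that by (metis add_2_eq_Suc' less_SucE Suc_eq_plus1)
  have "var 0 ^ d \<cdot>\<^sub>v u = bandm d *\<^sub>v b"
  proof (rule eq_vecI)
    fix r assume "r < dim_vec (bandm d *\<^sub>v b)"
    then have r: "r < d + 2" using Bc by simp
    show "(var 0 ^ d \<cdot>\<^sub>v u) $ r = (bandm d *\<^sub>v b) $ r"
      using f_zero[OF r] u Bc r by (simp del: index_mult_mat_vec)
  qed (use u Bc in simp)
  then show "\<exists>v\<in>carrier_vec d. var 0 ^ d \<cdot>\<^sub>v u = bandm d *\<^sub>v v" using b by blast
qed (simp_all add: syz_band_zero band_mat_kernel mat_image_no_columns)

text \<open>
  The two hypotheses of the saturation criterion are the expansions of a solution of the recurrence by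
  its first two and by its last two entries.
\<close>
lemma steiner_kernel:
  assumes d: "d > 0" shows "mat_kernel (steiner d) = mat_image (syz d)"
proof (rule exact_by_saturation[where i = 2 and j = 0 and k = d and ?\<phi>3.0 = "bandm d" and ?n3.0 = d,
      OF steiner_mat_carrier syz_mat_carrier band_mat_carrier])
  fix w :: "mpoly3 vec" assume w: "w \<in> carrier_vec (2 * d + 2)" and zero: "steiner d *\<^sub>v w = 0\<^sub>v (2 * d + 2)"
  have upper: "vec d (\<lambda>s. w $ s) = 0\<^sub>v d" and rec: "recurrent d (var 0) (var 1) (var 2) (\<lambda>j. w $ (d + j))"
    using zero band_mat_injective_x[of "vec d (\<lambda>s. w $ s)" d "var 0"] unfolding steiner_mat_kernel_iff[OF w] by auto
  have w0: "w $ s = 0" if "s < d" for s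
    using arg_cong[OF upper, of "\<lambda>v. v $ s"] that by simp
  have solve: "\<exists>u\<in>carrier_vec (d + 2). c \<cdot>\<^sub>v w = syz d *\<^sub>v u"
    if ab: "a \<noteq> b" "a < d + 2" "b < d + 2"
      and eq: "\<And>j. j < d + 2 \<Longrightarrow> c * w $ (d + j) =
          p * minors d (var 0) (var 1) (var 2) a j - q * minors d (var 0) (var 1) (var 2) b j" for a b c p q
  proof
    let ?u = "vec (d + 2) (\<lambda>i. if i = a then p else if i = b then - q else 0)"
    show u: "?u \<in> carrier_vec (d + 2)" by simp
    show "c \<cdot>\<^sub>v w = syz d *\<^sub>v ?u"
    proof (rule eq_vecI)
      fix i assume "i < dim_vec (syz d *\<^sub>v ?u)"
      then have i: "i < 2 * d + 2" by (simp add: syz_mat_def)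
      show "(c \<cdot>\<^sub>v w) $ i = (syz d *\<^sub>v ?u) $ i"
      proof (cases "i < d")
        case True
        then show ?thesis using w w0[OF True] i syz_mat_mult_upper[OF u True, of "var 0" "var 1" "var 2"] by simp
      next
        case False
        then obtain j where j: "i = d + j" using le_Suc_ex not_less by blast
        then have jd: "j < d + 2" using i by simp
        have "(syz d *\<^sub>v ?u) $ (d + j) = minors d (var 0) (var 1) (var 2) a j * ?u $ a + minors d (var 0) (var 1) (var 2) b j * ?u $ b"
          by (rule syz_mat_mult_two[OF ab jd u]) simp
        also have "\<dots> = c * w $ (d + j)"
          using ab eq[OF jd] by (simp add: mult.commute)
        finally show ?thesis using w i j by simp
      qed
    qed (use w in \<open>simp add: syz_mat_def\<close>)
  qed
  show "\<exists>u\<in>carrier_vec (d + 2). var 2 ^ d \<cdot>\<^sub>v w = syz d *\<^sub>v u"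
    by (rule solve[of 0 1 _ "w $ (d + 1)" "w $ (d + 0)"])
      (use recurrent_forward_expansion[OF rec _ d] in simp_all)
  show "\<exists>u\<in>carrier_vec (d + 2). var 0 ^ d \<cdot>\<^sub>v w = syz d *\<^sub>v u"
    by (rule solve[of d "d + 1" _ "w $ (d + (d + 1))" "w $ (d + d)"])
      (use recurrent_backward_expansion[OF rec _ d] in simp_all)
qed (simp_all add: steiner_syz_zero syz_kernel[OF d] band_mat_regular_mod_powers)

lemma is_form_minors:
  assumes "i < d + 2" "j < d + 2"
  shows "is_form (int d) (minors d (var 0) (var 1) (var 2) i j)"
proof -
  have "is_form (int d) (var 0 ^ a * var 2 ^ (d + 1 - b) * lucas (var 0) (var 1) (var 2) (b - a))"
    if "a \<le> b" "b \<le> d + 1" for a b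
  proof -
    have "is_form (int a + int (d + 1 - b) + (int (b - a) - 1))
        (var 0 ^ a * var 2 ^ (d + 1 - b) * lucas (var 0) (var 1) (var 2) (b - a))"
      by (intro is_form_mult is_form_var_power is_form_lucas)
    moreover have "int a + int (d + 1 - b) + (int (b - a) - 1) = int d" using that by simp
    ultimately show ?thesis by simp
  qed
  then show ?thesis using assms by (auto simp: minors_def is_form_uminus)
qed

lemma is_form_band: "is_form 1 (band (var a) (var b) (var c) i j)"
  by (auto simp: band_def intro!: is_form_add is_form_var)

lemma graded_map_replicate_iff:
  "graded_map (replicate m a) (replicate n b) \<phi> \<longleftrightarrow>
    \<phi> \<in> carrier_mat n m \<and> (\<forall>i<n. \<forall>j<m. is_form (b - a) (\<phi> $$ (i, j)))"
  by (simp add: graded_map_def)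

lemma steiner_resolution:
  assumes d: "d > 0"
  shows "graded_free_resolution (replicate (2 * d + 2) 0) (replicate (2 * d + 2) (- 1))
    (replicate (d + 2) (- int d - 1)) (replicate d (- int d - 2)) (steiner d) (syz d) (bandm d)"
  unfolding graded_free_resolution_def
proof (intro conjI)
  show "graded_map (replicate (2 * d + 2) (- 1)) (replicate (2 * d + 2) 0) (steiner d)"
    unfolding graded_map_replicate_iff by (auto simp: steiner_mat_def is_form_band is_form_uminus)
  show "graded_map (replicate (d + 2) (- int d - 1)) (replicate (2 * d + 2) (- 1)) (syz d)"
    unfolding graded_map_replicate_iff by (auto simp: syz_mat_def is_form_minors)
  show "graded_map (replicate d (- int d - 2)) (replicate (d + 2) (- int d - 1)) (bandm d)"
    unfolding graded_map_replicate_iff by (auto simp: band_mat_def is_form_band)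
qed (simp_all add: steiner_kernel syz_kernel band_mat_kernel d)

lemma eval_band: "eval3 (band (var a) (var b) (var c) i j) v = band (v a) (v b) (v c) i j"
  by (auto simp: band_def eval3_var eval3_0)

lemma eval_steiner: "eval_mat (steiner d) v = steiner_mat d (v 0) (v 1) (v 2)"
  by (rule eq_matI) (auto simp: eval_mat_def steiner_mat_def eval_band eval3_uminus eval3_0)

lemma lucas_product_zero: "lucas 0 y 0 (Suc k) = (- y) ^ k"
  by (induction k) simp_all

lemma steiner_mat_kernel_minors:
  assumes i: "i < d + 2"
  shows "steiner_mat d x y z *\<^sub>v vec (2 * d + 2) (\<lambda>t. if t < d then 0 else minors d x y z i (t - d)) = 0\<^sub>v (2 * d + 2)"
proof -
  let ?w = "vec (2 * d + 2) (\<lambda>t. if t < d then 0 else minors d x y z i (t - d))"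
  have "vec d (\<lambda>s. ?w $ s) = 0\<^sub>v d" by (rule eq_vecI) auto
  then have "band_mat d x y z *\<^sub>v vec d (\<lambda>s. ?w $ s) = 0\<^sub>v (d + 2)"
    using band_mat_carrier[of d x y z] by (intro eq_vecI) auto
  moreover have "recurrent d x y z (\<lambda>j. ?w $ (d + j))"
    using recurrent_minors[of i d x y z] i by (simp add: recurrent_def)
  ultimately show ?thesis using steiner_mat_kernel_iff[of ?w d x y z] by simp
qed

text \<open>
  At a point with \<open>z \<noteq> 0\<close> the kernel has the first two entries of a solution of the recurrence as coordinates, with
  \<open>x \<noteq> 0\<close> the last two, and at \<open>x = z = 0\<close> the first and the last one.
\<close>
lemma rank_steiner_mat:
  fixes x y z :: complex
  assumes d: "d > 0" and nz: "x \<noteq> 0 \<or> y \<noteq> 0 \<or> z \<noteq> 0"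
  shows "vec_space.rank (2 * d + 2) (steiner_mat d x y z) = 2 * d"
proof -
  let ?K = "\<lambda>i. vec (2 * d + 2) (\<lambda>t. if t < d then 0 else minors d x y z i (t - d))"
  have zeroI: "w = 0\<^sub>v (2 * d + 2)" if w: "w \<in> carrier_vec (2 * d + 2)" "steiner_mat d x y z *\<^sub>v w = 0\<^sub>v (2 * d + 2)"
    and lower: "\<And>j. j \<le> d + 1 \<Longrightarrow> w $ (d + j) = 0" for w
  proof -
    have "band_mat d x y z *\<^sub>v vec d (\<lambda>s. w $ s) = 0\<^sub>v (d + 2)"
      using w steiner_mat_kernel_iff by blast
    note B = this
    have "vec d (\<lambda>s. w $ s) = 0\<^sub>v d"
    proof (cases "x = 0 \<and> z = 0")
      case True
      then show ?thesis
        using band_mat_injective_y[OF vec_carrier B[unfolded conjunct1[OF True] conjunct2[OF True]]] nz by blast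
    next
      case False
      then show ?thesis
        using band_mat_injective_x[OF vec_carrier B] band_mat_injective_z[OF vec_carrier B] by blast
    qed
    then have upper: "w $ s = 0" if "s < d" for s
      using that by (metis index_vec index_zero_vec(1))
    have "w $ i = 0" if "i < 2 * d + 2" for i
      using upper[of i] lower[of "i - d"] that by (cases "i < d") auto
    then show ?thesis using w(1) by (intro eq_vecI) auto
  qed
  have rec: "recurrent d x y z (\<lambda>j. w $ (d + j))"
    if "w \<in> carrier_vec (2 * d + 2)" "steiner_mat d x y z *\<^sub>v w = 0\<^sub>v (2 * d + 2)" for w
    using that steiner_mat_kernel_iff by blast
  have K: "?K i \<in> carrier_vec (2 * d + 2)" "i < d + 2 \<Longrightarrow> steiner_mat d x y z *\<^sub>v ?K i = 0\<^sub>v (2 * d + 2)"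
    "j < d + 2 \<Longrightarrow> ?K i $ (d + j) = minors d x y z i j" for i j
    using steiner_mat_kernel_minors[of i d x y z] by simp_all
  consider "z \<noteq> 0" | "x \<noteq> 0" | "x = 0" "z = 0" "y \<noteq> 0" using nz by blast
  then have "vec_space.rank (2 * d + 2) (steiner_mat d x y z) = 2 * d + 2 - 2"
  proof cases
    case 1
    show ?thesis
    proof (rule rank_eq_if_kernel_coordinates[where a = "d + 0" and b = "d + 1" and u = "?K 1" and v = "?K 0"])
      fix w :: "complex vec" assume w: "w \<in> carrier_vec (2 * d + 2)" "steiner_mat d x y z *\<^sub>v w = 0\<^sub>v (2 * d + 2)"
        "w $ (d + 0) = 0" "w $ (d + 1) = 0"
      show "w = 0\<^sub>v (2 * d + 2)"
        by (rule zeroI[OF w(1,2)]) (rule recurrent_zero_forward[OF rec[OF w(1,2)] 1 w(3,4)])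
    qed (use d 1 K in \<open>simp_all only: steiner_mat_carrier\<close>, simp_all add: minors_def)
  next
    case 2
    show ?thesis
    proof (rule rank_eq_if_kernel_coordinates[where a = "d + d" and b = "d + (d + 1)" and u = "?K (d + 1)" and v = "?K d"])
      fix w :: "complex vec" assume w: "w \<in> carrier_vec (2 * d + 2)" "steiner_mat d x y z *\<^sub>v w = 0\<^sub>v (2 * d + 2)"
        "w $ (d + d) = 0" "w $ (d + (d + 1)) = 0"
      show "w = 0\<^sub>v (2 * d + 2)"
        by (rule zeroI[OF w(1,2)]) (rule recurrent_zero_backward[OF rec[OF w(1,2)] 2 w(4,3)])
    qed (use d 2 K in \<open>simp_all only: steiner_mat_carrier\<close>, simp_all add: minors_def)
  next
    case 3
    show ?thesis
    proof (rule rank_eq_if_kernel_coordinates[where a = "d + 0" and b = "d + (d + 1)" and u = "?K (d + 1)" and v = "?K 0"])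
      fix w :: "complex vec" assume w: "w \<in> carrier_vec (2 * d + 2)" "steiner_mat d x y z *\<^sub>v w = 0\<^sub>v (2 * d + 2)"
        "w $ (d + 0) = 0" "w $ (d + (d + 1)) = 0"
      have inner: "w $ (d + (r + 1)) = 0" if "r < d" for r
        using rec[OF w(1,2)] that 3 by (simp add: recurrent_def)
      have "w $ (d + j) = 0" if "j \<le> d + 1" for j
        using w(3,4) inner[of "j - 1"] that by (cases "j = 0 \<or> j = d + 1") auto
      then show "w = 0\<^sub>v (2 * d + 2)" using zeroI[OF w(1,2)] by blast
    qed (use d 3 K in \<open>simp_all only: steiner_mat_carrier\<close>, simp_all add: minors_def lucas_product_zero)
  qed
  then show ?thesis by simp
qed

lemma nonzero_three: "(\<exists>i::3. v i \<noteq> 0) \<longleftrightarrow> v 0 \<noteq> 0 \<or> v 1 \<noteq> 0 \<or> v 2 \<noteq> (0::complex)"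
  using all_three[of "\<lambda>i. v i = 0"] by blast

text \<open>
  The bundle with resolution \<open>0 \<rightarrow> O(-1)\<^sup>d \<rightarrow> O\<^sup>d\<^sup>+\<^sup>2 \<rightarrow> E \<rightarrow> 0\<close> has total Chern class \<open>(1 - h)\<^sup>-\<^sup>d\<close>, and \<open>E(-1)\<close> has
  no cohomology: this is the case of equality.
\<close>
theorem m_effective_steiner:
  assumes d: "d > 0" shows "m_effective (int d) (int ((d + 1) choose 2))"
  unfolding m_effective_def
proof (intro exI conjI)
  show "int (2 * d + 2) = 2 * int d + 2" "int (2 * d) = 2 * int d" by simp_all
  show "skew_linear_matrix (2 * d + 2) (steiner d)"
    unfolding skew_linear_matrix_def using steiner_mat_skew
    by (auto simp: steiner_mat_def is_form_band is_form_uminus)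
  show "spans_dim3 (2 * d + 2) (steiner d)"
    unfolding spans_dim3_def eval_steiner
  proof (intro allI impI)
    fix v :: "3 \<Rightarrow> complex" and i :: 3
    assume zero: "steiner_mat d (v 0) (v 1) (v 2) = 0\<^sub>m (2 * d + 2) (2 * d + 2)"
    have "steiner_mat d (v 0) (v 1) (v 2) $$ (0, d + k) = 0" if "k < 3" for k
      using d that unfolding zero by simp
    from this[of 0] this[of 1] this[of 2] have "v 0 = 0" "v 1 = 0" "v 2 = 0"
      using d by (simp_all add: steiner_mat_def band_def)
    then show "v i = 0" using all_three[of "\<lambda>i. v i = 0"] by blast
  qed
  show "constant_rank (2 * d + 2) (2 * d) (steiner d)"
    unfolding constant_rank_def eval_steiner nonzero_three using rank_steiner_mat[OF d] by blast
  show "coker_has_chern_classes (replicate (2 * d + 2) 0) (replicate (2 * d + 2) (- 1)) (steiner d) (int d)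
     (int ((d + 1) choose 2))"
    unfolding coker_has_chern_classes_def whitney_iff
  proof (intro exI conjI)
    show "graded_free_resolution (replicate (2 * d + 2) 0) (replicate (2 * d + 2) (- 1))
      (replicate (d + 2) (- int d - 1)) (replicate d (- int d - 2)) (steiner d) (syz d) (bandm d)"
      by (rule steiner_resolution[OF d])
    have "2 * ((d + 1) choose 2) = d * (d + 1)" by (simp add: choose_two)
    then have "2 * int ((d + 1) choose 2) = int d * (int d + 1)"
      by (metis of_nat_1 of_nat_add of_nat_mult of_nat_numeral)
    then show "(int d)\<^sup>2 - 2 * int ((d + 1) choose 2) + int d + (\<Sum>d\<leftarrow>replicate (2 * d + 2) (- 1). d * (d + 1)) +
        (\<Sum>d\<leftarrow>replicate d (- int d - 2). d * (d + 1)) =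
      (\<Sum>d\<leftarrow>replicate (2 * d + 2) 0. d * (d + 1)) + (\<Sum>d\<leftarrow>replicate (d + 2) (- int d - 1). d * (d + 1))"
      by (simp add: sum_list_replicate power2_eq_square algebra_simps)
  qed (simp add: sum_list_replicate algebra_simps)
qed

section \<open>Pfaffians and the bundle O + O(d)\<close>

text \<open>
  On the indices \<open>0, ..., 2d\<close> this is a skew-symmetric matrix with three antidiagonals \<open>x, y, z\<close> whose sign changes
  across the diagonal; its Pfaffians of size \<open>2d\<close> generate a Gorenstein ideal. The last row and column are zero
  and contribute the summand \<open>O\<close> of the cokernel \<open>O + O(d)\<close>.
\<close>
definition gorenstein_mat :: "nat \<Rightarrow> 'a::comm_ring_1 \<Rightarrow> 'a \<Rightarrow> 'a \<Rightarrow> 'a mat" where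
  "gorenstein_mat d x y z = mat (2 * d + 2) (2 * d + 2) (\<lambda>(i, j).
     if 2 * d < i \<or> 2 * d < j \<or> i = j then 0
     else if i < j then band x y z (2 * d - 1) (i + j) else - band x y z (2 * d - 1) (i + j))"

lemma gorenstein_mat_carrier: "gorenstein_mat d x y z \<in> carrier_mat (2 * d + 2) (2 * d + 2)"
  by (simp add: gorenstein_mat_def)

lemma dim_gorenstein_mat [simp]:
  "dim_row (gorenstein_mat d x y z) = 2 * d + 2" "dim_col (gorenstein_mat d x y z) = 2 * d + 2"
  by (simp_all add: gorenstein_mat_def)

lemma gorenstein_mat_skew: "transpose_mat (gorenstein_mat d x y z) = - gorenstein_mat d x y z"
  by (rule eq_matI) (auto simp: gorenstein_mat_def add.commute)

lemma gorenstein_mat_mult: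
  assumes w: "w \<in> carrier_vec (2 * d + 2)" and i: "i < 2 * d + 2"
    and entry: "\<And>j. j < 2 * d + 2 \<Longrightarrow> gorenstein_mat d x y z $$ (i, j) =
       (if j = a then p else 0) + (if j = b then q else 0) + (if j = c then r else 0)"
    and abc: "a < 2 * d + 2" "b < 2 * d + 2" "c < 2 * d + 2"
  shows "(gorenstein_mat d x y z *\<^sub>v w) $ i = p * w $ a + q * w $ b + r * w $ c"
proof -
  have "(gorenstein_mat d x y z *\<^sub>v w) $ i = (\<Sum>j<2 * d + 2. gorenstein_mat d x y z $$ (i, j) * w $ j)"
    by (rule mult_mat_vec_index[OF gorenstein_mat_carrier w i])
  also have "\<dots> = (\<Sum>j<2 * d + 2. ((if j = a then p else 0) + (if j = b then q else 0) + (if j = c then r else 0)) * w $ j)"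
    by (intro sum.cong refl) (simp add: entry)
  finally show ?thesis using abc unfolding sum_three_entries by simp
qed

lemma gorenstein_mat_entry:
  assumes "i \<le> 2 * d" "j < 2 * d + 2"
  shows "gorenstein_mat d x y z $$ (i, j) = (if 2 * d < j \<or> i = j then 0
     else if i < j then band x y z (2 * d - 1) (i + j) else - band x y z (2 * d - 1) (i + j))"
  using assms by (simp add: gorenstein_mat_def)

lemma gorenstein_mat_mult_upper:
  assumes w: "w \<in> carrier_vec (2 * d + 2)" and i: "i < d"
  shows "(gorenstein_mat d x y z *\<^sub>v w) $ i =
    x * w $ (2 * d - 1 - i) + y * w $ (2 * d - i) + (if i = 0 then 0 else z) * w $ (2 * d + 1 - i)"
proof (rule gorenstein_mat_mult[OF w])
  fix j assume j: "j < 2 * d + 2"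
  have "i \<le> 2 * d" using i by simp
  note e = gorenstein_mat_entry[OF this j, of x y z]
  consider (outside) "2 * d < j" | (diagonal) "j \<le> i" | (inside) "i < j" "j \<le> 2 * d" by linarith
  then show "gorenstein_mat d x y z $$ (i, j) = (if j = 2 * d - 1 - i then x else 0) +
      (if j = 2 * d - i then y else 0) + (if j = 2 * d + 1 - i then if i = 0 then 0 else z else 0)"
  proof cases
    case outside
    have "j \<noteq> 2 * d - 1 - i" "j \<noteq> 2 * d - i" "j = 2 * d + 1 - i \<longleftrightarrow> i = 0"
      using outside i j by linarith+
    then show ?thesis unfolding e using outside by simp
  next
    case diagonal
    have "j \<noteq> 2 * d - 1 - i" "j \<noteq> 2 * d - i" "j \<noteq> 2 * d + 1 - i"
      "i + j \<noteq> 2 * d - 1" "i + j \<noteq> 2 * d - 1 + 1" "i + j \<noteq> 2 * d - 1 + 2"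
      using diagonal i by linarith+
    then show ?thesis unfolding e band_def using diagonal by simp
  next
    case inside
    have c: "(i + j = 2 * d - 1) = (j = 2 * d - 1 - i)" "(i + j = 2 * d - 1 + 1) = (j = 2 * d - i)"
      "(i + j = 2 * d - 1 + 2) = (j = 2 * d + 1 - i)" "i = 0 \<Longrightarrow> j \<noteq> 2 * d + 1 - i"
      using i inside by linarith+
    show ?thesis unfolding e band_def c(1-3) using inside c(4) by simp
  qed
qed (use i in auto)

lemma gorenstein_mat_mult_middle:
  assumes w: "w \<in> carrier_vec (2 * d + 2)" and d: "d > 0"
  shows "(gorenstein_mat d x y z *\<^sub>v w) $ d = - x * w $ (d - 1) + 0 * w $ d + z * w $ (d + 1)"
proof (rule gorenstein_mat_mult[OF w])
  fix j assume j: "j < 2 * d + 2"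
  have "d \<le> 2 * d" by simp
  note e = gorenstein_mat_entry[OF this j, of x y z]
  have c: "(d + j = 2 * d - 1) = (j = d - 1)" "(d + j = 2 * d - 1 + 1) = (j = d)"
      "(d + j = 2 * d - 1 + 2) = (j = d + 1)"
    using d by linarith+
  consider (outside) "2 * d < j" | "j = d" | "d < j" "j \<le> 2 * d" | "j < d" by linarith
  then show "gorenstein_mat d x y z $$ (d, j) = (if j = d - 1 then - x else 0) +
      (if j = d then 0 else 0) + (if j = d + 1 then z else 0)"
    unfolding e band_def c using d by cases auto
qed (use d in auto)

lemma gorenstein_mat_mult_lower:
  assumes w: "w \<in> carrier_vec (2 * d + 2)" and i: "d < i" "i \<le> 2 * d"
  shows "(gorenstein_mat d x y z *\<^sub>v w) $ i =
    (if i = 2 * d then 0 else - x) * w $ (2 * d - 1 - i) + - y * w $ (2 * d - i) + - z * w $ (2 * d + 1 - i)"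
proof (rule gorenstein_mat_mult[OF w])
  fix j assume j: "j < 2 * d + 2"
  note e = gorenstein_mat_entry[OF i(2) j, of x y z]
  consider (outside) "2 * d < j" | (diagonal) "i \<le> j" "j \<le> 2 * d" | (inside) "j < i" by linarith
  then show "gorenstein_mat d x y z $$ (i, j) = (if j = 2 * d - 1 - i then if i = 2 * d then 0 else - x else 0) +
      (if j = 2 * d - i then - y else 0) + (if j = 2 * d + 1 - i then - z else 0)"
  proof cases
    case outside
    have "j \<noteq> 2 * d - 1 - i" "j \<noteq> 2 * d - i" "j \<noteq> 2 * d + 1 - i"
      using outside i j by linarith+
    then show ?thesis unfolding e using outside by simp
  next
    case diagonal
    have "j \<noteq> 2 * d - 1 - i" "j \<noteq> 2 * d - i" "j \<noteq> 2 * d + 1 - i"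
      "i + j \<noteq> 2 * d - 1" "i + j \<noteq> 2 * d - 1 + 1" "i + j \<noteq> 2 * d - 1 + 2"
      using diagonal i by linarith+
    then show ?thesis unfolding e band_def using diagonal by simp
  next
    case inside
    have c: "(i + j = 2 * d - 1) = (i \<noteq> 2 * d \<and> j = 2 * d - 1 - i)" "(i + j = 2 * d - 1 + 1) = (j = 2 * d - i)"
      "(i + j = 2 * d - 1 + 2) = (j = 2 * d + 1 - i)"
      using i inside by linarith+
    show ?thesis unfolding e band_def c using inside i by simp
  qed
qed (use i in auto)

lemma gorenstein_mat_mult_last:
  assumes w: "w \<in> carrier_vec (2 * d + 2)"
  shows "(gorenstein_mat d x y z *\<^sub>v w) $ (2 * d + 1) = 0"
proof -
  have "(gorenstein_mat d x y z *\<^sub>v w) $ (2 * d + 1) = 0 * w $ 0 + 0 * w $ 0 + 0 * w $ 0"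
    by (rule gorenstein_mat_mult[OF w]) (simp_all add: gorenstein_mat_def)
  then show ?thesis by simp
qed

text \<open>
  The recurrence of the band matrix for a sequence that is extended by 0 to the left of index 0.
\<close>
definition half_recurrent :: "nat \<Rightarrow> 'a::comm_ring_1 \<Rightarrow> 'a \<Rightarrow> 'a \<Rightarrow> (nat \<Rightarrow> 'a) \<Rightarrow> bool" where
  "half_recurrent d x y z w \<longleftrightarrow> y * w 0 + z * w 1 = 0 \<and> recurrent (d - 1) x y z w"

text \<open>
  The kernel equations of the three antidiagonal matrix. The rows below the middle one involve only the first half
  of the sequence, those above it only the second half, read backwards; the middle row glues the halves.
\<close>
definition birecurrent :: "nat \<Rightarrow> 'a::comm_ring_1 \<Rightarrow> 'a \<Rightarrow> 'a \<Rightarrow> (nat \<Rightarrow> 'a) \<Rightarrow> bool" where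
  "birecurrent d x y z w \<longleftrightarrow> half_recurrent d x y z w \<and> x * w (d - 1) = z * w (d + 1) \<and>
     half_recurrent d z y x (\<lambda>j. w (2 * d - j))"

lemma half_recurrent_iff:
  assumes "d > 0"
  shows "half_recurrent d x y z w \<longleftrightarrow>
    (\<forall>i<d. (if i = 0 then 0 else x) * w (i - 1) + y * w i + z * w (i + 1) = 0)"
proof -
  obtain e where e: "d = Suc e" using assms gr0_implies_Suc by blast
  show ?thesis unfolding e half_recurrent_def recurrent_def All_less_Suc2 by simp
qed

lemma gorenstein_mat_kernel_iff:
  assumes w: "w \<in> carrier_vec (2 * d + 2)" and d: "d > 0"
  shows "gorenstein_mat d x y z *\<^sub>v w = 0\<^sub>v (2 * d + 2) \<longleftrightarrow> birecurrent d x y z (\<lambda>j. w $ j)"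
    (is "?A *\<^sub>v w = _ \<longleftrightarrow> _")
proof -
  have upper: "(?A *\<^sub>v w) $ i = (if i = 0 then 0 else z) * w $ (2 * d - (i - 1)) + y * w $ (2 * d - i) + x * w $ (2 * d - (i + 1))"
    if i: "i < d" for i
  proof -
    have e: "2 * d - 1 - i = 2 * d - (i + 1)" by simp
    have "(if i = 0 then 0 else z) * w $ (2 * d + 1 - i) = (if i = 0 then 0 else z) * w $ (2 * d - (i - 1))"
    proof (cases i)
      case (Suc k)
      then have "2 * d + 1 - i = 2 * d - (i - 1)" by linarith
      then show ?thesis by (simp only:)
    qed simp
    then show ?thesis unfolding gorenstein_mat_mult_upper[OF w i] e by (simp only: ac_simps)
  qed
  have lower: "(?A *\<^sub>v w) $ (2 * d - i) = - ((if i = 0 then 0 else x) * w $ (i - 1) + y * w $ i + z * w $ (i + 1))"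
    if i: "i < d" for i
  proof -
    have "2 * d - 1 - (2 * d - i) = i - 1" "2 * d - (2 * d - i) = i" "2 * d + 1 - (2 * d - i) = i + 1"
      "(2 * d - i = 2 * d) = (i = 0)" "d < 2 * d - i" "2 * d - i \<le> 2 * d"
      using i by linarith+
    then show ?thesis
      using gorenstein_mat_mult_lower[OF w, of "2 * d - i" x y z] by (simp del: index_mult_mat_vec)
  qed
  have "?A *\<^sub>v w = 0\<^sub>v (2 * d + 2) \<longleftrightarrow>
    (\<forall>i<d. (?A *\<^sub>v w) $ (2 * d - i) = 0) \<and> (?A *\<^sub>v w) $ d = 0 \<and> (\<forall>i<d. (?A *\<^sub>v w) $ i = 0)"
    (is "?l \<longleftrightarrow> ?r")
  proof
    assume r: ?r
    show ?l
    proof (rule eq_vecI)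
      fix i assume "i < dim_vec (0\<^sub>v (2 * d + 2) :: 'a vec)"
      then have i: "i < 2 * d + 2" by simp
      have "(?A *\<^sub>v w) $ i = 0"
      proof -
        consider "i < d" | "i = d" | "d < i" "i \<le> 2 * d" | "i = 2 * d + 1" using i by linarith
        then show ?thesis
        proof cases
          case 3
          then have "2 * d - (2 * d - i) = i" "2 * d - i < d" by linarith+
          then show ?thesis using conjunct1[OF r, rule_format, of "2 * d - i"] by (simp only:)
        qed (use r gorenstein_mat_mult_last[OF w, of x y z] in \<open>simp_all del: index_mult_mat_vec\<close>)
      qed
      then show "(?A *\<^sub>v w) $ i = 0\<^sub>v (2 * d + 2) $ i" using i by simp
    qed simp
  qed simp
  also have "(\<forall>i<d. (?A *\<^sub>v w) $ (2 * d - i) = 0) \<longleftrightarrow> half_recurrent d x y z (\<lambda>j. w $ j)"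
    unfolding half_recurrent_iff[OF d]
    by (intro all_cong1 imp_cong refl) (simp only: lower neg_equal_0_iff_equal)
  also have "(\<forall>i<d. (?A *\<^sub>v w) $ i = 0) \<longleftrightarrow> half_recurrent d z y x (\<lambda>j. w $ (2 * d - j))"
    unfolding half_recurrent_iff[OF d]
    by (intro all_cong1 imp_cong refl) (simp only: upper)
  also have "(?A *\<^sub>v w) $ d = 0 \<longleftrightarrow> x * w $ (d - 1) = z * w $ (d + 1)"
    unfolding gorenstein_mat_mult_middle[OF w d] by (auto simp: algebra_simps)
  finally show ?thesis unfolding birecurrent_def .
qed

lemma recurrent_cong:
  "(\<And>j. j \<le> d + 1 \<Longrightarrow> v j = w j) \<Longrightarrow> recurrent d x y z v \<longleftrightarrow> recurrent d x y z w"
  unfolding recurrent_def by simp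

lemma birecurrent_reverse:
  assumes "birecurrent d x y z w" and d: "d > 0"
  shows "birecurrent d z y x (\<lambda>j. w (2 * d - j))"
proof -
  have "2 * d - (2 * d - j) = j" if "j \<le> d + 1" for j using that d by linarith
  then have "half_recurrent d x y z (\<lambda>j. w (2 * d - (2 * d - j))) = half_recurrent d x y z w"
    unfolding half_recurrent_def using d
    by (intro arg_cong2[where f = "(\<and>)"] recurrent_cong) simp_all
  moreover have "2 * d - (d - 1) = d + 1" "2 * d - (d + 1) = d - 1" using d by linarith+
  ultimately show ?thesis using assms(1) unfolding birecurrent_def by simp
qed

text \<open>
  Since \<open>z\<close> is a nonzerodivisor, the first entry determines the first half, the middle row then determines the entry
  after the middle, and the second half follows.
\<close>
lemma birecurrent_zero_forward:
  fixes x :: "'a :: idom"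
  assumes w: "birecurrent d x y z w" and d: "d > 0" and z: "z \<noteq> 0" and w0: "w 0 = 0" and j: "j \<le> 2 * d"
  shows "w j = 0"
proof -
  have rec: "recurrent (d - 1) x y z w" "recurrent (d - 1) z y x (\<lambda>j. w (2 * d - j))"
    and mid: "x * w (d - 1) = z * w (d + 1)" and "y * w 0 + z * w 1 = 0"
    using w by (simp_all add: birecurrent_def half_recurrent_def)
  then have w1: "w 1 = 0" using w0 z by simp
  have first: "w j = 0" if "j \<le> d" for j
    using recurrent_zero_forward[OF rec(1) z w0 w1] that d by simp
  then have "w (d + 1) = 0" using mid z by simp
  moreover have "2 * d - (d - 1 + 1) = d" "2 * d - (d - 1) = d + 1" using d by linarith+
  ultimately have "w (2 * d - i) = 0" if "i \<le> d" for i
    using recurrent_zero_backward[OF rec(2) z, of i] first that d by simp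
  from this[of "2 * d - j"] first[of j] show ?thesis using j by (cases "j \<le> d") auto
qed

lemma birecurrent_zero_backward:
  fixes x :: "'a :: idom"
  assumes w: "birecurrent d x y z w" and d: "d > 0" and x: "x \<noteq> 0" and w0: "w (2 * d) = 0" and j: "j \<le> 2 * d"
  shows "w j = 0"
  using birecurrent_zero_forward[OF birecurrent_reverse[OF w d] d x, of "2 * d - j"] w0 j by simp

lemma birecurrent_combine:
  assumes u: "birecurrent d x y z u" and w: "birecurrent d x y z w"
  shows "birecurrent d x y z (\<lambda>j. a * u j - b * w j)"
proof -
  have half: "half_recurrent d x y z (\<lambda>j. a * u j - b * w j)"
    if "half_recurrent d x y z u" "half_recurrent d x y z w" for x z and u w :: "nat \<Rightarrow> 'a"
  proof -
    have "y * (a * u 0 - b * w 0) + z * (a * u 1 - b * w 1) = a * (y * u 0 + z * u 1) - b * (y * w 0 + z * w 1)"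
      by (simp add: algebra_simps)
    then show ?thesis
      using that unfolding half_recurrent_def by (simp add: recurrent_diff recurrent_scale)
  qed
  have "x * (a * u (d - 1) - b * w (d - 1)) = a * (x * u (d - 1)) - b * (x * w (d - 1))"
    by (simp add: algebra_simps)
  also have "\<dots> = z * (a * u (d + 1) - b * w (d + 1))"
    using u w by (simp add: birecurrent_def algebra_simps)
  finally show ?thesis
    using u w half unfolding birecurrent_def by blast
qed

text \<open>
  The Pfaffians of size \<open>2d\<close> of the submatrices obtained by deleting one index, up to sign. Deleting an index
  in the first half leaves a power of \<open>z\<close> times a tridiagonal determinant, and the other half is the mirror
  image.
\<close>
definition pfaffian :: "nat \<Rightarrow> 'a::comm_ring_1 \<Rightarrow> 'a \<Rightarrow> 'a \<Rightarrow> nat \<Rightarrow> 'a" where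
  "pfaffian d x y z j = (if j \<le> d then z ^ (d - j) * lucas x y z (j + 1)
     else x ^ (j - d) * lucas x y z (2 * d - j + 1))"

lemma lucas_commute: "lucas z y x k = lucas x y z k"
  by (induction x y z k rule: lucas.induct) (simp_all add: mult.commute)

lemma pfaffian_reverse:
  assumes "j \<le> 2 * d" shows "pfaffian d x y z (2 * d - j) = pfaffian d z y x j"
proof -
  consider "j < d" | "j = d" | "j > d" by linarith
  then show ?thesis
  proof cases
    case 1
    then have "\<not> 2 * d - j \<le> d" "2 * d - j - d = d - j" "2 * d - (2 * d - j) = j" by linarith+
    then show ?thesis using 1 by (simp add: pfaffian_def lucas_commute[of z])
  next
    case 2
    then show ?thesis by (simp add: pfaffian_def lucas_commute[of z])
  next
    case 3
    then have "2 * d - j \<le> d" "d - (2 * d - j) = j - d" using assms by linarith+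
    then show ?thesis using 3 by (simp add: pfaffian_def lucas_commute[of z])
  qed
qed

lemma half_recurrent_pfaffian:
  assumes d: "d > 0" shows "half_recurrent d x y z (pfaffian d x y z)"
  unfolding half_recurrent_def recurrent_def
proof (intro conjI allI impI)
  obtain e where e: "d = Suc e" using d gr0_implies_Suc by blast
  show "y * pfaffian d x y z 0 + z * pfaffian d x y z 1 = 0"
    by (simp add: pfaffian_def e algebra_simps)
  fix r assume "r < d - 1"
  then have "r + 2 \<le> d" by linarith
  then obtain k where k: "d = r + 2 + k" using le_Suc_ex by blast
  have "d - r = Suc (Suc k)" "d - (r + 1) = Suc k" "d - (r + 2) = k" using k by linarith+
  then show "x * pfaffian d x y z r + y * pfaffian d x y z (r + 1) + z * pfaffian d x y z (r + 2) = 0"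
    using k by (simp add: pfaffian_def algebra_simps)
qed

lemma birecurrent_pfaffian:
  assumes d: "d > 0" shows "birecurrent d x y z (pfaffian d x y z)"
  unfolding birecurrent_def
proof (intro conjI half_recurrent_pfaffian d)
  obtain e where e: "d = Suc e" using d gr0_implies_Suc by blast
  show "x * pfaffian d x y z (d - 1) = z * pfaffian d x y z (d + 1)"
    by (simp add: pfaffian_def e)
  have "half_recurrent d z y x (\<lambda>j. pfaffian d x y z (2 * d - j)) = half_recurrent d z y x (pfaffian d z y x)"
    unfolding half_recurrent_def using d pfaffian_reverse[of _ d x y z] pfaffian_reverse[of 0 d x y z]
    by (intro arg_cong2[where f = "(\<and>)"] recurrent_cong) simp_all
  then show "half_recurrent d z y x (\<lambda>j. pfaffian d x y z (2 * d - j))"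
    using half_recurrent_pfaffian[OF d] by blast
qed

lemma pfaffian_first: "pfaffian d x y z 0 = z ^ d"
  by (simp add: pfaffian_def)

lemma pfaffian_last: "d > 0 \<Longrightarrow> pfaffian d x y z (2 * d) = x ^ d"
  by (simp add: pfaffian_def)

text \<open>
  The second column takes care of the zero row and column of \<^const>\<open>gorenstein_mat\<close>.
\<close>
definition pfaffian_syz_mat :: "nat \<Rightarrow> 'a::comm_ring_1 \<Rightarrow> 'a \<Rightarrow> 'a \<Rightarrow> 'a mat" where
  "pfaffian_syz_mat d x y z = mat (2 * d + 2) 2 (\<lambda>(i, j).
     if i \<le> 2 * d then (if j = 0 then pfaffian d x y z i else 0) else if j = 1 then 1 else 0)"

lemma pfaffian_syz_mat_carrier: "pfaffian_syz_mat d x y z \<in> carrier_mat (2 * d + 2) 2"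
  by (simp add: pfaffian_syz_mat_def)

lemma pfaffian_syz_mat_mult:
  assumes u: "u \<in> carrier_vec 2" and i: "i < 2 * d + 2"
  shows "(pfaffian_syz_mat d x y z *\<^sub>v u) $ i = (if i \<le> 2 * d then pfaffian d x y z i * u $ 0 else u $ 1)"
proof -
  have "(pfaffian_syz_mat d x y z *\<^sub>v u) $ i = (\<Sum>j<2. pfaffian_syz_mat d x y z $$ (i, j) * u $ j)"
    by (rule mult_mat_vec_index[OF pfaffian_syz_mat_carrier u i])
  then show ?thesis using i by (simp add: pfaffian_syz_mat_def numeral_2_eq_2)
qed

lemma birecurrent_cong:
  assumes "d > 0" "\<And>j. j \<le> 2 * d \<Longrightarrow> v j = w j"
  shows "birecurrent d x y z v \<longleftrightarrow> birecurrent d x y z w"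
  unfolding birecurrent_def half_recurrent_def using assms
  by (intro arg_cong2[where f = "(\<and>)"] recurrent_cong) simp_all

lemma gorenstein_pfaffian_zero:
  assumes d: "d > 0" and u: "u \<in> carrier_vec 2"
  shows "gorenstein_mat d x y z *\<^sub>v (pfaffian_syz_mat d x y z *\<^sub>v u) = 0\<^sub>v (2 * d + 2)"
proof -
  let ?w = "pfaffian_syz_mat d x y z *\<^sub>v u"
  have w: "?w \<in> carrier_vec (2 * d + 2)" using mult_mat_vec_carrier[OF pfaffian_syz_mat_carrier u] .
  have "birecurrent d x y z (\<lambda>j. u $ 0 * pfaffian d x y z j - 0 * pfaffian d x y z j)"
    by (intro birecurrent_combine birecurrent_pfaffian d)
  also have "birecurrent d x y z (\<lambda>j. u $ 0 * pfaffian d x y z j - 0 * pfaffian d x y z j) =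
      birecurrent d x y z (\<lambda>j. ?w $ j)"
    by (rule birecurrent_cong[OF d]) (subst pfaffian_syz_mat_mult[OF u], simp_all add: mult.commute)
  finally show ?thesis using gorenstein_mat_kernel_iff[OF w d] by blast
qed

abbreviation gorenstein :: "nat \<Rightarrow> mpoly3 mat" where
  "gorenstein d \<equiv> gorenstein_mat d (var 0) (var 1) (var 2)"

abbreviation pfaffian_syz :: "nat \<Rightarrow> mpoly3 mat" where
  "pfaffian_syz d \<equiv> pfaffian_syz_mat d (var 0) (var 1) (var 2)"

lemma pfaffian_syz_kernel: "mat_kernel (pfaffian_syz d) = {0\<^sub>v 2}"
proof -
  have "u = 0\<^sub>v 2" if u: "u \<in> carrier_vec 2" "pfaffian_syz d *\<^sub>v u = 0\<^sub>v (2 * d + 2)" for u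
  proof -
    have "(pfaffian_syz d *\<^sub>v u) $ 0 = 0" "(pfaffian_syz d *\<^sub>v u) $ (2 * d + 1) = 0"
      using u(2) by simp_all
    then have "u $ 0 = 0" "u $ 1 = 0"
      by (simp_all add: pfaffian_syz_mat_mult[OF u(1)] pfaffian_first del: index_mult_mat_vec)
    then have "u $ i = 0" if "i < 2" for i using less_2_cases[OF that] by auto
    then show ?thesis using u(1) by (intro eq_vecI) auto
  qed
  moreover have "pfaffian_syz d *\<^sub>v 0\<^sub>v 2 = 0\<^sub>v (2 * d + 2)"
    by (intro eq_vecI) (auto simp: pfaffian_syz_mat_def scalar_prod_def)
  ultimately show ?thesis by (auto simp: mat_kernel[OF pfaffian_syz_mat_carrier])
qed

text \<open>
  The first Pfaffian is \<open>x\<^sub>2\<^sup>d\<close> and the last one is \<open>x\<^sub>0\<^sup>d\<close>. For a kernel vector \<open>w\<close> the combination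
  \<open>x\<^sub>2\<^sup>d w - w\<^sub>0 p\<close> with the Pfaffian vector \<open>p\<close> is in the kernel and starts with 0, hence it vanishes; in the
  same way at the other end.
\<close>
lemma gorenstein_kernel:
  assumes d: "d > 0" shows "mat_kernel (gorenstein d) = mat_image (pfaffian_syz d)"
proof (rule exact_by_saturation[where i = 2 and j = 0 and k = d and ?\<phi>3.0 = "0\<^sub>m 2 0" and ?n3.0 = 0,
      OF gorenstein_mat_carrier pfaffian_syz_mat_carrier])
  fix w :: "mpoly3 vec" assume w: "w \<in> carrier_vec (2 * d + 2)" and zero: "gorenstein d *\<^sub>v w = 0\<^sub>v (2 * d + 2)"
  let ?p = "pfaffian d (var 0) (var 1) (var 2)"
  have bi: "birecurrent d (var 0) (var 1) (var 2) (\<lambda>j. w $ j)"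
    using zero gorenstein_mat_kernel_iff[OF w d] by blast
  have combined: "birecurrent d (var 0) (var 1) (var 2) (\<lambda>j. c * w $ j - b * ?p j)" for c b
    by (intro birecurrent_combine bi birecurrent_pfaffian d)
  have solve: "\<exists>u\<in>carrier_vec 2. c \<cdot>\<^sub>v w = pfaffian_syz d *\<^sub>v u"
    if eq: "\<And>j. j \<le> 2 * d \<Longrightarrow> c * w $ j - b * ?p j = 0" for b c
  proof
    let ?u = "vec 2 (\<lambda>i. if i = 0 then b else c * w $ (2 * d + 1))"
    show u: "?u \<in> carrier_vec 2" by simp
    show "c \<cdot>\<^sub>v w = pfaffian_syz d *\<^sub>v ?u"
    proof (rule eq_vecI)
      fix i assume "i < dim_vec (pfaffian_syz d *\<^sub>v ?u)"
      then have i: "i < 2 * d + 2" by (simp add: pfaffian_syz_mat_def)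
      show "(c \<cdot>\<^sub>v w) $ i = (pfaffian_syz d *\<^sub>v ?u) $ i"
      proof (cases "i \<le> 2 * d")
        case True
        then show ?thesis using w i eq[OF True]
          unfolding pfaffian_syz_mat_mult[OF u i] by (simp add: mult.commute)
      next
        case False
        then have "i = 2 * d + 1" using i by linarith
        then show ?thesis using w unfolding pfaffian_syz_mat_mult[OF u i] by simp
      qed
    qed (use w in \<open>simp add: pfaffian_syz_mat_def\<close>)
  qed
  show "\<exists>u\<in>carrier_vec 2. var 2 ^ d \<cdot>\<^sub>v w = pfaffian_syz d *\<^sub>v u"
    by (rule solve[where b = "w $ 0"], rule birecurrent_zero_forward[OF combined d var_nonzero])
      (simp_all add: pfaffian_first mult.commute)
  show "\<exists>u\<in>carrier_vec 2. var 0 ^ d \<cdot>\<^sub>v w = pfaffian_syz d *\<^sub>v u"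
  proof (rule solve[where b = "w $ (2 * d)"])
    fix j assume "j \<le> 2 * d"
    then show "var 0 ^ d * w $ j - w $ (2 * d) * ?p j = 0"
      by (rule birecurrent_zero_backward[OF combined d var_nonzero, rotated])
        (simp only: pfaffian_last[OF d] mult.commute[of "var 0 ^ d"] diff_self)
  qed
qed (simp_all add: gorenstein_pfaffian_zero[OF d] pfaffian_syz_kernel mat_image_no_columns)

lemma is_form_pfaffian:
  assumes "j \<le> 2 * d" shows "is_form (int d) (pfaffian d (var 0) (var 1) (var 2) j)"
proof -
  have form: "is_form (int d) (var i ^ a * lucas (var 0) (var 1) (var 2) b)" if "int a + (int b - 1) = int d" for i a b
    unfolding that[symmetric] by (intro is_form_mult is_form_var_power is_form_lucas)
  show ?thesis unfolding pfaffian_def using assms by (auto intro!: form)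
qed

lemma gorenstein_resolution:
  assumes d: "d > 0"
  shows "graded_free_resolution (replicate (2 * d + 2) 0) (replicate (2 * d + 2) (- 1))
    [- int d - 1, - 1] [] (gorenstein d) (pfaffian_syz d) (0\<^sub>m 2 0)"
  unfolding graded_free_resolution_def
proof (intro conjI)
  show "graded_map (replicate (2 * d + 2) (- 1)) (replicate (2 * d + 2) 0) (gorenstein d)"
    unfolding graded_map_replicate_iff by (auto simp: gorenstein_mat_def is_form_band is_form_uminus)
  show "graded_map [- int d - 1, - 1] (replicate (2 * d + 2) (- 1)) (pfaffian_syz d)"
    unfolding graded_map_def length_replicate
  proof (intro conjI allI impI)
    show "pfaffian_syz d \<in> carrier_mat (2 * d + 2) (length [- int d - 1, - 1])"
      unfolding length_Cons list.size(3) numeral_2_eq_2[symmetric] by (rule pfaffian_syz_mat_carrier)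
  next
    fix i j assume i: "i < 2 * d + 2" and "j < length [- int d - 1, - 1]"
    then have "j = 0 \<or> j = 1" by auto
    then show "is_form (replicate (2 * d + 2) (- 1) ! i - [- int d - 1, - 1] ! j) (pfaffian_syz d $$ (i, j))"
      using i is_form_pfaffian[of i d] by (auto simp: pfaffian_syz_mat_def simp del: replicate.simps)
  qed
  show "graded_map [] [- int d - 1, - 1] (0\<^sub>m 2 0)"
    by (simp add: graded_map_def numeral_2_eq_2)
qed (simp_all add: gorenstein_kernel[OF d] pfaffian_syz_kernel mat_image_no_columns mat_kernel_no_columns)

lemma eval_gorenstein: "eval_mat (gorenstein d) v = gorenstein_mat d (v 0) (v 1) (v 2)"
  by (rule eq_matI) (auto simp: eval_mat_def gorenstein_mat_def eval_band eval3_uminus eval3_0)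

lemma rank_gorenstein_mat:
  fixes x y z :: complex
  assumes d: "d > 0" and nz: "x \<noteq> 0 \<or> y \<noteq> 0 \<or> z \<noteq> 0"
  shows "vec_space.rank (2 * d + 2) (gorenstein_mat d x y z) = 2 * d"
proof -
  have ker: "birecurrent d x y z (\<lambda>j. w $ j)"
    if "w \<in> carrier_vec (2 * d + 2)" "gorenstein_mat d x y z *\<^sub>v w = 0\<^sub>v (2 * d + 2)" for w
    using gorenstein_mat_kernel_iff[OF that(1) d] that(2) by blast
  obtain a where a: "a \<le> 2 * d" "pfaffian d x y z a \<noteq> 0"
    and zero: "\<And>w j. birecurrent d x y z w \<Longrightarrow> w a = 0 \<Longrightarrow> j \<le> 2 * d \<Longrightarrow> w j = 0"
  proof -
    consider "z \<noteq> 0" | "x \<noteq> 0" | "x = 0" "z = 0" "y \<noteq> 0" using nz by blast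
    then show thesis
    proof cases
      case 1
      show thesis
        by (rule that[of 0]) (use 1 birecurrent_zero_forward[OF _ d 1] in \<open>simp_all only: pfaffian_first power_not_zero not_False_eq_True le0\<close>)
    next
      case 2
      show thesis
        by (rule that[of "2 * d"]) (use 2 birecurrent_zero_backward[OF _ d 2] in \<open>simp_all only: pfaffian_last[OF d] power_not_zero not_False_eq_True le_refl\<close>)
    next
      case 3
      have half: "w j = 0" if "half_recurrent d x y z w" "j < d" for w j
        using that(1)[unfolded half_recurrent_iff[OF d], rule_format, OF that(2)] 3 by (simp split: if_splits)
      have half': "w j = 0" if "half_recurrent d z y x w" "j < d" for w j
        using that(1)[unfolded half_recurrent_iff[OF d], rule_format, OF that(2)] 3 by (simp split: if_splits)
      have zero: "w j = 0" if w: "birecurrent d x y z w" "w d = 0" and j: "j \<le> 2 * d" for w j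
      proof -
        consider "j < d" | "j = d" | "2 * d - j < d" "2 * d - (2 * d - j) = j" using j by linarith
        then show ?thesis
        proof cases
          case 3
          then show ?thesis using half'[of "\<lambda>j. w (2 * d - j)" "2 * d - j"] w(1) by (simp add: birecurrent_def)
        qed (use half[of w j] w in \<open>simp_all add: birecurrent_def\<close>)
      qed
      have "pfaffian d x y z d \<noteq> 0" using 3 lucas_product_zero[of y d] by (simp add: pfaffian_def)
      then show thesis using zero by (intro that[of d]) simp_all
    qed
  qed
  let ?col = "\<lambda>k. pfaffian_syz_mat d x y z *\<^sub>v unit_vec 2 k"
  have col: "?col k \<in> carrier_vec (2 * d + 2)" "gorenstein_mat d x y z *\<^sub>v ?col k = 0\<^sub>v (2 * d + 2)" for k
    using mult_mat_vec_carrier[OF pfaffian_syz_mat_carrier, of "unit_vec 2 k"] gorenstein_pfaffian_zero[OF d, of "unit_vec 2 k"]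
    by simp_all
  have col_index: "?col k $ i = (if i \<le> 2 * d then pfaffian d x y z i * unit_vec 2 k $ 0 else unit_vec 2 k $ 1)"
    if "i < 2 * d + 2" for i k
    by (rule pfaffian_syz_mat_mult[OF unit_vec_carrier that])
  have "vec_space.rank (2 * d + 2) (gorenstein_mat d x y z) = 2 * d + 2 - 2"
  proof (rule rank_eq_if_kernel_coordinates[where a = a and b = "2 * d + 1" and u = "?col 0" and v = "?col 1",
        OF gorenstein_mat_carrier])
    fix w :: "complex vec" assume w: "w \<in> carrier_vec (2 * d + 2)" "gorenstein_mat d x y z *\<^sub>v w = 0\<^sub>v (2 * d + 2)"
      "w $ a = 0" "w $ (2 * d + 1) = 0"
    show "w = 0\<^sub>v (2 * d + 2)"
    proof (rule eq_vecI)
      fix i assume "i < dim_vec (0\<^sub>v (2 * d + 2) :: complex vec)"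
      then have i: "i < 2 * d + 2" by simp
      then consider "i \<le> 2 * d" | "i = 2 * d + 1" by linarith
      then have "w $ i = 0" using zero[OF ker[OF w(1,2)] w(3)] w(4) by cases blast+
      then show "w $ i = 0\<^sub>v (2 * d + 2) $ i" using i by simp
    qed (use w in simp)
  next
    show "?col 0 $ a \<noteq> 0" "?col 0 $ (2 * d + 1) = 0" "?col 1 $ a = 0" "?col 1 $ (2 * d + 1) \<noteq> 0"
      using a by (simp_all only: col_index) simp_all
  qed (use a col in simp_all)
  then show ?thesis by simp
qed

text \<open>
  The cokernel is \<open>O + O(d)\<close>, with total Chern class \<open>1 + d h\<close>.
\<close>
theorem m_effective_gorenstein:
  assumes d: "d > 0" shows "m_effective (int d) 0"
  unfolding m_effective_def
proof (intro exI conjI)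
  show "int (2 * d + 2) = 2 * int d + 2" "int (2 * d) = 2 * int d" by simp_all
  show "skew_linear_matrix (2 * d + 2) (gorenstein d)"
    unfolding skew_linear_matrix_def using gorenstein_mat_skew
    by (auto simp: gorenstein_mat_def is_form_band is_form_uminus)
  show "spans_dim3 (2 * d + 2) (gorenstein d)"
    unfolding spans_dim3_def eval_gorenstein
  proof (intro allI impI)
    fix v :: "3 \<Rightarrow> complex" and i :: 3
    assume zero: "gorenstein_mat d (v 0) (v 1) (v 2) = 0\<^sub>m (2 * d + 2) (2 * d + 2)"
    have "gorenstein_mat d (v 0) (v 1) (v 2) $$ (0, 2 * d - 1) = 0"
      "gorenstein_mat d (v 0) (v 1) (v 2) $$ (0, 2 * d) = 0" "gorenstein_mat d (v 0) (v 1) (v 2) $$ (1, 2 * d) = 0"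
      unfolding zero by simp_all
    then have "v 0 = 0" "v 1 = 0" "v 2 = 0"
      using d by (simp_all add: gorenstein_mat_def band_def split: if_splits)
    then show "v i = 0" using all_three[of "\<lambda>i. v i = 0"] by blast
  qed
  show "constant_rank (2 * d + 2) (2 * d) (gorenstein d)"
    unfolding constant_rank_def eval_gorenstein nonzero_three using rank_gorenstein_mat[OF d] by blast
  show "coker_has_chern_classes (replicate (2 * d + 2) 0) (replicate (2 * d + 2) (- 1)) (gorenstein d) (int d) 0"
    unfolding coker_has_chern_classes_def whitney_iff
  proof (intro exI conjI)
    show "graded_free_resolution (replicate (2 * d + 2) 0) (replicate (2 * d + 2) (- 1))
      [- int d - 1, - 1] [] (gorenstein d) (pfaffian_syz d) (0\<^sub>m 2 0)"
      by (rule gorenstein_resolution[OF d])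
  qed (simp_all add: sum_list_replicate power2_eq_square algebra_simps)
qed

section \<open>The range of the second Chern class\<close>

theorem proposition3p2:
  fixes c y :: nat
  shows "(m_effective (int c) (int y) \<longrightarrow> c > 0 \<and> 0 \<le> y \<and> y \<le> (c + 1) choose 2) \<and>
    (\<forall>d::nat. d > 0 \<longrightarrow> m_effective (int d) 0 \<and> m_effective (int d) (int ((d + 1) choose 2)))"
  using m_effective_c1_positive m_effective_c2_bound m_effective_gorenstein m_effective_steiner by blast

end
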